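(* Let $X$ be a complex manifold, $i\colon Y\hookrightarrow X$ a compact complex submanifold, and $L$ a holomorphic line bundle on $X$ whose restriction $L|_Y$ is a unitary flat line bundle on $Y$. Let $r\ge 2$ be an integer. If the generalized first Ueda obstruction class $u_1(Y,X,L)\in H^1(Y,i^*\Omega^1_X)$ is nonzero, then $L$ admits no Hermitian metric of class $C^r$ with semi-positive Chern curvature.
   Context: For $r\ge 2$ a Hermitian metric of class $C^r$ on $L$ has a Chern curvature form with $C^{r-2}$ (in particular continuous) coefficients; it is semi-positive if it is a semi-positive $(1,1)$-form at every point of $X$. A holomorphic line bundle is unitary flat if it can be given by locally constant transition functions with values in $\mathrm{U}(1)$. Generalized first Ueda obstruction class. Let $X$ be a complex manifold, $i\colon Y\hookrightarrow X$ a closed embedding of a reduced analytic subvariety, and $L$ a holomorphic line bundle on $X$. Here $i^{-1}$ denotes the inverse image functor for sheaves of abelian groups, and $i^*\mathcal F:=i^{-1}\mathcal F\otimes_{i^{-1}\mathcal O_X}\mathcal O_Y$ is the inverse image of an $\mathcal O_X$-module $\mathcal F$; there is a canonical morphism $i^{-1}\mathcal F\to i^*\mathcal F$. Let $[L]\in H^1(Y,i^{-1}\mathcal O_X^* )$ be the image of the class of $L$ in $H^1(X,\mathcal O_X^* )$ under the natural map $H^1(X,\mathcal O_X^* )\to H^1(X,i_*i^{-1}\mathcal O_X^* )\simeq H^1(Y,i^{-1}\mathcal O_X^* )$. Let $d\mathcal O_X\subset\Omega^1_X$ be the subsheaf of (locally) exact holomorphic $1$-forms. Then $u_1(Y,X,L)\in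 H^1(Y,i^*\Omega^1_X)$ is the image of $[L]$ under $$H^1(Y,i^{-1}\mathcal O_X^* )\xrightarrow{d\log}H^1(Y,i^{-1}d\mathcal O_X)\to H^1(Y,i^{-1}\Omega_X^1)\to H^1(Y,i^*\Omega_X^1),$$ where $d\log$ is induced by $f\mapsto df/f$, the second map by the inclusion $d\mathcal O_X\hookrightarrow\Omega^1_X$, and the third by $i^{-1}\Omega^1_X\to i^*\Omega^1_X$. *)

theory Defs
  imports "HOL-Analysis.Analysis" "HOL-Algebra.Free_Abelian_Groups" "HOL-Algebra.Module"
begin

section \<open>Complex manifolds and submanifolds\<close>

definition cholo_on :: "(complex^'n::finite) set \<Rightarrow> (complex^'n \<Rightarrow> complex) \<Rightarrow> bool" where
  "cholo_on S f \<longleftrightarrow>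
     (\<forall>z\<in>S. \<exists>D. (f has_derivative D) (at z) \<and> (\<forall>c v. D (c *s v) = c * D v))"

type_synonym ('a, 'n) chart = "'a set \<times> ('a \<Rightarrow> complex^'n)"

definition is_chart :: "'a topology \<Rightarrow> ('a, 'n::finite) chart \<Rightarrow> bool" where
  "is_chart X = (\<lambda>(U, \<phi>). openin X U \<and> open (\<phi> ` U) \<and>
     homeomorphic_map (subtopology X U) (top_of_set (\<phi> ` U)) \<phi>)"

definition transition_holo :: "('a, 'n::finite) chart \<Rightarrow> ('a, 'n) chart \<Rightarrow> bool" where
  "transition_holo = (\<lambda>(U, \<phi>) (V, \<psi>).
     \<forall>i. cholo_on (\<phi> ` (U \<inter> V)) (\<lambda>z. \<psi> (inv_into U \<phi> z) $ i))"

text \<open>The holomorphic structure is a maximal atlas.  Charts are total functions; their values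
  outside their domain are irrelevant.\<close>

definition complex_manifold :: "'a topology \<Rightarrow> ('a, 'n::finite) chart set \<Rightarrow> bool" where
  "complex_manifold X A \<longleftrightarrow>
     Hausdorff_space X \<and> second_countable X \<and>
     (\<forall>c\<in>A. is_chart X c) \<and>
     (\<forall>x\<in>topspace X. \<exists>c\<in>A. x \<in> fst c) \<and>
     (\<forall>c\<in>A. \<forall>d\<in>A. transition_holo c d) \<and>
     (\<forall>c. is_chart X c \<and> (\<forall>d\<in>A. transition_holo c d \<and> transition_holo d c) \<longrightarrow> c \<in> A)"

text \<open>The codimension of \<open>Y\<close> at a point is the number of equations \<open>card I\<close>; it may depend on the
  component of \<open>Y\<close>.\<close>

definition complex_submanifold ::
    "'a topology \<Rightarrow> ('a, 'n::finite) chart set \<Rightarrow> 'a set \<Rightarrow> bool" where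
  "complex_submanifold X A Y \<longleftrightarrow> Y \<subseteq> topspace X \<and>
     (\<forall>y\<in>Y. \<exists>(W, \<phi>)\<in>A. \<exists>I. y \<in> W \<and> \<phi> ` (W \<inter> Y) = {z \<in> \<phi> ` W. \<forall>i\<in>I. z $ i = 0})"

definition holo_fun :: "('a, 'n::finite) chart set \<Rightarrow> 'a set \<Rightarrow> ('a \<Rightarrow> complex) \<Rightarrow> bool" where
  "holo_fun A U f \<longleftrightarrow> (\<forall>(W, \<phi>)\<in>A. cholo_on (\<phi> ` (U \<inter> W)) (\<lambda>z. f (inv_into W \<phi> z)))"

section \<open>Sheaves of abelian groups\<close>

text \<open>A sheaf is represented as a sheaf of functions: a section over \<open>U\<close> is a function on \<open>U\<close> whose
  value at \<open>x\<close> lies in the abelian group \<open>vals F x\<close>, and restriction is restriction of functions.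
  Every sheaf has this form, with its stalks as value groups.  Sections are total functions
  whose values outside \<open>U\<close> are irrelevant.\<close>

record ('a, 's) sheaf =
  vals :: "'a \<Rightarrow> 's monoid"
  sections :: "'a set \<Rightarrow> ('a \<Rightarrow> 's) set"

record ('a, 's) O_module = "('a, 's) sheaf" +
  act :: "complex \<Rightarrow> 's \<Rightarrow> 's"

definition germ :: "'a topology \<Rightarrow> 'a \<Rightarrow> ('a \<Rightarrow> 's) \<Rightarrow> ('a \<Rightarrow> 's) set" where
  "germ T y f = {g. \<exists>N. openin T N \<and> y \<in> N \<and> (\<forall>x\<in>N. g x = f x)}"

definition stalk ::
    "'a topology \<Rightarrow> ('a, 's, 'z) sheaf_scheme \<Rightarrow> 'a \<Rightarrow> ('a \<Rightarrow> 's) set monoid" where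
  "stalk T F y =
     \<lparr> carrier = {germ T y f | U f. openin T U \<and> y \<in> U \<and> f \<in> sections F U},
       mult = (\<lambda>a b. \<Union>f\<in>a. \<Union>g\<in>b. germ T y (\<lambda>x. f x \<otimes>\<^bsub>vals F x\<^esub> g x)),
       one = germ T y (\<lambda>x. \<one>\<^bsub>vals F x\<^esub>) \<rparr>"

text \<open>The functor \<open>i\<inverse>\<close> for the inclusion of a subspace \<open>Y\<close>: sections are the
  functions with values in the stalks of \<open>F\<close> that are locally induced by sections of \<open>F\<close>.\<close>

definition inverse_image ::
    "'a topology \<Rightarrow> 'a set \<Rightarrow> ('a, 's, 'z) sheaf_scheme \<Rightarrow> ('a, ('a \<Rightarrow> 's) set) sheaf" where
  "inverse_image X Y F =
     \<lparr> vals = stalk X F,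
       sections = (\<lambda>V. {s. openin (subtopology X Y) V \<and>
         (\<forall>y\<in>V. \<exists>U f. openin X U \<and> y \<in> U \<and> f \<in> sections F U \<and>
                 (\<forall>z\<in>U \<inter> V. s z = germ X z f))}) \<rparr>"

section \<open>The first cohomology group\<close>

text \<open>\<open>H\<^sup>1\<close> as the direct limit of Cech cohomology over open coverings.  As in Godement, only
  coverings \<open>(U x)\<close> indexed by the points of the space, with \<open>x \<in> U x\<close>, are used.  They are
  cofinal among all open coverings, and any two have the common refinement \<open>U x \<inter> U' x\<close>.  Elements
  of the group are equivalence classes of pairs of a covering and a 1-cocycle on it.\<close>

type_synonym ('a, 's) cochain = "('a \<Rightarrow> 'a set) \<times> ('a \<Rightarrow> 'a \<Rightarrow> 'a \<Rightarrow> 's)"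

definition cocycles :: "'a topology \<Rightarrow> ('a, 's, 'z) sheaf_scheme \<Rightarrow> ('a, 's) cochain set" where
  "cocycles T F = {(U, c).
     (\<forall>x\<in>topspace T. openin T (U x) \<and> x \<in> U x) \<and>
     (\<forall>x\<in>topspace T. \<forall>y\<in>topspace T. c x y \<in> sections F (U x \<inter> U y)) \<and>
     (\<forall>x\<in>topspace T. \<forall>y\<in>topspace T. \<forall>z\<in>topspace T. \<forall>p\<in>U x \<inter> U y \<inter> U z.
        c x y p \<otimes>\<^bsub>vals F p\<^esub> c y z p = c x z p)}"

definition cohomologous ::
    "'a topology \<Rightarrow> ('a, 's, 'z) sheaf_scheme \<Rightarrow> (('a, 's) cochain \<times> ('a, 's) cochain) set" where
  "cohomologous T F = {((U, c), (U', c')).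
     (U, c) \<in> cocycles T F \<and> (U', c') \<in> cocycles T F \<and>
     (\<exists>V b.
        (\<forall>x\<in>topspace T. openin T (V x) \<and> x \<in> V x \<and> V x \<subseteq> U x \<inter> U' x \<and> b x \<in> sections F (V x)) \<and>
        (\<forall>x\<in>topspace T. \<forall>y\<in>topspace T. \<forall>p\<in>V x \<inter> V y.
           b x p \<otimes>\<^bsub>vals F p\<^esub> c' x y p = c x y p \<otimes>\<^bsub>vals F p\<^esub> b y p))}"

definition coh_class ::
    "'a topology \<Rightarrow> ('a, 's, 'z) sheaf_scheme \<Rightarrow> ('a, 's) cochain \<Rightarrow> ('a, 's) cochain set" where
  "coh_class T F u = cohomologous T F `` {u}"

definition H1 :: "'a topology \<Rightarrow> ('a, 's, 'z) sheaf_scheme \<Rightarrow> ('a, 's) cochain set monoid" where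
  "H1 T F =
     \<lparr> carrier = cocycles T F // cohomologous T F,
       mult = (\<lambda>a b. \<Union>(U, c)\<in>a. \<Union>(V, d)\<in>b.
         coh_class T F (\<lambda>x. U x \<inter> V x, \<lambda>x y p. c x y p \<otimes>\<^bsub>vals F p\<^esub> d x y p)),
       one = coh_class T F (\<lambda>x. topspace T, \<lambda>x y p. \<one>\<^bsub>vals F p\<^esub>) \<rparr>"

text \<open>The map into \<open>H1 T G\<close> induced by a sheaf morphism to \<open>G\<close> given by the maps \<open>h p\<close> of value
  groups.\<close>

definition H1_map ::
    "'a topology \<Rightarrow> ('a, 't, 'z) sheaf_scheme \<Rightarrow> ('a \<Rightarrow> 's \<Rightarrow> 't) \<Rightarrow>
     ('a, 's) cochain set \<Rightarrow> ('a, 't) cochain set" where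
  "H1_map T G h a = (\<Union>(U, c)\<in>a. coh_class T G (U, \<lambda>x y p. h p (c x y p)))"

text \<open>The natural map \<open>H\<^sup>1(X, F) \<rightarrow> H\<^sup>1(X, i\<^sub>* i\<inverse> F) \<simeq> H\<^sup>1(Y, i\<inverse> F)\<close>: a cocycle of \<open>F\<close> on a covering
  \<open>U\<close> goes to the cocycle of its germs along \<open>Y\<close>, on the covering of \<open>Y\<close> by the sets
  \<open>U y \<inter> Y\<close>.\<close>

definition H1_restrict ::
    "'a topology \<Rightarrow> 'a set \<Rightarrow> ('a, 's, 'z) sheaf_scheme \<Rightarrow>
     ('a, 's) cochain set \<Rightarrow> ('a, ('a \<Rightarrow> 's) set) cochain set" where
  "H1_restrict X Y F a = (\<Union>(U, c)\<in>a.
     coh_class (subtopology X Y) (inverse_image X Y F)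
       (\<lambda>x. U x \<inter> Y, \<lambda>x y p. germ X p (c x y)))"

section \<open>Structure sheaves and holomorphic 1-forms\<close>

definition add_complex :: "complex monoid" where
  "add_complex = \<lparr> carrier = UNIV, mult = (+), one = 0 \<rparr>"

definition mult_complex :: "complex monoid" where
  "mult_complex = \<lparr> carrier = - {0}, mult = (*), one = 1 \<rparr>"

definition O_sheaf ::
    "'a topology \<Rightarrow> ('a, 'n::finite) chart set \<Rightarrow> ('a, complex) sheaf" where
  "O_sheaf X A =
     \<lparr> vals = (\<lambda>x. add_complex), sections = (\<lambda>U. {f. openin X U \<and> holo_fun A U f}) \<rparr>"

text \<open>The structure sheaf \<open>O\<^sub>X / I\<^sub>Y\<close> of the reduced subspace \<open>Y\<close>: functions that are locally
  restrictions of holomorphic functions on \<open>X\<close>.\<close>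

definition O_sub ::
    "'a topology \<Rightarrow> ('a, 'n::finite) chart set \<Rightarrow> 'a set \<Rightarrow> ('a, complex) sheaf" where
  "O_sub X A Y =
     \<lparr> vals = (\<lambda>x. add_complex),
       sections = (\<lambda>V. {f. openin (subtopology X Y) V \<and>
         (\<forall>y\<in>V. \<exists>U g. y \<in> U \<and> g \<in> sections (O_sheaf X A) U \<and> (\<forall>x\<in>U \<inter> V. f x = g x))}) \<rparr>"

definition units_sheaf :: "('a, complex) sheaf \<Rightarrow> ('a, complex) sheaf" where
  "units_sheaf F =
     \<lparr> vals = (\<lambda>x. mult_complex), sections = (\<lambda>U. {f \<in> sections F U. \<forall>x\<in>U. f x \<noteq> 0}) \<rparr>"

definition cgrad ::
    "('a, 'n::finite) chart \<Rightarrow> ('a \<Rightarrow> complex) \<Rightarrow> 'a \<Rightarrow> complex^'n" where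
  "cgrad = (\<lambda>(W, \<phi>) f x. \<chi> i. deriv (\<lambda>t. f (inv_into W \<phi> (\<phi> x + axis i t))) 0)"

text \<open>A holomorphic cotangent vector at \<open>x\<close> is given by its components in all charts at \<open>x\<close>,
  subject to the transformation rule
  \<open>\<omega>\<^sub>d = (\<Sum>i. \<omega>\<^sub>c\<^sub>,\<^sub>i * \<partial>\<phi>\<^sub>i / \<partial>\<psi>)\<close>
  for charts \<open>c = (W, \<phi>)\<close> and \<open>d = (V, \<psi>)\<close>.\<close>

type_synonym ('a, 'n) covector = "('a, 'n) chart \<Rightarrow> complex^'n"

definition cotangent ::
    "('a, 'n::finite) chart set \<Rightarrow> 'a \<Rightarrow> ('a, 'n) covector set" where
  "cotangent A x = {\<omega>.
     (\<forall>c. \<not> (c \<in> A \<and> x \<in> fst c) \<longrightarrow> \<omega> c = 0) \<and>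
     (\<forall>c\<in>A. \<forall>d\<in>A. x \<in> fst c \<and> x \<in> fst d \<longrightarrow>
        \<omega> d = (\<Sum>i\<in>UNIV. (\<omega> c $ i) *s cgrad d (\<lambda>p. snd c p $ i) x))}"

definition cotangent_group ::
    "('a, 'n::finite) chart set \<Rightarrow> 'a \<Rightarrow> ('a, 'n) covector monoid" where
  "cotangent_group A x =
     \<lparr> carrier = cotangent A x, mult = (\<lambda>\<omega> \<eta> c. \<omega> c + \<eta> c), one = (\<lambda>c. 0) \<rparr>"

definition Omega1 ::
    "'a topology \<Rightarrow> ('a, 'n::finite) chart set \<Rightarrow> ('a, ('a, 'n) covector) O_module" where
  "Omega1 X A =
     \<lparr> vals = cotangent_group A,
       sections = (\<lambda>U. {\<omega>. openin X U \<and> (\<forall>x\<in>U. \<omega> x \<in> cotangent A x) \<and>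
         (\<forall>c\<in>A. \<forall>i. holo_fun A (U \<inter> fst c) (\<lambda>x. \<omega> x c $ i))}),
       act = (\<lambda>a \<omega> c. a *s \<omega> c) \<rparr>"

definition ext_d ::
    "('a, 'n::finite) chart set \<Rightarrow> ('a \<Rightarrow> complex) \<Rightarrow> 'a \<Rightarrow> ('a, 'n) covector" where
  "ext_d A f x = (\<lambda>c. if c \<in> A \<and> x \<in> fst c then cgrad c f x else 0)"

definition dlog ::
    "('a, 'n::finite) chart set \<Rightarrow> ('a \<Rightarrow> complex) \<Rightarrow> 'a \<Rightarrow> ('a, 'n) covector" where
  "dlog A f x = (\<lambda>c. (1 / f x) *s ext_d A f x c)"

definition dO_sheaf ::
    "'a topology \<Rightarrow> ('a, 'n::finite) chart set \<Rightarrow> ('a, ('a, 'n) covector) sheaf" where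
  "dO_sheaf X A =
     \<lparr> vals = cotangent_group A,
       sections = (\<lambda>U. {\<omega>. openin X U \<and>
         (\<forall>x\<in>U. \<exists>N f. x \<in> N \<and> N \<subseteq> U \<and> f \<in> sections (O_sheaf X A) N \<and>
                 (\<forall>y\<in>N. \<omega> y = ext_d A f y))}) \<rparr>"

section \<open>Tensor products and the inverse image of a module\<close>

definition tensor_relations ::
    "'r ring \<Rightarrow> ('r, 'm) module \<Rightarrow> ('r, 'k) module \<Rightarrow> ('m \<times> 'k \<Rightarrow>\<^sub>0 int) set" where
  "tensor_relations R M N =
     {frag_of (m \<oplus>\<^bsub>M\<^esub> m', n) - frag_of (m, n) - frag_of (m', n) | m m' n.
        m \<in> carrier M \<and> m' \<in> carrier M \<and> n \<in> carrier N} \<union>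
     {frag_of (m, n \<oplus>\<^bsub>N\<^esub> n') - frag_of (m, n) - frag_of (m, n') | m n n'.
        m \<in> carrier M \<and> n \<in> carrier N \<and> n' \<in> carrier N} \<union>
     {frag_of (a \<odot>\<^bsub>M\<^esub> m, n) - frag_of (m, a \<odot>\<^bsub>N\<^esub> n) | a m n.
        a \<in> carrier R \<and> m \<in> carrier M \<and> n \<in> carrier N}"

definition tensor_kernel ::
    "'r ring \<Rightarrow> ('r, 'm) module \<Rightarrow> ('r, 'k) module \<Rightarrow> ('m \<times> 'k \<Rightarrow>\<^sub>0 int) set" where
  "tensor_kernel R M N =
     generate (free_Abelian_group (carrier M \<times> carrier N)) (tensor_relations R M N)"

definition tensor_group ::
    "'r ring \<Rightarrow> ('r, 'm) module \<Rightarrow> ('r, 'k) module \<Rightarrow> ('m \<times> 'k \<Rightarrow>\<^sub>0 int) set monoid" where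
  "tensor_group R M N =
     free_Abelian_group (carrier M \<times> carrier N) Mod tensor_kernel R M N"

definition tensor_elem ::
    "'r ring \<Rightarrow> ('r, 'm) module \<Rightarrow> ('r, 'k) module \<Rightarrow> 'm \<Rightarrow> 'k \<Rightarrow> ('m \<times> 'k \<Rightarrow>\<^sub>0 int) set" where
  "tensor_elem R M N m n =
     tensor_kernel R M N #>\<^bsub>free_Abelian_group (carrier M \<times> carrier N)\<^esub> frag_of (m, n)"

definition O_stalk ::
    "'a topology \<Rightarrow> ('a, 'n::finite) chart set \<Rightarrow> 'a \<Rightarrow> ('a \<Rightarrow> complex) set ring" where
  "O_stalk X A y =
     \<lparr> carrier = carrier (stalk X (O_sheaf X A) y),
       mult = (\<lambda>a b. \<Union>f\<in>a. \<Union>g\<in>b. germ X y (\<lambda>x. f x * g x)),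
       one = germ X y (\<lambda>x. 1),
       zero = \<one>\<^bsub>stalk X (O_sheaf X A) y\<^esub>,
       add = mult (stalk X (O_sheaf X A) y) \<rparr>"

text \<open>The ring operations that the record type of modules inherits play no role for modules, so
  they are left undefined.\<close>

definition stalk_module ::
    "'a topology \<Rightarrow> ('a, 's) O_module \<Rightarrow> 'a \<Rightarrow> (('a \<Rightarrow> complex) set, ('a \<Rightarrow> 's) set) module" where
  "stalk_module X F y =
     \<lparr> carrier = carrier (stalk X F y), mult = undefined, one = undefined,
       zero = \<one>\<^bsub>stalk X F y\<^esub>, add = mult (stalk X F y),
       smult = (\<lambda>a m. \<Union>f\<in>a. \<Union>s\<in>m. germ X y (\<lambda>x. act F (f x) (s x))) \<rparr>"

definition O_sub_stalk_module ::
    "'a topology \<Rightarrow> ('a, 'n::finite) chart set \<Rightarrow> 'a set \<Rightarrow> 'a \<Rightarrow>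
     (('a \<Rightarrow> complex) set, ('a \<Rightarrow> complex) set) module" where
  "O_sub_stalk_module X A Y y =
     \<lparr> carrier = carrier (stalk (subtopology X Y) (O_sub X A Y) y),
       mult = undefined, one = undefined,
       zero = \<one>\<^bsub>stalk (subtopology X Y) (O_sub X A Y) y\<^esub>,
       add = mult (stalk (subtopology X Y) (O_sub X A Y) y),
       smult = (\<lambda>a b. \<Union>f\<in>a. \<Union>g\<in>b. germ (subtopology X Y) y (\<lambda>x. f x * g x)) \<rparr>"

definition pullback_stalk ::
    "'a topology \<Rightarrow> ('a, 'n::finite) chart set \<Rightarrow> 'a set \<Rightarrow> ('a, 's) O_module \<Rightarrow> 'a \<Rightarrow>
     (('a \<Rightarrow> 's) set \<times> ('a \<Rightarrow> complex) set \<Rightarrow>\<^sub>0 int) set monoid" where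
  "pullback_stalk X A Y F y =
     tensor_group (O_stalk X A y) (stalk_module X F y) (O_sub_stalk_module X A Y y)"

definition pullback_elem ::
    "'a topology \<Rightarrow> ('a, 'n::finite) chart set \<Rightarrow> 'a set \<Rightarrow> ('a, 's) O_module \<Rightarrow> 'a \<Rightarrow>
     ('a \<Rightarrow> 's) set \<Rightarrow> ('a \<Rightarrow> complex) set \<Rightarrow>
     (('a \<Rightarrow> 's) set \<times> ('a \<Rightarrow> complex) set \<Rightarrow>\<^sub>0 int) set" where
  "pullback_elem X A Y F y =
     tensor_elem (O_stalk X A y) (stalk_module X F y) (O_sub_stalk_module X A Y y)"

text \<open>\<open>i\<^sup>*F\<close> is the sheaf associated with the presheaf tensor product of \<open>i\<inverse> F\<close> and \<open>O\<^sub>Y\<close> over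
  \<open>i\<inverse> O\<^sub>X\<close>: its sections are locally finite sums of elementary tensors of sections.\<close>

definition module_pullback ::
    "'a topology \<Rightarrow> ('a, 'n::finite) chart set \<Rightarrow> 'a set \<Rightarrow> ('a, 's) O_module \<Rightarrow>
     ('a, (('a \<Rightarrow> 's) set \<times> ('a \<Rightarrow> complex) set \<Rightarrow>\<^sub>0 int) set) sheaf" where
  "module_pullback X A Y F =
     \<lparr> vals = pullback_stalk X A Y F,
       sections = (\<lambda>V. {s. openin (subtopology X Y) V \<and>
         (\<forall>y\<in>V. \<exists>N (k::nat) m h. y \<in> N \<and> N \<subseteq> V \<and> openin (subtopology X Y) N \<and>
            (\<forall>j<k. m j \<in> sections (inverse_image X Y F) N \<and> h j \<in> sections (O_sub X A Y) N) \<and>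
            (\<forall>z\<in>N. s z = finprod (pullback_stalk X A Y F z)
               (\<lambda>j. pullback_elem X A Y F z (m j z) (germ (subtopology X Y) z (h j))) {..<k}))}) \<rparr>"

section \<open>Holomorphic line bundles\<close>

text \<open>A line bundle consists of a total space, a projection and a set of local trivializations.  A
  trivialization over \<open>U\<close> is given by its fibre coordinate \<open>\<tau>\<close>.  Transition functions act by
  multiplication, so the trivializations determine the vector space structure of the fibres.\<close>

record ('a, 'e) line_bundle =
  bundle_space :: "'e topology"
  bundle_proj :: "'e \<Rightarrow> 'a"
  bundle_trivs :: "('a set \<times> ('e \<Rightarrow> complex)) set"

definition over :: "('a, 'e) line_bundle \<Rightarrow> 'a set \<Rightarrow> 'e set" where
  "over L U = {e \<in> topspace (bundle_space L). bundle_proj L e \<in> U}"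

definition local_triv ::
    "'a topology \<Rightarrow> ('a, 'e) line_bundle \<Rightarrow> 'a set \<times> ('e \<Rightarrow> complex) \<Rightarrow> bool" where
  "local_triv T L = (\<lambda>(U, \<tau>). openin T U \<and>
     homeomorphic_map (subtopology (bundle_space L) (over L U))
       (prod_topology (subtopology T U) euclidean) (\<lambda>e. (bundle_proj L e, \<tau> e)))"

definition local_frame ::
    "('a, 'e) line_bundle \<Rightarrow> 'a set \<times> ('e \<Rightarrow> complex) \<Rightarrow> 'a \<Rightarrow> 'e" where
  "local_frame L t x = (THE e. e \<in> over L {x} \<and> snd t e = 1)"

definition transition ::
    "('a, 'e) line_bundle \<Rightarrow> 'a set \<times> ('e \<Rightarrow> complex) \<Rightarrow> 'a set \<times> ('e \<Rightarrow> complex) \<Rightarrow> 'a \<Rightarrow> complex" where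
  "transition L t t' x = snd t (local_frame L t' x)"

text \<open>Here and below \<open>S\<close> is the structure sheaf of the base \<open>T\<close>.\<close>

definition trivs_compatible ::
    "('a, complex) sheaf \<Rightarrow> ('a, 'e) line_bundle \<Rightarrow>
     'a set \<times> ('e \<Rightarrow> complex) \<Rightarrow> 'a set \<times> ('e \<Rightarrow> complex) \<Rightarrow> bool" where
  "trivs_compatible S L t t' \<longleftrightarrow>
     transition L t t' \<in> sections (units_sheaf S) (fst t \<inter> fst t') \<and>
     (\<forall>e\<in>over L (fst t \<inter> fst t'). snd t e = transition L t t' (bundle_proj L e) * snd t' e)"

definition holomorphic_line_bundle ::
    "'a topology \<Rightarrow> ('a, complex) sheaf \<Rightarrow> ('a, 'e) line_bundle \<Rightarrow> bool" where
  "holomorphic_line_bundle T S L \<longleftrightarrow>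
     continuous_map (bundle_space L) T (bundle_proj L) \<and>
     (\<forall>t\<in>bundle_trivs L. local_triv T L t) \<and>
     (\<forall>x\<in>topspace T. \<exists>t\<in>bundle_trivs L. x \<in> fst t) \<and>
     (\<forall>t\<in>bundle_trivs L. \<forall>t'\<in>bundle_trivs L. trivs_compatible S L t t')"

definition holo_triv ::
    "'a topology \<Rightarrow> ('a, complex) sheaf \<Rightarrow> ('a, 'e) line_bundle \<Rightarrow>
     'a set \<times> ('e \<Rightarrow> complex) \<Rightarrow> bool" where
  "holo_triv T S L t \<longleftrightarrow> local_triv T L t \<and>
     (\<forall>t'\<in>bundle_trivs L. trivs_compatible S L t t' \<and> trivs_compatible S L t' t)"

definition restrict_bundle :: "('a, 'e) line_bundle \<Rightarrow> 'a set \<Rightarrow> ('a, 'e) line_bundle" where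
  "restrict_bundle L Y =
     \<lparr> bundle_space = subtopology (bundle_space L) (over L Y),
       bundle_proj = bundle_proj L,
       bundle_trivs = (\<lambda>(U, \<tau>). (U \<inter> Y, \<tau>)) ` bundle_trivs L \<rparr>"

definition locally_constant_on :: "'a topology \<Rightarrow> 'a set \<Rightarrow> ('a \<Rightarrow> 'b) \<Rightarrow> bool" where
  "locally_constant_on T U g \<longleftrightarrow>
     (\<forall>x\<in>U. \<exists>N. openin T N \<and> x \<in> N \<and> (\<forall>y\<in>N \<inter> U. g y = g x))"

definition unitary_flat ::
    "'a topology \<Rightarrow> ('a, complex) sheaf \<Rightarrow> ('a, 'e) line_bundle \<Rightarrow> bool" where
  "unitary_flat T S L \<longleftrightarrow> (\<exists>\<T>.
     (\<forall>t\<in>\<T>. holo_triv T S L t) \<and>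
     (\<forall>x\<in>topspace T. \<exists>t\<in>\<T>. x \<in> fst t) \<and>
     (\<forall>t\<in>\<T>. \<forall>t'\<in>\<T>. locally_constant_on T (fst t \<inter> fst t') (transition L t t') \<and>
        (\<forall>x\<in>fst t \<inter> fst t'. cmod (transition L t t' x) = 1)))"

text \<open>The class of \<open>L\<close> in \<open>H\<^sup>1(T, S\<^sup>*)\<close>.  All choices of local trivializations give the same class.\<close>

definition bundle_class ::
    "'a topology \<Rightarrow> ('a, complex) sheaf \<Rightarrow> ('a, 'e) line_bundle \<Rightarrow> ('a, complex) cochain set" where
  "bundle_class T S L =
     (\<Union>t\<in>{t. \<forall>x\<in>topspace T. holo_triv T S L (t x) \<and> x \<in> fst (t x)}.
        coh_class T (units_sheaf S) (\<lambda>x. fst (t x), \<lambda>x y. transition L (t x) (t y)))"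

section \<open>The generalized first Ueda obstruction class\<close>

definition ueda_class ::
    "'a topology \<Rightarrow> ('a, 'n::finite) chart set \<Rightarrow> 'a set \<Rightarrow> ('a, 'e) line_bundle \<Rightarrow>
     ('a, (('a \<Rightarrow> ('a, 'n) covector) set \<times> ('a \<Rightarrow> complex) set \<Rightarrow>\<^sub>0 int) set) cochain set" where
  "ueda_class X A Y L =
     (let T = subtopology X Y;
          L_class = H1_restrict X Y (units_sheaf (O_sheaf X A)) (bundle_class X (O_sheaf X A) L);
          dlog_class =
            H1_map T (inverse_image X Y (dO_sheaf X A)) (\<lambda>p a. \<Union>f\<in>a. germ X p (dlog A f)) L_class;
          Omega_class = H1_map T (inverse_image X Y (Omega1 X A)) (\<lambda>p m. m) dlog_class
      in H1_map T (module_pullback X A Y (Omega1 X A))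
           (\<lambda>p m. pullback_elem X A Y (Omega1 X A) p m (germ T p (\<lambda>x. 1))) Omega_class)"

section \<open>Hermitian metrics and their curvature\<close>

fun Cr_on :: "nat \<Rightarrow> 'v::real_normed_vector set \<Rightarrow> ('v \<Rightarrow> real) \<Rightarrow> bool" where
  "Cr_on 0 S f = continuous_on S f"
| "Cr_on (Suc k) S f =
     ((\<forall>x\<in>S. f differentiable (at x)) \<and> (\<forall>v. Cr_on k S (\<lambda>x. frechet_derivative f (at x) v)))"

text \<open>A metric is a family of Hermitian inner products \<open>h e e'\<close> on the fibres, for \<open>e\<close> and
  \<open>e'\<close> in the same fibre.  The weight is the squared norm of the local frame.\<close>

definition weight ::
    "('a, 'e) line_bundle \<Rightarrow> ('e \<Rightarrow> 'e \<Rightarrow> complex) \<Rightarrow> 'a set \<times> ('e \<Rightarrow> complex) \<Rightarrow> 'a \<Rightarrow> real" where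
  "weight L h t x = Re (h (local_frame L t x) (local_frame L t x))"

definition hermitian_metric ::
    "('a, 'e) line_bundle \<Rightarrow> ('e \<Rightarrow> 'e \<Rightarrow> complex) \<Rightarrow> bool" where
  "hermitian_metric L h \<longleftrightarrow>
     (\<forall>t\<in>bundle_trivs L. \<forall>x\<in>fst t. weight L h t x > 0 \<and>
        (\<forall>e\<in>over L {x}. \<forall>e'\<in>over L {x}.
           h e e' = of_real (weight L h t x) * snd t e * cnj (snd t e')))"

definition metric_of_class ::
    "('a, 'n::finite) chart set \<Rightarrow> ('a, 'e) line_bundle \<Rightarrow> nat \<Rightarrow> ('e \<Rightarrow> 'e \<Rightarrow> complex) \<Rightarrow> bool" where
  "metric_of_class A L r h \<longleftrightarrow>
     (\<forall>t\<in>bundle_trivs L. \<forall>(W, \<phi>)\<in>A.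
        Cr_on r (\<phi> ` (fst t \<inter> W)) (\<lambda>z. weight L h t (inv_into W \<phi> z)))"

definition wirtinger ::
    "'n::finite \<Rightarrow> (complex^'n \<Rightarrow> complex) \<Rightarrow> complex^'n \<Rightarrow> complex" where
  "wirtinger i f z = (frechet_derivative f (at z) (axis i 1)
                      - \<i> * frechet_derivative f (at z) (axis i \<i>)) / 2"

definition wirtinger_bar ::
    "'n::finite \<Rightarrow> (complex^'n \<Rightarrow> complex) \<Rightarrow> complex^'n \<Rightarrow> complex" where
  "wirtinger_bar i f z = (frechet_derivative f (at z) (axis i 1)
                          + \<i> * frechet_derivative f (at z) (axis i \<i>)) / 2"

text \<open>The matrix of coefficients of the Chern curvature form (minus \<open>del\<close> \<open>del-bar\<close> of the logarithm of the weight)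
  in the chart \<open>(W, \<phi>)\<close>, with respect to the forms \<open>dz\<^sub>i \<and> dz-bar\<^sub>j\<close>.\<close>

definition chern_curvature ::
    "('a, 'e) line_bundle \<Rightarrow> ('e \<Rightarrow> 'e \<Rightarrow> complex) \<Rightarrow> 'a set \<times> ('e \<Rightarrow> complex) \<Rightarrow>
     ('a, 'n::finite) chart \<Rightarrow> 'a \<Rightarrow> complex^'n^'n" where
  "chern_curvature L h t = (\<lambda>(W, \<phi>) x. \<chi> i j.
     - wirtinger i (wirtinger_bar j
         (\<lambda>z. of_real (ln (weight L h t (inv_into W \<phi> z))))) (\<phi> x))"

definition semipositive_curvature ::
    "('a, 'n::finite) chart set \<Rightarrow> ('a, 'e) line_bundle \<Rightarrow> ('e \<Rightarrow> 'e \<Rightarrow> complex) \<Rightarrow> bool" where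
  "semipositive_curvature A L h \<longleftrightarrow>
     (\<forall>t\<in>bundle_trivs L. \<forall>c\<in>A. \<forall>x\<in>fst t \<inter> fst c. \<forall>v.
        let q = (\<Sum>i\<in>UNIV. \<Sum>j\<in>UNIV. chern_curvature L h t c x $ i $ j * (v $ i) * cnj (v $ j))
        in q \<in> \<real> \<and> Re q \<ge> 0)"

end

theory Submission
  imports Defs "HOL-Complex_Analysis.Cauchy_Integral_Formula"
begin

text \<open>A unitary flat structure on the restriction of \<open>L\<close> to \<open>Y\<close> has frames whose square norm \<open>G\<close>, for a
  given metric on \<open>L\<close>, does not depend on the frame.  If the curvature is semi-positive, then \<open>- log G\<close> is
  plurisubharmonic on the compact manifold \<open>Y\<close>, so \<open>G\<close> is locally constant by the strong maximum
  principle.  Hence the curvature form vanishes on the tangent vectors of \<open>Y\<close>, and being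
  semi-positive it vanishes as soon as one of its two arguments is tangent to \<open>Y\<close>.  This says that the
  coefficients of the forms \<open>\<partial> log |e|\<^sup>2\<close>, for local frames \<open>e\<close> of \<open>L\<close>, are holomorphic along \<open>Y\<close>.  These
  forms differ by the logarithmic derivatives of the transition functions, so that they
  define sections of the pullback of the cotangent sheaf whose coboundary is the Ueda cocycle.\<close>

section \<open>Complex differentiability in several variables\<close>

subsection \<open>Coordinate vectors and complex lines\<close>

lemma norm_axis: "norm (axis i c :: 'a::real_inner^'n::finite) = norm c"
  by (simp add: norm_eq_sqrt_inner inner_axis_axis)

lemma axis_eq_smult_axis: "axis i c = c *s (axis i 1 :: 'a::semiring_1^'n::finite)"
  by (simp add: vec_eq_iff axis_def)

lemma bounded_linear_axis:
  "bounded_linear (axis i :: 'a::euclidean_space \<Rightarrow> 'a^'n::finite)"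
  unfolding linear_conv_bounded_linear[symmetric]
  by (rule linearI) (simp_all add: vec_eq_iff axis_def)

lemma sum_axis_nth: "(\<Sum>i\<in>UNIV. axis i (v $ i)) = (v :: 'a::comm_monoid_add^'n::finite)"
  by (simp add: vec_eq_iff axis_def sum.delta)

lemma norm_smult_vec: "norm (c *s (v :: complex^'n::finite)) = cmod c * norm v"
  by (simp add: norm_vec_def norm_mult L2_set_right_distrib)

lemma bounded_linear_smult_left: "bounded_linear (\<lambda>c. c *s (v :: complex^'n::finite))"
  unfolding linear_conv_bounded_linear[symmetric]
  by (rule linearI) (simp_all add: vec_eq_iff algebra_simps)

lemma has_derivative_complex_line:
  "((\<lambda>\<xi>. z + \<xi> *s (v :: complex^'n::finite)) has_derivative (\<lambda>h. h *s v)) (at \<xi>)"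
  using has_derivative_add[OF has_derivative_const
      bounded_linear_imp_has_derivative[OF bounded_linear_smult_left]]
  by simp

lemma continuous_on_complex_line: "continuous_on S (\<lambda>\<xi>. z + \<xi> *s (v :: complex^'n::finite))"
  by (intro continuous_at_imp_continuous_on ballI)
    (rule has_derivative_continuous[OF has_derivative_complex_line])

lemma has_derivative_vecI:
  fixes g :: "'v::real_normed_vector \<Rightarrow> 'a::euclidean_space^'m::finite"
  assumes "\<And>i. ((\<lambda>z. g z $ i) has_derivative D i) F"
  shows "(g has_derivative (\<lambda>v. \<chi> i. D i v)) F"
proof -
  have "((\<lambda>z. \<Sum>i\<in>UNIV. axis i (g z $ i)) has_derivative (\<lambda>v. \<Sum>i\<in>UNIV. axis i (D i v))) F"
    by (intro has_derivative_sum bounded_linear.has_derivative[OF bounded_linear_axis] assms)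
  moreover have "(\<Sum>i\<in>UNIV. axis i (D i v)) = (\<chi> i. D i v)" for v
    using sum_axis_nth[of "\<chi> i. D i v"] by simp
  ultimately show ?thesis
    by (simp add: sum_axis_nth)
qed

subsection \<open>Complex differentiability at a point\<close>

definition cdiff_at :: "(complex^'n::finite \<Rightarrow> complex) \<Rightarrow> complex^'n \<Rightarrow> bool" where
  "cdiff_at f z \<longleftrightarrow> (\<exists>D. (f has_derivative D) (at z) \<and> (\<forall>c v. D (c *s v) = c * D v))"

definition cpartial :: "'n::finite \<Rightarrow> (complex^'n \<Rightarrow> complex) \<Rightarrow> complex^'n \<Rightarrow> complex" where
  "cpartial i f z = deriv (\<lambda>t. f (z + axis i t)) 0"

lemma cholo_on_iff: "cholo_on S f \<longleftrightarrow> (\<forall>z\<in>S. cdiff_at f z)"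
  by (simp add: cholo_on_def cdiff_at_def)

lemma cdiff_atI: "(f has_derivative D) (at z) \<Longrightarrow> (\<And>c v. D (c *s v) = c * D v) \<Longrightarrow> cdiff_at f z"
  unfolding cdiff_at_def by blast

lemma cdiff_atE:
  assumes "cdiff_at f z"
  obtains D where "(f has_derivative D) (at z)" "\<And>c v. D (c *s v) = c * D v"
  using assms unfolding cdiff_at_def by blast

lemma has_field_derivative_along_axis:
  fixes f :: "complex^'n::finite \<Rightarrow> complex"
  assumes D: "(f has_derivative D) (at z)" and smult: "\<And>c v. D (c *s v) = c * D v"
  shows "((\<lambda>t. f (z + axis i t)) has_field_derivative D (axis i 1)) (at 0)"
proof -
  have "((\<lambda>t. z + axis i t) has_derivative axis i) (at 0)"
    using has_derivative_add[OF has_derivative_const bounded_linear_imp_has_derivative[OF bounded_linear_axis]]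
    by simp
  from has_derivative_compose[OF this, of f D]
  have "((\<lambda>t. f (z + axis i t)) has_derivative (\<lambda>t. D (axis i t))) (at 0)"
    using D by (simp add: axis_eq_0_iff[THEN iffD2])
  moreover have "(\<lambda>t. D (axis i t)) = (*) (D (axis i 1))"
    by (rule ext, subst axis_eq_smult_axis) (simp only: smult mult.commute)
  ultimately show ?thesis
    by (simp only: has_field_derivative_def)
qed

lemma cpartial_eq:
  assumes "(f has_derivative D) (at z)" and "\<And>c v. D (c *s v) = c * D v"
  shows "cpartial i f z = D (axis i 1)"
  unfolding cpartial_def by (rule DERIV_imp_deriv[OF has_field_derivative_along_axis[OF assms]])

lemma cdiff_at_has_derivative:
  assumes "cdiff_at f z"
  shows "(f has_derivative (\<lambda>v. \<Sum>i\<in>UNIV. v $ i * cpartial i f z)) (at z)"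
proof -
  obtain D where D: "(f has_derivative D) (at z)" and smult: "\<And>c v. D (c *s v) = c * D v"
    using assms by (rule cdiff_atE) blast
  have "D = (\<lambda>v. \<Sum>i\<in>UNIV. v $ i * cpartial i f z)"
  proof
    fix v
    have "D v = (\<Sum>i\<in>UNIV. D ((v $ i) *s axis i 1))"
      unfolding linear_sum[OF has_derivative_linear[OF D], symmetric] basis_expansion ..
    then show "D v = (\<Sum>i\<in>UNIV. v $ i * cpartial i f z)"
      by (simp only: smult cpartial_eq[OF D smult])
  qed
  then show ?thesis
    using D by simp
qed

lemma cpartial_eqI:
  assumes "(f has_derivative (\<lambda>v. \<Sum>i\<in>UNIV. v $ i * a i)) (at z)"
  shows "cpartial i f z = a i"
proof -
  have "cpartial i f z = (\<Sum>k\<in>UNIV. axis i 1 $ k * a k)"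
    by (rule cpartial_eq[OF assms]) (simp add: sum_distrib_left mult.assoc)
  also have "\<dots> = (\<Sum>k\<in>UNIV. if k = i then a k else 0)"
    by (intro sum.cong) (auto simp: axis_def)
  finally show ?thesis by simp
qed

lemma cdiff_at_cong:
  assumes "cdiff_at f z" and "open N" "z \<in> N" "\<And>w. w \<in> N \<Longrightarrow> g w = f w"
  shows "cdiff_at g z"
  using assms unfolding cdiff_at_def by (metis has_derivative_transform_within_open)

lemma cpartial_cong:
  assumes "open N" "z \<in> N" "\<And>w. w \<in> N \<Longrightarrow> f w = g w"
  shows "cpartial i f z = cpartial i g z"
proof -
  have "isCont (\<lambda>t. z + axis i t) 0"
    by (intro continuous_intros bounded_linear.isCont[OF bounded_linear_axis])
  then have "\<forall>\<^sub>F t in nhds 0. z + axis i t \<in> N"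
    using assms(1,2) tendsto_at_iff_tendsto_nhds[of "\<lambda>t. z + axis i t" 0]
    by (intro topological_tendstoD) (simp_all add: isCont_def axis_eq_0_iff[THEN iffD2])
  then have "\<forall>\<^sub>F t in nhds 0. f (z + axis i t) = g (z + axis i t)"
    by eventually_elim (rule assms(3))
  then show ?thesis
    unfolding cpartial_def by (rule deriv_cong_ev) simp
qed

lemma cdiff_at_isCont: "cdiff_at f z \<Longrightarrow> isCont f z"
  by (elim cdiff_atE) (rule has_derivative_continuous)

lemma cholo_on_continuous_on: "cholo_on S f \<Longrightarrow> continuous_on S f"
  unfolding cholo_on_iff by (intro continuous_at_imp_continuous_on ballI cdiff_at_isCont) blast

lemma cdiff_at_const: "cdiff_at (\<lambda>z. c) z"
  by (rule cdiff_atI[of _ "\<lambda>v. 0"]) auto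

lemma cdiff_at_nth: "cdiff_at (\<lambda>z. z $ i) z"
  by (rule cdiff_atI[of _ "\<lambda>v. v $ i"])
    (auto intro!: bounded_linear.has_derivative[OF bounded_linear_vec_nth] derivative_eq_intros)

lemma cdiff_at_add:
  assumes "cdiff_at f z" "cdiff_at g z"
  shows "cdiff_at (\<lambda>z. f z + g z) z"
proof -
  obtain D where D: "(f has_derivative D) (at z)" "\<And>c v. D (c *s v) = c * D v"
    using assms(1) by (rule cdiff_atE) blast
  obtain E where E: "(g has_derivative E) (at z)" "\<And>c v. E (c *s v) = c * E v"
    using assms(2) by (rule cdiff_atE) blast
  show ?thesis
    by (rule cdiff_atI[OF has_derivative_add[OF D(1) E(1)]]) (simp add: D E algebra_simps)
qed

lemma cdiff_at_mult:
  assumes "cdiff_at f z" "cdiff_at g z"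
  shows "cdiff_at (\<lambda>z. f z * g z) z"
proof -
  obtain D where D: "(f has_derivative D) (at z)" "\<And>c v. D (c *s v) = c * D v"
    using assms(1) by (rule cdiff_atE) blast
  obtain E where E: "(g has_derivative E) (at z)" "\<And>c v. E (c *s v) = c * E v"
    using assms(2) by (rule cdiff_atE) blast
  show ?thesis
    by (rule cdiff_atI[OF has_derivative_mult[OF D(1) E(1)]]) (simp add: D E algebra_simps)
qed

lemma cdiff_at_compose_field:
  assumes "cdiff_at f z" and "(g has_field_derivative g') (at (f z))"
  shows "cdiff_at (\<lambda>z. g (f z)) z"
proof -
  obtain D where D: "(f has_derivative D) (at z)" "\<And>c v. D (c *s v) = c * D v"
    using assms(1) by (rule cdiff_atE) blast
  have "((\<lambda>z. g (f z)) has_derivative (\<lambda>v. g' * D v)) (at z)"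
    using has_derivative_compose[OF D(1), of g "(*) g'"] assms(2)
    by (simp add: has_field_derivative_def)
  then show ?thesis
    by (rule cdiff_atI) (simp add: D)
qed

lemma cdiff_at_compose:
  fixes g :: "complex^'m::finite \<Rightarrow> complex^'n::finite"
  assumes f: "cdiff_at f (g z)" and g: "\<And>i. cdiff_at (\<lambda>w. g w $ i) z"
  shows "cdiff_at (\<lambda>w. f (g w)) z"
proof -
  obtain D where D: "(f has_derivative D) (at (g z))" "\<And>c v. D (c *s v) = c * D v"
    using f by (rule cdiff_atE) blast
  obtain E where E: "\<And>i. ((\<lambda>w. g w $ i) has_derivative E i) (at z)"
      "\<And>i c v. E i (c *s v) = c * E i v"
  proof -
    have "\<forall>i. \<exists>E. ((\<lambda>w. g w $ i) has_derivative E) (at z) \<and> (\<forall>c v. E (c *s v) = c * E v)"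
      using g unfolding cdiff_at_def by blast
    then show ?thesis using that by metis
  qed
  have "((\<lambda>w. f (g w)) has_derivative (\<lambda>v. D (\<chi> i. E i v))) (at z)"
    by (rule has_derivative_compose[OF has_derivative_vecI[OF E(1)] D(1)])
  moreover have "(\<chi> i. E i (c *s v)) = c *s (\<chi> i. E i v)" for c v
    by (simp add: vec_eq_iff E)
  ultimately show ?thesis
    by (intro cdiff_atI) (auto simp: D)
qed

lemma cdiff_at_imp_field_differentiable_line:
  assumes "cdiff_at f (z + \<zeta> *s v)"
  shows "(\<lambda>\<xi>. f (z + \<xi> *s v)) field_differentiable (at \<zeta>)"
proof -
  obtain D where D: "(f has_derivative D) (at (z + \<zeta> *s v))" "\<And>c v. D (c *s v) = c * D v"
    using assms by (rule cdiff_atE) blast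
  from has_derivative_compose[OF has_derivative_complex_line D(1)]
  have "((\<lambda>\<xi>. f (z + \<xi> *s v)) has_derivative (\<lambda>h. D v * h)) (at \<zeta>)"
    by (simp add: D(2) mult.commute)
  then show ?thesis
    unfolding field_differentiable_def has_field_derivative_def by blast
qed

subsection \<open>Partial derivatives of holomorphic functions\<close>

lemma norm_circlepath_zero: "norm (circlepath 0 r \<theta>) = \<bar>r\<bar>"
  by (simp add: circlepath norm_mult)

lemma continuous_on_circlepath: "continuous_on S (circlepath z r)"
  unfolding circlepath by (intro continuous_intros)

lemma Cauchy_derivative_has_integral:
  assumes hol: "g holomorphic_on ball w s" and r: "0 < r" "r < s"
  shows "((\<lambda>\<theta>. g (w + circlepath 0 r \<theta>) / circlepath 0 r \<theta>) has_integral deriv g w) {0..1}"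
proof -
  let ?\<gamma> = "circlepath w r"
  have "((\<lambda>u. g u / (u - w) ^ Suc 1) has_contour_integral ((2 * pi * \<i>) / fact 1 * (deriv ^^ 1) g w)) ?\<gamma>"
    using r by (intro Cauchy_has_contour_integral_higher_derivative_circlepath
        holomorphic_on_imp_continuous_on holomorphic_on_subset[OF hol]) auto
  then have "((\<lambda>\<theta>. g (?\<gamma> \<theta>) / (?\<gamma> \<theta> - w)\<^sup>2 * vector_derivative ?\<gamma> (at \<theta>)) has_integral
      2 * pi * \<i> * deriv g w) {0..1}"
    by (simp add: has_contour_integral power2_eq_square)
  then have "((\<lambda>\<theta>. g (?\<gamma> \<theta>) / (?\<gamma> \<theta> - w)\<^sup>2 * vector_derivative ?\<gamma> (at \<theta>) / (2 * pi * \<i>)) has_integral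
      2 * pi * \<i> * deriv g w / (2 * pi * \<i>)) {0..1}"
    by (rule has_integral_divide)
  moreover have "g (?\<gamma> \<theta>) / (?\<gamma> \<theta> - w)\<^sup>2 * vector_derivative ?\<gamma> (at \<theta>) / (2 * pi * \<i>) =
      g (w + circlepath 0 r \<theta>) / circlepath 0 r \<theta>" for \<theta>
    unfolding vector_derivative_circlepath
    using r by (simp add: circlepath power2_eq_square field_simps)
  ultimately show ?thesis by simp
qed

lemma cpartial_eq_circle_integral:
  fixes f :: "complex^'n::finite \<Rightarrow> complex"
  assumes f: "cholo_on (ball z s) f" and r: "0 < r" "r < s"
  shows "cpartial i f z =
    integral {0..1} (\<lambda>\<theta>. f (z + axis i (circlepath 0 r \<theta>)) * inverse (circlepath 0 r \<theta>))"
proof -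
  have "(\<lambda>t. f (z + t *s axis i 1)) holomorphic_on ball 0 s"
    unfolding holomorphic_on_def
  proof
    fix t :: complex assume "t \<in> ball 0 s"
    then have "cdiff_at f (z + t *s axis i 1)"
      using f by (simp add: cholo_on_iff dist_norm norm_smult_vec norm_axis)
    then show "(\<lambda>t. f (z + t *s axis i 1)) field_differentiable at t within ball 0 s"
      by (rule field_differentiable_at_within[OF cdiff_at_imp_field_differentiable_line])
  qed
  then have "(\<lambda>t. f (z + axis i t)) holomorphic_on ball 0 s"
    by (simp only: axis_eq_smult_axis[symmetric])
  from Cauchy_derivative_has_integral[OF this r] show ?thesis
    unfolding cpartial_def add_0_left divide_inverse by (rule integral_unique[symmetric])
qed

lemma cpartial_eq_circle_integral_near:
  fixes f :: "complex^'n::finite \<Rightarrow> complex"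
  assumes "open S" "cholo_on S f" "z \<in> S"
  obtains r where "r > 0"
    "\<And>w \<theta>. w \<in> ball z r \<Longrightarrow> w + axis i (circlepath 0 r \<theta>) \<in> S"
    "\<And>w. w \<in> ball z r \<Longrightarrow> cpartial i f w =
       integral {0..1} (\<lambda>\<theta>. f (w + axis i (circlepath 0 r \<theta>)) * inverse (circlepath 0 r \<theta>))"
proof -
  obtain e where e: "e > 0" "ball z e \<subseteq> S"
    using assms(1,3) openE by blast
  define r where "r = e / 4"
  have r: "r > 0" "4 * r = e" using e by (simp_all add: r_def)
  have ball: "ball w (2 * r) \<subseteq> S" if "w \<in> ball z r" for w
  proof -
    have "dist z u < e" if "dist w u < 2 * r" for u
      using \<open>w \<in> ball z r\<close> that r dist_triangle[of z u w] by simp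
    then show ?thesis using e(2) by auto
  qed
  show thesis
  proof (rule that[OF r(1)])
    show "w + axis i (circlepath 0 r \<theta>) \<in> S" if "w \<in> ball z r" for w \<theta>
      using r(1) by (intro subsetD[OF ball[OF that]]) (simp add: dist_norm norm_axis norm_circlepath_zero)
    show "cpartial i f w =
        integral {0..1} (\<lambda>\<theta>. f (w + axis i (circlepath 0 r \<theta>)) * inverse (circlepath 0 r \<theta>))"
      if "w \<in> ball z r" for w
      using assms(2) ball[OF that] r(1) unfolding cholo_on_iff
      by (intro cpartial_eq_circle_integral[of w "2 * r"]) (auto simp: cholo_on_iff)
  qed
qed

lemma continuous_on_cpartial:
  fixes f :: "complex^'n::finite \<Rightarrow> complex"
  assumes "open S" "cholo_on S f"
  shows "continuous_on S (cpartial i f)"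
proof (rule continuous_at_imp_continuous_on, rule ballI)
  fix z assume "z \<in> S"
  then obtain r where r: "r > 0" "\<And>w \<theta>. w \<in> ball z r \<Longrightarrow> w + axis i (circlepath 0 r \<theta>) \<in> S"
    and eq: "\<And>w. w \<in> ball z r \<Longrightarrow> cpartial i f w =
       integral {0..1} (\<lambda>\<theta>. f (w + axis i (circlepath 0 r \<theta>)) * inverse (circlepath 0 r \<theta>))"
    using cpartial_eq_circle_integral_near[OF assms, of z i] by blast
  have nz: "circlepath 0 r \<theta> \<noteq> 0" for \<theta>
    using norm_circlepath_zero[of r \<theta>] r(1) by auto
  have "continuous_on (ball z r \<times> {0..1})
      (\<lambda>(w, \<theta>). f (w + axis i (circlepath 0 r \<theta>)) * inverse (circlepath 0 r \<theta>))"
    unfolding split_beta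
    by (intro continuous_intros continuous_on_compose2[OF cholo_on_continuous_on[OF assms(2)]]
        continuous_on_compose2[OF continuous_on_circlepath[of UNIV]]
        bounded_linear.continuous_on[OF bounded_linear_axis]) (auto simp: nz intro: r(2)[unfolded mem_ball])
  then have "continuous_on (ball z r)
      (\<lambda>w. integral (cbox 0 1) (\<lambda>\<theta>. f (w + axis i (circlepath 0 r \<theta>)) * inverse (circlepath 0 r \<theta>)))"
    by (intro integral_continuous_on_param) simp
  then have "continuous_on (ball z r) (cpartial i f)"
    by (rule continuous_on_eq) (simp add: eq)
  then show "isCont (cpartial i f) z"
    using r(1) by (simp add: continuous_on_eq_continuous_at)
qed

lemma has_derivative_translate:
  assumes "cdiff_at f (w + a)"
  shows "((\<lambda>w. f (w + a)) has_derivative (\<lambda>v. \<Sum>i\<in>UNIV. v $ i * cpartial i f (w + a))) (at w)"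
  by (rule has_derivative_compose[of "\<lambda>w. w + a" "\<lambda>v. v" w UNIV f,
        OF _ cdiff_at_has_derivative[OF assms]]) (auto intro!: derivative_eq_intros)

lemma translates_blinfun_derivative:
  fixes f :: "complex^'n::finite \<Rightarrow> complex" and \<gamma> :: "real \<Rightarrow> complex^'n"
  assumes S: "open S" "cholo_on S f"
    and \<gamma>: "continuous_on {0..1} \<gamma>" and q: "continuous_on {0..1} q"
    and stay: "\<And>w \<theta>. w \<in> B \<Longrightarrow> \<theta> \<in> {0..1} \<Longrightarrow> w + \<gamma> \<theta> \<in> S"
  obtains f' where "continuous_on (B \<times> {0..1}) (\<lambda>(w, \<theta>). f' w \<theta>)"
    "\<And>w \<theta>. w \<in> B \<Longrightarrow> \<theta> \<in> {0..1} \<Longrightarrow> ((\<lambda>w. f (w + \<gamma> \<theta>) * q \<theta>) has_derivative blinfun_apply (f' w \<theta>)) (at w)"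
    "\<And>w \<theta> a v. blinfun_apply (f' w \<theta>) (a *s v) = a * blinfun_apply (f' w \<theta>) v"
proof -
  define f' where "f' w \<theta> = Blinfun (\<lambda>v. (\<Sum>j\<in>UNIV. v $ j * cpartial j f (w + \<gamma> \<theta>)) * q \<theta>)" for w \<theta>
  have f': "blinfun_apply (f' w \<theta>) = (\<lambda>v. (\<Sum>j\<in>UNIV. v $ j * cpartial j f (w + \<gamma> \<theta>)) * q \<theta>)" for w \<theta>
    unfolding f'_def
    by (rule bounded_linear_Blinfun_apply)
      (intro bounded_linear_mult_const bounded_linear_sum bounded_linear_vec_nth)
  show thesis
  proof (rule that)
    show "continuous_on (B \<times> {0..1}) (\<lambda>(w, \<theta>). f' w \<theta>)"
      unfolding split_beta
      by (intro continuous_on_blinfun_componentwise, unfold f')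
        (intro continuous_intros continuous_on_compose2[OF continuous_on_cpartial[OF S]]
            continuous_on_compose2[OF \<gamma>] continuous_on_compose2[OF q], auto intro!: stay)
    show "((\<lambda>w. f (w + \<gamma> \<theta>) * q \<theta>) has_derivative blinfun_apply (f' w \<theta>)) (at w)"
      if "w \<in> B" "\<theta> \<in> {0..1}" for w \<theta>
    proof -
      have "cdiff_at f (w + \<gamma> \<theta>)"
        using S(2) stay that by (auto simp: cholo_on_iff)
      from has_derivative_mult_left[OF has_derivative_translate[OF this], of "q \<theta>"]
      show ?thesis unfolding f' .
    qed
    show "blinfun_apply (f' w \<theta>) (a *s v) = a * blinfun_apply (f' w \<theta>) v" for w \<theta> a v
      unfolding f' by (simp add: sum_distrib_left mult.assoc)
  qed
qed

lemma cdiff_at_integral_translates: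
  fixes f :: "complex^'n::finite \<Rightarrow> complex" and \<gamma> :: "real \<Rightarrow> complex^'n"
  assumes S: "open S" "cholo_on S f" and r: "r > 0"
    and \<gamma>: "continuous_on {0..1} \<gamma>" and q: "continuous_on {0..1} q"
    and stay: "\<And>w \<theta>. w \<in> ball z r \<Longrightarrow> \<theta> \<in> {0..1} \<Longrightarrow> w + \<gamma> \<theta> \<in> S"
  shows "cdiff_at (\<lambda>w. integral {0..1} (\<lambda>\<theta>. f (w + \<gamma> \<theta>) * q \<theta>)) z"
proof -
  obtain f' where cont: "continuous_on (ball z r \<times> {0..1}) (\<lambda>(w, \<theta>). f' w \<theta>)"
    and deriv: "\<And>w \<theta>. w \<in> ball z r \<Longrightarrow> \<theta> \<in> {0..1} \<Longrightarrow>
      ((\<lambda>w. f (w + \<gamma> \<theta>) * q \<theta>) has_derivative blinfun_apply (f' w \<theta>)) (at w)"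
    and smult: "\<And>w \<theta> a v. blinfun_apply (f' w \<theta>) (a *s v) = a * blinfun_apply (f' w \<theta>) v"
    using S \<gamma> q stay by (rule translates_blinfun_derivative) blast+
  have "((\<lambda>w. integral (cbox 0 1) (\<lambda>\<theta>. f (w + \<gamma> \<theta>) * q \<theta>)) has_derivative
      blinfun_apply (integral (cbox 0 1) (f' z))) (at z within ball z r)"
  proof (rule leibniz_rule[where fx = f'])
    fix w assume "w \<in> ball z r"
    then show "(\<lambda>\<theta>. f (w + \<gamma> \<theta>) * q \<theta>) integrable_on cbox 0 1"
      by (intro integrable_continuous continuous_intros
          continuous_on_compose2[OF cholo_on_continuous_on[OF S(2)]]) (use stay \<gamma> q in auto)
  qed (use cont r deriv in \<open>auto intro: has_derivative_at_withinI\<close>)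
  then have "((\<lambda>w. integral {0..1} (\<lambda>\<theta>. f (w + \<gamma> \<theta>) * q \<theta>)) has_derivative
      blinfun_apply (integral {0..1} (f' z))) (at z)"
    using r by (simp add: at_within_open[of z "ball z r"])
  moreover have "continuous_on {0..1} (\<lambda>\<theta>. (\<lambda>(w, \<theta>). f' w \<theta>) (z, \<theta>))"
    by (rule continuous_on_compose2[OF cont]) (use r in \<open>auto intro!: continuous_intros\<close>)
  then have "f' z integrable_on {0..1}"
    by (intro integrable_continuous_real) simp
  from blinfun_apply_integral[OF this]
  have "blinfun_apply (integral {0..1} (f' z)) (a *s v) = a * blinfun_apply (integral {0..1} (f' z)) v" for a v
    by (simp add: smult)
  ultimately show ?thesis by (rule cdiff_atI)
qed

text \<open>Differentiation under Cauchy's integral for the derivative, which is legitimate because the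
  same integral first shows that the partial derivatives are continuous.\<close>

lemma cholo_on_cpartial:
  fixes f :: "complex^'n::finite \<Rightarrow> complex"
  assumes "open S" "cholo_on S f"
  shows "cholo_on S (cpartial i f)"
  unfolding cholo_on_iff
proof
  fix z assume "z \<in> S"
  then obtain r where r: "r > 0" "\<And>w \<theta>. w \<in> ball z r \<Longrightarrow> w + axis i (circlepath 0 r \<theta>) \<in> S"
    and eq: "\<And>w. w \<in> ball z r \<Longrightarrow> cpartial i f w =
       integral {0..1} (\<lambda>\<theta>. f (w + axis i (circlepath 0 r \<theta>)) * inverse (circlepath 0 r \<theta>))"
    using cpartial_eq_circle_integral_near[OF assms, of z i] by blast
  have nz: "circlepath 0 r \<theta> \<noteq> 0" for \<theta>
    using norm_circlepath_zero[of r \<theta>] r(1) by auto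
  have "cdiff_at (\<lambda>w. integral {0..1}
      (\<lambda>\<theta>. f (w + axis i (circlepath 0 r \<theta>)) * inverse (circlepath 0 r \<theta>))) z"
  proof (rule cdiff_at_integral_translates[OF assms r(1)])
    show "continuous_on {0..1} (\<lambda>\<theta>. axis i (circlepath 0 r \<theta>))"
      by (rule bounded_linear.continuous_on[OF bounded_linear_axis continuous_on_circlepath])
    show "continuous_on {0..1} (\<lambda>\<theta>. inverse (circlepath 0 r \<theta>))"
      by (rule continuous_on_inverse[OF continuous_on_circlepath]) (simp add: nz)
  qed (rule r(2))
  then show "cdiff_at (cpartial i f) z"
    by (rule cdiff_at_cong[OF _ open_ball]) (use r(1) eq in auto)
qed

section \<open>The maximum principle for subharmonic functions\<close>

subsection \<open>Second derivatives and Laplacians\<close>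

definition has_second_derivative :: "(real \<Rightarrow> real) \<Rightarrow> real \<Rightarrow> real \<Rightarrow> bool" where
  "has_second_derivative g a t \<longleftrightarrow>
     (\<exists>g'. (\<forall>\<^sub>F s in nhds t. (g has_real_derivative g' s) (at s)) \<and> (g' has_real_derivative a) (at t))"

lemma has_second_derivativeI:
  "\<forall>\<^sub>F s in nhds t. (g has_real_derivative g' s) (at s) \<Longrightarrow> (g' has_real_derivative a) (at t) \<Longrightarrow>
    has_second_derivative g a t"
  unfolding has_second_derivative_def by blast

lemma has_second_derivativeE:
  assumes "has_second_derivative g a t"
  obtains g' where "\<forall>\<^sub>F s in nhds t. (g has_real_derivative g' s) (at s)" "(g' has_real_derivative a) (at t)"
  using assms unfolding has_second_derivative_def by blast

lemma has_second_derivative_cong: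
  assumes g: "has_second_derivative g a t" and eq: "\<forall>\<^sub>F s in nhds t. g s = h s"
  shows "has_second_derivative h a t"
proof -
  obtain g' where g': "\<forall>\<^sub>F s in nhds t. (g has_real_derivative g' s) (at s)" "(g' has_real_derivative a) (at t)"
    using g by (rule has_second_derivativeE)
  have "\<forall>\<^sub>F s in nhds t. \<forall>\<^sub>F r in nhds s. g r = h r"
    using eq by (simp add: eventually_eventually)
  with g'(1) have "\<forall>\<^sub>F s in nhds t. (h has_real_derivative g' s) (at s)"
    by eventually_elim (simp cong: DERIV_cong_ev)
  then show ?thesis using g'(2) by (rule has_second_derivativeI)
qed

lemma has_second_derivative_unique:
  assumes "has_second_derivative g a t" "has_second_derivative g b t"
  shows "a = b"
proof -
  obtain g' where g': "\<forall>\<^sub>F s in nhds t. (g has_real_derivative g' s) (at s)" "(g' has_real_derivative a) (at t)"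
    using assms(1) by (rule has_second_derivativeE)
  obtain h' where h': "\<forall>\<^sub>F s in nhds t. (g has_real_derivative h' s) (at s)" "(h' has_real_derivative b) (at t)"
    using assms(2) by (rule has_second_derivativeE)
  have "\<forall>\<^sub>F s in nhds t. g' s = h' s"
    using g'(1) h'(1) by eventually_elim (rule DERIV_unique)
  then have "(h' has_real_derivative a) (at t)"
    using g'(2) by (simp cong: DERIV_cong_ev)
  then show ?thesis using h'(2) by (rule DERIV_unique)
qed

lemma has_second_derivative_const: "has_second_derivative (\<lambda>s. c) 0 t"
  by (rule has_second_derivativeI[where g' = "\<lambda>s. 0"]) auto

lemma has_second_derivative_add:
  assumes "has_second_derivative g a t" "has_second_derivative h b t"
  shows "has_second_derivative (\<lambda>s. g s + h s) (a + b) t"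
proof -
  obtain g' where g': "\<forall>\<^sub>F s in nhds t. (g has_real_derivative g' s) (at s)" "(g' has_real_derivative a) (at t)"
    using assms(1) by (rule has_second_derivativeE)
  obtain h' where h': "\<forall>\<^sub>F s in nhds t. (h has_real_derivative h' s) (at s)" "(h' has_real_derivative b) (at t)"
    using assms(2) by (rule has_second_derivativeE)
  have "\<forall>\<^sub>F s in nhds t. ((\<lambda>s. g s + h s) has_real_derivative g' s + h' s) (at s)"
    using g'(1) h'(1) by eventually_elim (rule DERIV_add)
  then show ?thesis by (rule has_second_derivativeI) (rule DERIV_add[OF g'(2) h'(2)])
qed

lemma has_second_derivative_cmult:
  assumes "has_second_derivative g a t"
  shows "has_second_derivative (\<lambda>s. c * g s) (c * a) t"
proof -
  obtain g' where g': "\<forall>\<^sub>F s in nhds t. (g has_real_derivative g' s) (at s)" "(g' has_real_derivative a) (at t)"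
    using assms by (rule has_second_derivativeE)
  have "\<forall>\<^sub>F s in nhds t. ((\<lambda>s. c * g s) has_real_derivative c * g' s) (at s)"
    using g'(1) by eventually_elim (rule DERIV_cmult)
  then show ?thesis by (rule has_second_derivativeI) (rule DERIV_cmult[OF g'(2)])
qed

lemma has_second_derivative_nonpos_at_max:
  assumes g: "has_second_derivative g a t" and max: "\<forall>\<^sub>F s in nhds t. g s \<le> g t"
  shows "a \<le> 0"
proof (rule ccontr)
  assume "\<not> a \<le> 0"
  then have a: "a > 0" by simp
  obtain g' where g': "\<forall>\<^sub>F s in nhds t. (g has_real_derivative g' s) (at s)" "(g' has_real_derivative a) (at t)"
    using g by (rule has_second_derivativeE)
  obtain e where e: "e > 0"
      "\<And>s. dist s t < e \<Longrightarrow> (g has_real_derivative g' s) (at s) \<and> g s \<le> g t"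
    using eventually_conj[OF g'(1) max] unfolding eventually_nhds_metric by blast
  have "g' t = 0"
    by (rule DERIV_local_max[of g _ t e]) (use e in \<open>auto simp: dist_real_def\<close>)
  then obtain d where d: "d > 0" "\<And>s. 0 < s \<Longrightarrow> s < d \<Longrightarrow> 0 < g' (t + s)"
    using DERIV_pos_inc_right[OF g'(2) a] by auto
  define s where "s = min d e / 2"
  have s: "0 < s" "s < d" "s < e" using d(1) e(1) by (auto simp: s_def)
  obtain \<xi> where \<xi>: "t < \<xi>" "\<xi> < t + s" "g (t + s) - g t = s * g' \<xi>"
    using s MVT2[of t "t + s" g g'] e(2) by (auto simp: dist_real_def)
  have "0 < g' \<xi>"
    using d(2)[of "\<xi> - t"] \<xi>(1,2) s by simp
  then have "g t < g (t + s)"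
    using \<xi>(3) s(1) by (metis diff_gt_0_iff_gt mult_pos_pos)
  then show False
    using e(2)[of "t + s"] s by (auto simp: dist_real_def)
qed

lemma eventually_along_line:
  fixes x v :: "'v::real_normed_vector"
  assumes "\<forall>\<^sub>F w in nhds x. P w"
  shows "\<forall>\<^sub>F t in nhds 0. P (x + t *\<^sub>R v)"
proof -
  have "((\<lambda>t. x + t *\<^sub>R v) \<longlongrightarrow> x + 0 *\<^sub>R v) (nhds 0)"
    by (intro tendsto_intros filterlim_ident)
  then show ?thesis
    using assms by (auto simp: filterlim_iff)
qed

lemma has_second_derivative_along_line:
  fixes u :: "'v::real_normed_vector \<Rightarrow> real"
  assumes u: "\<forall>\<^sub>F w in nhds x. (u has_derivative u' w) (at w)"
    and H: "((\<lambda>w. u' w v) has_derivative H) (at x)"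
  shows "has_second_derivative (\<lambda>t. u (x + t *\<^sub>R v)) (H v) 0"
proof -
  have line: "((\<lambda>t. x + t *\<^sub>R v) has_derivative (\<lambda>h. h *\<^sub>R v)) (at t)" for t
    by (auto intro!: derivative_eq_intros)
  have along: "((\<lambda>t. f (x + t *\<^sub>R v)) has_real_derivative D v) (at t)"
    if D: "(f has_derivative D) (at (x + t *\<^sub>R v))" for f D t
  proof -
    have "(\<lambda>h. D (h *\<^sub>R v)) = (*) (D v)"
      using linear_scale[OF has_derivative_linear[OF D]] by (auto simp: mult.commute)
    with has_derivative_compose[OF line D] show ?thesis
      by (simp only: has_field_derivative_def)
  qed
  have "\<forall>\<^sub>F t in nhds 0. ((\<lambda>t. u (x + t *\<^sub>R v)) has_real_derivative u' (x + t *\<^sub>R v) v) (at t)"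
    using eventually_along_line[OF u] by eventually_elim (rule along)
  moreover have "((\<lambda>t. u' (x + t *\<^sub>R v) v) has_real_derivative H v) (at 0)"
    using along[of "\<lambda>w. u' w v" H 0] H by simp
  ultimately show ?thesis
    by (rule has_second_derivativeI)
qed

definition has_laplacian :: "(complex \<Rightarrow> real) \<Rightarrow> real \<Rightarrow> complex \<Rightarrow> bool" where
  "has_laplacian u l z \<longleftrightarrow> (\<exists>a b. has_second_derivative (\<lambda>t. u (z + of_real t)) a 0 \<and>
     has_second_derivative (\<lambda>t. u (z + t *\<^sub>R \<i>)) b 0 \<and> l = a + b)"

lemma has_laplacianI:
  assumes "\<forall>\<^sub>F w in nhds z. (u has_derivative u' w) (at w)"
    and "\<And>v. ((\<lambda>w. u' w v) has_derivative H v) (at z)"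
  shows "has_laplacian u (H 1 1 + H \<i> \<i>) z"
  using has_second_derivative_along_line[OF assms, of 1] has_second_derivative_along_line[OF assms, of \<i>]
  unfolding has_laplacian_def by (auto simp: of_real_def)

lemma has_laplacian_unique: "has_laplacian u l z \<Longrightarrow> has_laplacian u l' z \<Longrightarrow> l = l'"
  unfolding has_laplacian_def using has_second_derivative_unique by blast

lemma has_laplacian_cong:
  assumes u: "has_laplacian u l z" and N: "open N" "z \<in> N" and eq: "\<And>w. w \<in> N \<Longrightarrow> u w = u' w"
  shows "has_laplacian u' l z"
proof -
  have near: "\<forall>\<^sub>F w in nhds z. u w = u' w"
    using eventually_nhds_in_open[OF N] by eventually_elim (rule eq)
  show ?thesis
    using u eventually_along_line[OF near, of 1] eventually_along_line[OF near, of \<i>]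
    unfolding has_laplacian_def of_real_def by (blast intro: has_second_derivative_cong)
qed

lemma has_laplacian_const: "has_laplacian (\<lambda>w. c) 0 z"
  unfolding has_laplacian_def using has_second_derivative_const by fastforce

lemma has_laplacian_add:
  "has_laplacian u l z \<Longrightarrow> has_laplacian u' l' z \<Longrightarrow> has_laplacian (\<lambda>w. u w + u' w) (l + l') z"
  unfolding has_laplacian_def using has_second_derivative_add
  by (elim exE conjE) (intro exI conjI, assumption+, simp)

lemma has_laplacian_cmult: "has_laplacian u l z \<Longrightarrow> has_laplacian (\<lambda>w. c * u w) (c * l) z"
  unfolding has_laplacian_def
  by (elim exE conjE) (intro exI conjI, (erule has_second_derivative_cmult)+, simp add: distrib_left)

lemma has_laplacian_nonpos_at_max:
  assumes "has_laplacian u l z" and max: "\<forall>\<^sub>F w in nhds z. u w \<le> u z"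
  shows "l \<le> 0"
proof -
  obtain a b where ab: "has_second_derivative (\<lambda>t. u (z + of_real t)) a 0"
      "has_second_derivative (\<lambda>t. u (z + t *\<^sub>R \<i>)) b 0" "l = a + b"
    using assms(1) unfolding has_laplacian_def by blast
  have "a \<le> 0"
    using eventually_along_line[OF max, of 1]
    by (intro has_second_derivative_nonpos_at_max[OF ab(1)]) (simp add: of_real_def)
  moreover have "b \<le> 0"
    using eventually_along_line[OF max, of \<i>]
    by (intro has_second_derivative_nonpos_at_max[OF ab(2)]) simp
  ultimately show ?thesis by (simp add: ab(3))
qed

lemma has_laplacian_norm_square: "has_laplacian (\<lambda>w. (cmod w)\<^sup>2) 4 z"
proof -
  have "((\<lambda>w. (cmod w)\<^sup>2) has_derivative (\<lambda>v. 2 * (w \<bullet> v))) (at w)" for w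
    unfolding power2_norm_eq_inner
    by (auto intro!: derivative_eq_intros simp: inner_commute)
  then have "has_laplacian (\<lambda>w. (cmod w)\<^sup>2) (2 * ((1::complex) \<bullet> 1) + 2 * (\<i> \<bullet> \<i>)) z"
    by (intro has_laplacianI[where u' = "\<lambda>w v. 2 * (w \<bullet> v)" and H = "\<lambda>v h. 2 * (h \<bullet> v)"]
        always_eventually allI) (auto intro!: derivative_eq_intros)
  then show ?thesis by (simp add: inner_complex_def)
qed

lemma has_laplacian_Re_holomorphic:
  assumes F: "F holomorphic_on S" and S: "open S" "z \<in> S"
  shows "has_laplacian (\<lambda>w. Re (F w)) 0 z"
proof -
  have deriv: "(f has_derivative (*) (deriv f w)) (at w)" if "f holomorphic_on S" "w \<in> S" for f w
    using holomorphic_derivI[OF that(1) S(1) that(2), of UNIV] by (simp add: has_field_derivative_def)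
  define d where "d = deriv (deriv F) z"
  have "\<forall>\<^sub>F w in nhds z. ((\<lambda>w. Re (F w)) has_derivative (\<lambda>v. Re (deriv F w * v))) (at w)"
    using eventually_nhds_in_open[OF S] by eventually_elim (rule has_derivative_Re[OF deriv[OF F]])
  moreover have "((\<lambda>w. Re (deriv F w * v)) has_derivative (\<lambda>h. Re (d * h * v))) (at z)" for v
    unfolding d_def
    by (intro has_derivative_Re has_derivative_mult_left deriv holomorphic_deriv[OF F S(1)] S(2))
  ultimately have "has_laplacian (\<lambda>w. Re (F w)) (Re (d * 1 * 1) + Re (d * \<i> * \<i>)) z"
    by (rule has_laplacianI)
  then show ?thesis by simp
qed

lemma has_laplacian_ln_norm_holomorphic:
  assumes F: "F holomorphic_on S" and S: "open S" "z \<in> S" and nz: "F z \<noteq> 0"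
  shows "has_laplacian (\<lambda>w. ln ((cmod (F w))\<^sup>2)) 0 z"
proof -
  define G where "G = (\<lambda>w. F w / F z)"
  have G: "G holomorphic_on S"
    unfolding G_def using nz by (intro holomorphic_intros F) auto
  define N where "N = S \<inter> G -` {w. Re w > 0}"
  have N: "open N" "z \<in> N"
    using nz S(2) continuous_open_preimage[OF holomorphic_on_imp_continuous_on[OF G] S(1) open_halfspace_Re_gt]
    by (simp_all add: N_def G_def)
  have halfplane: "G w \<notin> \<real>\<^sub>\<le>\<^sub>0" "G w \<noteq> 0" if "w \<in> N" for w
    using that by (auto simp: N_def complex_nonpos_Reals_iff)
  have "(\<lambda>w. Ln (G w)) holomorphic_on N"
    using halfplane by (intro holomorphic_on_Ln' holomorphic_on_subset[OF G]) (auto simp: N_def)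
  then have "has_laplacian (\<lambda>w. ln ((cmod (F z))\<^sup>2) + 2 * Re (Ln (G w))) (0 + 2 * 0) z"
    by (intro has_laplacian_add has_laplacian_const has_laplacian_cmult has_laplacian_Re_holomorphic[OF _ N])
  moreover have "ln ((cmod (F z))\<^sup>2) + 2 * Re (Ln (G w)) = ln ((cmod (F w))\<^sup>2)" if "w \<in> N" for w
  proof -
    have "F w \<noteq> 0" using halfplane[OF that] by (auto simp: G_def)
    then show ?thesis
      using halfplane(2)[OF that] nz
      by (simp add: ln_realpow Re_Ln G_def norm_divide ln_div)
  qed
  ultimately show ?thesis
    using has_laplacian_cong[OF _ N] by simp
qed

lemma has_laplacian_complex_line:
  fixes u :: "complex^'n::finite \<Rightarrow> real"
  assumes u: "\<forall>\<^sub>F w in nhds (z + \<zeta> *s v). (u has_derivative u' w) (at w)"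
    and H: "\<And>x. ((\<lambda>w. u' w x) has_derivative H x) (at (z + \<zeta> *s v))"
  shows "has_laplacian (\<lambda>\<xi>. u (z + \<xi> *s v)) (H v v + H (\<i> *s v) (\<i> *s v)) \<zeta>"
proof -
  have lines: "z + (\<zeta> + of_real t) *s v = z + \<zeta> *s v + t *\<^sub>R v"
    "z + (\<zeta> + t *\<^sub>R \<i>) *s v = z + \<zeta> *s v + t *\<^sub>R (\<i> *s v)" for t
    by (simp_all add: vec_eq_iff complex_eq_iff algebra_simps)
  show ?thesis
    unfolding has_laplacian_def lines using has_second_derivative_along_line[OF u H] by blast
qed

subsection \<open>The maximum principle\<close>

lemma weak_maximum_principle:
  assumes cont: "continuous_on (cball 0 R) u" and R: "R > 0"
    and lap: "\<And>z. z \<in> ball 0 R \<Longrightarrow> \<exists>l\<ge>0. has_laplacian u l z"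
    and bound: "\<And>z. cmod z = R \<Longrightarrow> u z \<le> M"
  shows "u 0 \<le> M"
proof (rule field_le_epsilon)
  fix e :: real assume e: "e > 0"
  define \<eta> where "\<eta> = e / R\<^sup>2"
  have \<eta>: "\<eta> > 0" using e R by (simp add: \<eta>_def)
  define w where "w = (\<lambda>z. u z + \<eta> * (cmod z)\<^sup>2)"
  have "continuous_on (cball 0 R) w"
    unfolding w_def by (intro continuous_intros cont)
  then obtain x where x: "x \<in> cball 0 R" "\<And>y. y \<in> cball 0 R \<Longrightarrow> w y \<le> w x"
    using continuous_attains_sup[of "cball 0 R" w] R by auto
  have "cmod x = R"
  proof (rule ccontr)
    assume "cmod x \<noteq> R"
    then have xR: "x \<in> ball 0 R" using x(1) by auto
    then obtain l where l: "l \<ge> 0" "has_laplacian u l x" using lap by blast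
    have "has_laplacian w (l + \<eta> * 4) x"
      unfolding w_def by (intro has_laplacian_add has_laplacian_cmult has_laplacian_norm_square l)
    moreover have "\<forall>\<^sub>F y in nhds x. w y \<le> w x"
      using eventually_nhds_in_open[OF open_ball xR] by eventually_elim (use x(2) in auto)
    ultimately show False
      using has_laplacian_nonpos_at_max l(1) \<eta> by fastforce
  qed
  then have "w x \<le> M + e"
    using bound[of x] R by (simp add: w_def \<eta>_def)
  moreover have "w 0 \<le> w x" using x(2)[of 0] R by simp
  ultimately show "u 0 \<le> M + e" by (simp add: w_def)
qed

lemma Re_Poisson:
  assumes "b \<noteq> z"
  shows "Re ((b + z) / (b - z)) = ((cmod b)\<^sup>2 - (cmod z)\<^sup>2) / (cmod (b - z))\<^sup>2"
  by (simp add: Re_divide' cmod_power2) (simp add: power2_eq_square algebra_simps)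

lemma Re_Poisson_le:
  assumes s: "0 < s" and R: "0 < R" and b: "cmod b = (1 + s) * R" and z: "cmod z = R"
  shows "Re ((b + z) / (b - z)) \<le> (2 + s) / s"
proof -
  have "s * R \<le> cmod (b - z)"
    using norm_triangle_ineq2[of b z] b z by (simp add: algebra_simps)
  moreover have "cmod (b + z) \<le> (2 + s) * R"
    using norm_triangle_ineq[of b z] b z by (simp add: algebra_simps)
  ultimately have "cmod (b + z) / cmod (b - z) \<le> ((2 + s) * R) / (s * R)"
    using R s by (intro frac_le) auto
  then show ?thesis
    using complex_Re_le_cmod[of "(b + z) / (b - z)"] R by (simp add: norm_divide)
qed

lemma Re_Poisson_le_half:
  assumes s: "0 < s" "s \<le> 1" "24 * R\<^sup>2 * s \<le> d\<^sup>2" and d: "0 < d"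
    and b: "cmod b = (1 + s) * R" and z: "cmod z = R" and far: "d / 2 \<le> cmod (b - z)"
  shows "Re ((b + z) / (b - z)) \<le> 1 / 2"
proof -
  have "(cmod b)\<^sup>2 - (cmod z)\<^sup>2 = R\<^sup>2 * (2 * s + s\<^sup>2)"
    by (simp add: b z power2_eq_square algebra_simps)
  also have "\<dots> \<le> R\<^sup>2 * (3 * s)"
    using s by (intro mult_left_mono) (auto simp: power2_eq_square)
  also have "\<dots> \<le> d\<^sup>2 / 8" using s(3) by (simp add: mult_ac)
  also have "\<dots> = (1 / 2) * (d / 2)\<^sup>2" by (simp add: power_divide)
  also have "\<dots> \<le> (1 / 2) * (cmod (b - z))\<^sup>2"
    using far d by (intro mult_left_mono power_mono) auto
  finally have "(cmod b)\<^sup>2 - (cmod z)\<^sup>2 \<le> (1 / 2) * (cmod (b - z))\<^sup>2" .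
  moreover have "b \<noteq> z" "0 < (cmod (b - z))\<^sup>2" using far d by auto
  ultimately show ?thesis
    by (simp add: Re_Poisson field_simps)
qed

lemma Poisson_pole_near:
  fixes a :: complex
  assumes a: "a \<noteq> 0" and d: "0 < d"
  obtains b C where "\<And>z. cmod z \<le> cmod a \<Longrightarrow> b \<noteq> z" "0 < C"
    "\<And>z. cmod z = cmod a \<Longrightarrow> Re ((b + z) / (b - z)) \<le> C"
    "\<And>z. cmod z = cmod a \<Longrightarrow> d \<le> dist z a \<Longrightarrow> Re ((b + z) / (b - z)) \<le> 1 / 2"
proof -
  define R where "R = cmod a"
  have R: "0 < R" using a by (simp add: R_def)
  define s where "s = min 1 (min (d / (2 * R)) (d\<^sup>2 / (24 * R\<^sup>2)))"
  have "s \<le> d / (2 * R)" "s \<le> d\<^sup>2 / (24 * R\<^sup>2)" by (auto simp: s_def)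
  then have s: "0 < s" "s \<le> 1" "s * R \<le> d / 2" "24 * R\<^sup>2 * s \<le> d\<^sup>2"
    using d R by (auto simp: s_def field_simps)
  define b where "b = (1 + s) *\<^sub>R a"
  have b: "cmod b = (1 + s) * R" "cmod (b - a) = s * R"
  proof -
    have "b - a = s *\<^sub>R a" by (simp add: b_def scaleR_left_distrib)
    then show "cmod b = (1 + s) * R" "cmod (b - a) = s * R"
      using s(1) by (simp_all only: b_def R_def norm_scaleR abs_of_pos add_pos_pos zero_less_one)
  qed
  show thesis
  proof (rule that)
    show "b \<noteq> z" if "cmod z \<le> cmod a" for z
    proof
      assume "b = z"
      then have "(1 + s) * R \<le> 1 * R" using b(1) that by (simp add: R_def)
      then show False using s(1) R by (simp add: mult_le_cancel_right)
    qed
    show "0 < (2 + s) / s" using s(1) by simp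
    fix z assume z: "cmod z = cmod a"
    then show "Re ((b + z) / (b - z)) \<le> (2 + s) / s"
      by (intro Re_Poisson_le[OF s(1) R b(1)]) (simp add: R_def)
    assume "d \<le> dist z a"
    moreover have "dist z a \<le> cmod (b - z) + cmod (b - a)"
      using norm_triangle_ineq4[of "b - a" "b - z"] by (simp add: dist_norm)
    ultimately show "Re ((b + z) / (b - z)) \<le> 1 / 2"
      using z s(3) b(2) by (intro Re_Poisson_le_half[OF s(1,2,4) d b(1)]) (simp_all add: R_def)
  qed
qed

lemma harmonic_barrier:
  fixes a :: complex
  assumes a: "a \<noteq> 0" and d: "0 < d"
  obtains P C where "continuous_on (cball 0 (cmod a)) P"
    "\<And>z. z \<in> ball 0 (cmod a) \<Longrightarrow> has_laplacian P 0 z" "P 0 = 1" "0 < C"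
    "\<And>z. cmod z = cmod a \<Longrightarrow> P z \<le> C"
    "\<And>z. cmod z = cmod a \<Longrightarrow> d \<le> dist z a \<Longrightarrow> P z \<le> 1 / 2"
proof -
  obtain b C where b: "\<And>z. cmod z \<le> cmod a \<Longrightarrow> b \<noteq> z" and C: "0 < C"
      "\<And>z. cmod z = cmod a \<Longrightarrow> Re ((b + z) / (b - z)) \<le> C"
      "\<And>z. cmod z = cmod a \<Longrightarrow> d \<le> dist z a \<Longrightarrow> Re ((b + z) / (b - z)) \<le> 1 / 2"
    using Poisson_pole_near[OF a d] by blast
  show thesis
  proof (rule that[OF _ _ _ C])
    show "continuous_on (cball 0 (cmod a)) (\<lambda>z. Re ((b + z) / (b - z)))"
      using b by (intro continuous_intros) auto
    have "(\<lambda>z. (b + z) / (b - z)) holomorphic_on ball 0 (cmod a)"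
      using b by (intro holomorphic_intros) auto
    then show "has_laplacian (\<lambda>z. Re ((b + z) / (b - z))) 0 z" if "z \<in> ball 0 (cmod a)" for z
      using that by (intro has_laplacian_Re_holomorphic[OF _ open_ball])
    show "Re ((b + 0) / (b - 0)) = 1" using b[of 0] by simp
  qed
qed

text \<open>If \<open>u\<close> is smaller than its maximum \<open>u 0\<close> at \<open>a\<close>, then adding a small multiple of a Poisson kernel
  with a pole just outside the disc near \<open>a\<close> contradicts the weak maximum principle: on the circle
  this kernel is below its value \<open>1\<close> at \<open>0\<close> except near \<open>a\<close>.\<close>

lemma strong_maximum_principle:
  assumes cont: "continuous_on (ball 0 S) u"
    and lap: "\<And>z. z \<in> ball 0 S \<Longrightarrow> \<exists>l\<ge>0. has_laplacian u l z"
    and max: "\<And>z. z \<in> ball 0 S \<Longrightarrow> u z \<le> u 0"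
    and a: "a \<in> ball 0 S"
  shows "u a = u 0"
proof (rule ccontr)
  assume ne: "u a \<noteq> u 0"
  define \<delta> where "\<delta> = (u 0 - u a) / 2"
  have \<delta>: "\<delta> > 0" "u a < u 0 - \<delta>" using ne max[OF a] by (simp_all add: \<delta>_def field_simps)
  have "isCont u a"
    using cont a by (simp add: continuous_on_eq_continuous_at)
  then have "\<forall>\<^sub>F z in nhds a. u z < u 0 - \<delta>"
    using \<delta>(2) by (intro order_tendstoD(2)[of u "u a"]) (auto simp: isCont_def tendsto_at_iff_tendsto_nhds)
  then obtain d where d: "d > 0" "\<And>z. dist z a < d \<Longrightarrow> u z < u 0 - \<delta>"
    unfolding eventually_nhds_metric by blast
  have "a \<noteq> 0" using ne by auto
  obtain P C where P: "continuous_on (cball 0 (cmod a)) P"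
      "\<And>z. z \<in> ball 0 (cmod a) \<Longrightarrow> has_laplacian P 0 z" "P 0 = 1"
    and C: "0 < C" "\<And>z. cmod z = cmod a \<Longrightarrow> P z \<le> C"
      "\<And>z. cmod z = cmod a \<Longrightarrow> d \<le> dist z a \<Longrightarrow> P z \<le> 1 / 2"
    using harmonic_barrier[OF \<open>a \<noteq> 0\<close> d(1)] by blast
  define \<epsilon> where "\<epsilon> = \<delta> / C"
  have \<epsilon>: "\<epsilon> > 0" "\<epsilon> * C = \<delta>" using \<delta>(1) C(1) by (simp_all add: \<epsilon>_def)
  have "u 0 + \<epsilon> * P 0 \<le> u 0 + \<epsilon> / 2"
  proof (rule weak_maximum_principle[where u = "\<lambda>z. u z + \<epsilon> * P z" and R = "cmod a"])
    show "continuous_on (cball 0 (cmod a)) (\<lambda>z. u z + \<epsilon> * P z)"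
      using a by (intro continuous_intros continuous_on_subset[OF cont] P(1)) auto
    show "0 < cmod a" using \<open>a \<noteq> 0\<close> by simp
    show "\<exists>l\<ge>0. has_laplacian (\<lambda>z. u z + \<epsilon> * P z) l z" if z: "z \<in> ball 0 (cmod a)" for z
      using lap[of z] has_laplacian_add[OF _ has_laplacian_cmult[OF P(2)[OF z], of \<epsilon>]] z a by force
    show "u z + \<epsilon> * P z \<le> u 0 + \<epsilon> / 2" if z: "cmod z = cmod a" for z
    proof (cases "dist z a < d")
      case True
      have "\<epsilon> * P z \<le> \<epsilon> * C" using C(2)[OF z] \<epsilon>(1) by simp
      then show ?thesis using d(2)[OF True] \<epsilon> by simp
    next
      case False
      have "\<epsilon> * P z \<le> \<epsilon> * (1 / 2)" using C(3)[OF z] False \<epsilon>(1) by (intro mult_left_mono) auto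
      then show ?thesis using max[of z] z a by simp
    qed
  qed
  then show False using \<epsilon>(1) P(3) by simp
qed

subsection \<open>From local minima to local constancy\<close>

text \<open>On a connected component, which is open and compact, the set of minimum points is open and
  closed.\<close>

lemma locally_constant_on_if_locally_constant_at_minima:
  fixes G :: "'a \<Rightarrow> real"
  assumes "compact_space T" "locally_connected_space T" and G: "continuous_map T euclideanreal G"
    and min: "\<And>y N. openin T N \<Longrightarrow> y \<in> N \<Longrightarrow> (\<And>x. x \<in> N \<Longrightarrow> G y \<le> G x) \<Longrightarrow>
      \<exists>M. openin T M \<and> y \<in> M \<and> (\<forall>x\<in>M. G x = G y)"
  shows "locally_constant_on T (topspace T) G"
  unfolding locally_constant_on_def
proof
  fix x assume x: "x \<in> topspace T"
  define C where "C = connected_component_of_set T x"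
  have C: "openin T C" "closedin T C" "connectedin T C" "x \<in> C"
    using assms(2) x unfolding C_def
    by (simp_all add: openin_connected_component_of_locally_connected_space
        closedin_connected_component_of connectedin_connected_component_of connected_component_of_refl)
  have "compactin euclideanreal (G ` C)"
    using assms(1) C(2) G by (intro image_compactin[of T] closedin_compact_space)
  then obtain y where y: "y \<in> C" "\<And>z. z \<in> C \<Longrightarrow> G y \<le> G z"
    using compact_attains_inf[of "G ` C"] C(4) by auto
  define M where "M = {z \<in> C. G z = G y}"
  have "openin T M"
  proof (subst openin_subopen, intro ballI)
    fix z assume z: "z \<in> M"
    then have Gz: "z \<in> C" "G z = G y" by (simp_all add: M_def)
    then obtain N where N: "openin T N" "z \<in> N" "\<forall>w\<in>N. G w = G y"
      using min[OF C(1), of z] y(2) by auto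
    then have "N \<inter> C \<subseteq> M" by (auto simp: M_def)
    then show "\<exists>N. openin T N \<and> z \<in> N \<and> N \<subseteq> M"
      using C(1) N Gz(1) by (intro exI[of _ "N \<inter> C"]) blast
  qed
  moreover have "closedin T M"
  proof -
    have "closedin T {z \<in> topspace T. G z \<in> {G y}}"
      by (rule closedin_continuous_map_preimage[OF G]) simp
    moreover have "M = C \<inter> {z \<in> topspace T. G z \<in> {G y}}"
      using openin_subset[OF C(1)] by (auto simp: M_def)
    ultimately show ?thesis using C(2) by (simp add: closedin_Int)
  qed
  ultimately have "C \<subseteq> M"
    using connectedinD[OF C(3), of M "topspace T - M"] y(1) openin_subset[OF C(1)]
    by (auto simp: M_def)
  then have "\<forall>z\<in>C. G z = G y" by (auto simp: M_def)
  then have "\<forall>z\<in>C. G z = G x" using C(4) by simp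
  then show "\<exists>N. openin T N \<and> x \<in> N \<and> (\<forall>y\<in>N \<inter> topspace T. G y = G x)"
    using C(1,4) by blast
qed

section \<open>Sheaves of abelian groups and their first cohomology\<close>

subsection \<open>Sheaves\<close>

locale ab_sheaf =
  fixes T :: "'a topology" and F :: "('a, 's, 'z) sheaf_scheme"
  assumes comm_group_vals: "p \<in> topspace T \<Longrightarrow> comm_group (vals F p)"
    and open_section: "s \<in> sections F U \<Longrightarrow> openin T U"
    and section_closed: "s \<in> sections F U \<Longrightarrow> p \<in> U \<Longrightarrow> s p \<in> carrier (vals F p)"
    and section_restrict: "s \<in> sections F U \<Longrightarrow> openin T V \<Longrightarrow> V \<subseteq> U \<Longrightarrow> s \<in> sections F V"
    and section_mult: "s \<in> sections F U \<Longrightarrow> t \<in> sections F U \<Longrightarrow>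
      (\<lambda>p. s p \<otimes>\<^bsub>vals F p\<^esub> t p) \<in> sections F U"
    and section_inv: "s \<in> sections F U \<Longrightarrow> (\<lambda>p. inv\<^bsub>vals F p\<^esub> (s p)) \<in> sections F U"
    and section_one: "openin T U \<Longrightarrow> (\<lambda>p. \<one>\<^bsub>vals F p\<^esub>) \<in> sections F U"
begin

lemma in_topspace: "s \<in> sections F U \<Longrightarrow> p \<in> U \<Longrightarrow> p \<in> topspace T"
  using open_section openin_subset by fastforce

end

definition local_sections ::
    "'a topology \<Rightarrow> ('a set \<Rightarrow> ('a \<Rightarrow> 's) set) \<Rightarrow> 'a set \<Rightarrow> ('a \<Rightarrow> 's) set" where
  "local_sections T B V = {s. openin T V \<and>
     (\<forall>y\<in>V. \<exists>N f. openin T N \<and> y \<in> N \<and> N \<subseteq> V \<and> f \<in> B N \<and> (\<forall>z\<in>N. s z = f z))}"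

lemma local_sectionsI:
  assumes "openin T V"
    and "\<And>y. y \<in> V \<Longrightarrow> \<exists>N f. openin T N \<and> y \<in> N \<and> N \<subseteq> V \<and> f \<in> B N \<and> (\<forall>z\<in>N. s z = f z)"
  shows "s \<in> local_sections T B V"
  unfolding local_sections_def mem_Collect_eq by (intro conjI ballI assms)

lemma local_sections_open: "s \<in> local_sections T B V \<Longrightarrow> openin T V"
  by (simp add: local_sections_def)

lemma local_sectionsE:
  assumes "s \<in> local_sections T B V" "y \<in> V"
  obtains N f where "openin T N" "y \<in> N" "N \<subseteq> V" "f \<in> B N" "\<And>z. z \<in> N \<Longrightarrow> s z = f z"
  using assms unfolding local_sections_def by blast

text \<open>Values of functions in \<open>B N\<close> outside \<open>N\<close> are irrelevant, so the operations need to preserve \<open>B N\<close>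
  only up to these values.\<close>

locale ab_presheaf =
  fixes T :: "'a topology" and G :: "'a \<Rightarrow> 's monoid" and B :: "'a set \<Rightarrow> ('a \<Rightarrow> 's) set"
  assumes comm_group_vals: "p \<in> topspace T \<Longrightarrow> comm_group (G p)"
    and closed: "openin T N \<Longrightarrow> f \<in> B N \<Longrightarrow> p \<in> N \<Longrightarrow> f p \<in> carrier (G p)"
    and restrict: "f \<in> B N \<Longrightarrow> openin T M \<Longrightarrow> M \<subseteq> N \<Longrightarrow> f \<in> B M"
    and mult: "openin T N \<Longrightarrow> f \<in> B N \<Longrightarrow> g \<in> B N \<Longrightarrow> \<exists>k\<in>B N. \<forall>p\<in>N. k p = f p \<otimes>\<^bsub>G p\<^esub> g p"
    and inverse: "openin T N \<Longrightarrow> f \<in> B N \<Longrightarrow> \<exists>k\<in>B N. \<forall>p\<in>N. k p = inv\<^bsub>G p\<^esub> (f p)"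
    and one: "openin T N \<Longrightarrow> \<exists>k\<in>B N. \<forall>p\<in>N. k p = \<one>\<^bsub>G p\<^esub>"
begin

lemma local_sections_restrict:
  assumes s: "s \<in> local_sections T B V" and W: "openin T W" "W \<subseteq> V"
  shows "s \<in> local_sections T B W"
proof (rule local_sectionsI[OF W(1)])
  fix y assume y: "y \<in> W"
  then obtain N f where N: "openin T N" "y \<in> N" "f \<in> B N" "\<And>z. z \<in> N \<Longrightarrow> s z = f z"
    using local_sectionsE[OF s] W(2) by (metis subsetD)
  then show "\<exists>M f. openin T M \<and> y \<in> M \<and> M \<subseteq> W \<and> f \<in> B M \<and> (\<forall>z\<in>M. s z = f z)"
    using y W(1) restrict[OF N(3), of "N \<inter> W"]
    by (intro exI[of _ "N \<inter> W"] exI[of _ f]) auto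
qed

lemma local_sections_mult:
  assumes s: "s \<in> local_sections T B V" and t: "t \<in> local_sections T B V"
  shows "(\<lambda>p. s p \<otimes>\<^bsub>G p\<^esub> t p) \<in> local_sections T B V"
proof (rule local_sectionsI[OF local_sections_open[OF s]])
  fix y assume y: "y \<in> V"
  obtain N f where N: "openin T N" "y \<in> N" "N \<subseteq> V" "f \<in> B N" "\<And>z. z \<in> N \<Longrightarrow> s z = f z"
    using s y by (rule local_sectionsE) blast
  obtain M g where M: "openin T M" "y \<in> M" "M \<subseteq> V" "g \<in> B M" "\<And>z. z \<in> M \<Longrightarrow> t z = g z"
    using t y by (rule local_sectionsE) blast
  have NM: "openin T (N \<inter> M)" using N(1) M(1) by blast
  moreover obtain k where "k \<in> B (N \<inter> M)" "\<forall>p\<in>N \<inter> M. k p = f p \<otimes>\<^bsub>G p\<^esub> g p"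
    using mult[OF NM restrict[OF N(4) NM] restrict[OF M(4) NM]] by blast
  ultimately show "\<exists>N f. openin T N \<and> y \<in> N \<and> N \<subseteq> V \<and> f \<in> B N \<and> (\<forall>z\<in>N. s z \<otimes>\<^bsub>G z\<^esub> t z = f z)"
    using N M by (intro exI[of _ "N \<inter> M"] exI[of _ k]) auto
qed

lemma local_sections_inv:
  assumes s: "s \<in> local_sections T B V"
  shows "(\<lambda>p. inv\<^bsub>G p\<^esub> (s p)) \<in> local_sections T B V"
proof (rule local_sectionsI[OF local_sections_open[OF s]])
  fix y assume y: "y \<in> V"
  obtain N f where N: "openin T N" "y \<in> N" "N \<subseteq> V" "f \<in> B N" "\<And>z. z \<in> N \<Longrightarrow> s z = f z"
    using s y by (rule local_sectionsE) blast
  obtain k where "k \<in> B N" "\<forall>p\<in>N. k p = inv\<^bsub>G p\<^esub> (f p)"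
    using inverse[OF N(1,4)] by blast
  then show "\<exists>N f. openin T N \<and> y \<in> N \<and> N \<subseteq> V \<and> f \<in> B N \<and> (\<forall>z\<in>N. inv\<^bsub>G z\<^esub> (s z) = f z)"
    using N by (intro exI[of _ N] exI[of _ k]) auto
qed

lemma ab_sheaf_local_sections:
  assumes F: "vals F = G" "sections F = local_sections T B"
  shows "ab_sheaf T F"
proof (rule ab_sheaf.intro, unfold F)
  show "comm_group (G p)" if "p \<in> topspace T" for p
    by (rule comm_group_vals[OF that])
  show "(\<lambda>p. \<one>\<^bsub>G p\<^esub>) \<in> local_sections T B U" if "openin T U" for U
  proof (rule local_sectionsI[OF that])
    obtain k where "k \<in> B U" "\<forall>p\<in>U. k p = \<one>\<^bsub>G p\<^esub>"
      using one[OF \<open>openin T U\<close>] by blast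
    then show "\<exists>N f. openin T N \<and> y \<in> N \<and> N \<subseteq> U \<and> f \<in> B N \<and> (\<forall>z\<in>N. \<one>\<^bsub>G z\<^esub> = f z)"
      if "y \<in> U" for y
      using \<open>openin T U\<close> that by (intro exI[of _ U] exI[of _ k]) auto
  qed
  fix s U assume s: "s \<in> local_sections T B U"
  show "openin T U" by (rule local_sections_open[OF s])
  show "s p \<in> carrier (G p)" if "p \<in> U" for p
    using s that by (rule local_sectionsE) (metis closed)
  show "s \<in> local_sections T B V" if "openin T V" "V \<subseteq> U" for V
    by (rule local_sections_restrict[OF s that])
  show "(\<lambda>p. inv\<^bsub>G p\<^esub> (s p)) \<in> local_sections T B U"
    by (rule local_sections_inv[OF s])
  show "(\<lambda>p. s p \<otimes>\<^bsub>G p\<^esub> t p) \<in> local_sections T B U" if "t \<in> local_sections T B U" for t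
    by (rule local_sections_mult[OF s that])
qed

end

subsection \<open>Cocycles and coboundaries\<close>

lemma
  assumes "(U, c) \<in> cocycles T F" "x \<in> topspace T"
  shows cocycle_cover_open: "openin T (U x)" and cocycle_cover_mem: "x \<in> U x"
    and cocycle_section: "y \<in> topspace T \<Longrightarrow> c x y \<in> sections F (U x \<inter> U y)"
    and cocycle_mult: "y \<in> topspace T \<Longrightarrow> z \<in> topspace T \<Longrightarrow> p \<in> U x \<inter> U y \<inter> U z \<Longrightarrow>
      c x y p \<otimes>\<^bsub>vals F p\<^esub> c y z p = c x z p"
  using assms unfolding cocycles_def by auto

lemma (in ab_sheaf) cocycle_closed:
  assumes "(U, c) \<in> cocycles T F" "x \<in> topspace T" "y \<in> topspace T" "p \<in> U x \<inter> U y"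
  shows "c x y p \<in> carrier (vals F p)"
  using assms section_closed cocycle_section by metis

locale coboundary = ab_sheaf T F for T :: "'a topology" and F :: "('a, 's, 'z) sheaf_scheme" +
  fixes U :: "'a \<Rightarrow> 'a set" and c and U' :: "'a \<Rightarrow> 'a set" and c' and V :: "'a \<Rightarrow> 'a set" and b
  assumes source: "(U, c) \<in> cocycles T F" and target: "(U', c') \<in> cocycles T F"
    and cover_open: "x \<in> topspace T \<Longrightarrow> openin T (V x)"
    and cover_mem: "x \<in> topspace T \<Longrightarrow> x \<in> V x"
    and cover_refines: "x \<in> topspace T \<Longrightarrow> V x \<subseteq> U x \<inter> U' x"
    and cochain: "x \<in> topspace T \<Longrightarrow> b x \<in> sections F (V x)"
    and coboundary: "x \<in> topspace T \<Longrightarrow> y \<in> topspace T \<Longrightarrow> p \<in> V x \<inter> V y \<Longrightarrow>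
      b x p \<otimes>\<^bsub>vals F p\<^esub> c' x y p = c x y p \<otimes>\<^bsub>vals F p\<^esub> b y p"
begin

lemma
  assumes "x \<in> topspace T" "p \<in> V x"
  shows cochain_closed: "b x p \<in> carrier (vals F p)" and cover_topspace: "p \<in> topspace T"
  using assms cochain section_closed in_topspace by blast+

lemma
  assumes "x \<in> topspace T" "y \<in> topspace T" "p \<in> V x \<inter> V y"
  shows source_closed: "c x y p \<in> carrier (vals F p)" and target_closed: "c' x y p \<in> carrier (vals F p)"
  using assms cover_refines cocycle_closed[OF source] cocycle_closed[OF target] by blast+

end

context ab_sheaf
begin

lemma cohomologous_iff:
  "((U, c), (U', c')) \<in> cohomologous T F \<longleftrightarrow> (\<exists>V b. coboundary T F U c U' c' V b)"
proof
  assume "((U, c), (U', c')) \<in> cohomologous T F"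
  then obtain V b where "(U, c) \<in> cocycles T F" "(U', c') \<in> cocycles T F"
    and "\<forall>x\<in>topspace T. openin T (V x) \<and> x \<in> V x \<and> V x \<subseteq> U x \<inter> U' x \<and> b x \<in> sections F (V x)"
    and "\<forall>x\<in>topspace T. \<forall>y\<in>topspace T. \<forall>p\<in>V x \<inter> V y.
           b x p \<otimes>\<^bsub>vals F p\<^esub> c' x y p = c x y p \<otimes>\<^bsub>vals F p\<^esub> b y p"
    unfolding cohomologous_def by auto
  then have "coboundary T F U c U' c' V b"
    by unfold_locales auto
  then show "\<exists>V b. coboundary T F U c U' c' V b" by blast
next
  assume "\<exists>V b. coboundary T F U c U' c' V b"
  then obtain V b where "coboundary T F U c U' c' V b" by blast
  then interpret B: coboundary T F U c U' c' V b .
  show "((U, c), (U', c')) \<in> cohomologous T F"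
    unfolding cohomologous_def mem_Collect_eq prod.case
    by (intro conjI exI[of _ V] exI[of _ b] ballI B.source B.target B.cover_open B.cover_mem
        B.cover_refines B.cochain B.coboundary)
qed

lemma coboundary_refl:
  assumes c: "(U, c) \<in> cocycles T F"
  shows "coboundary T F U c U c U (\<lambda>x p. \<one>\<^bsub>vals F p\<^esub>)"
proof unfold_locales
  fix x y p assume xy: "x \<in> topspace T" "y \<in> topspace T" and p: "p \<in> U x \<inter> U y"
  have "p \<in> topspace T"
    using in_topspace[OF cocycle_section[OF c xy] p] .
  then interpret comm_group "vals F p" by (rule comm_group_vals)
  show "\<one>\<^bsub>vals F p\<^esub> \<otimes>\<^bsub>vals F p\<^esub> c x y p = c x y p \<otimes>\<^bsub>vals F p\<^esub> \<one>\<^bsub>vals F p\<^esub>"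
    using cocycle_closed[OF c xy p] by simp
qed (use c cocycle_cover_open[OF c] cocycle_cover_mem[OF c] section_one in auto)

end

lemma (in comm_group) inv_mult_eq_mult_inv:
  assumes "x \<in> carrier G" "y \<in> carrier G" "u \<in> carrier G" "v \<in> carrier G"
    and eq: "x \<otimes> u = v \<otimes> y"
  shows "inv x \<otimes> v = u \<otimes> inv y"
proof -
  have "u = inv x \<otimes> (x \<otimes> u)"
    using assms(1-4) by (simp add: m_assoc[symmetric])
  also have "\<dots> = inv x \<otimes> v \<otimes> y"
    unfolding eq using assms(1-4) by (simp add: m_assoc)
  finally show ?thesis
    using assms(1-4) by (simp add: m_assoc)
qed

lemma (in coboundary) coboundary_sym:
  "coboundary T F U' c' U c V (\<lambda>x p. inv\<^bsub>vals F p\<^esub> (b x p))"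
proof unfold_locales
  fix x y p assume xy: "x \<in> topspace T" "y \<in> topspace T" and p: "p \<in> V x \<inter> V y"
  interpret comm_group "vals F p"
    using cover_topspace[OF xy(1)] p by (intro comm_group_vals) blast
  show "inv\<^bsub>vals F p\<^esub> b x p \<otimes>\<^bsub>vals F p\<^esub> c x y p = c' x y p \<otimes>\<^bsub>vals F p\<^esub> inv\<^bsub>vals F p\<^esub> b y p"
    using xy p by (intro inv_mult_eq_mult_inv coboundary cochain_closed source_closed target_closed) auto
qed (use source target cover_open cover_mem cover_refines cochain section_inv in blast)+

lemma coboundary_trans:
  assumes "coboundary T F U c U' c' V b" "coboundary T F U' c' U'' c'' V' b'"
  shows "coboundary T F U c U'' c'' (\<lambda>x. V x \<inter> V' x) (\<lambda>x p. b x p \<otimes>\<^bsub>vals F p\<^esub> b' x p)"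
proof -
  interpret B: coboundary T F U c U' c' V b by (rule assms(1))
  interpret B': coboundary T F U' c' U'' c'' V' b' by (rule assms(2))
  show ?thesis
  proof unfold_locales
    fix x assume x: "x \<in> topspace T"
    show op: "openin T (V x \<inter> V' x)" using B.cover_open[OF x] B'.cover_open[OF x] by blast
    show "(\<lambda>p. b x p \<otimes>\<^bsub>vals F p\<^esub> b' x p) \<in> sections F (V x \<inter> V' x)"
      using B.section_restrict[OF B.cochain[OF x] op] B.section_restrict[OF B'.cochain[OF x] op]
      by (intro B.section_mult) auto
  next
    fix x y p assume xy: "x \<in> topspace T" "y \<in> topspace T"
      and "p \<in> V x \<inter> V' x \<inter> (V y \<inter> V' y)"
    then have p: "p \<in> V x \<inter> V y" "p \<in> V' x \<inter> V' y" by auto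
    interpret comm_group "vals F p"
      using B.cover_topspace[OF xy(1)] p by (intro B.comm_group_vals) blast
    note closed = B.cochain_closed[OF xy(1)] B.cochain_closed[OF xy(2)] B'.cochain_closed[OF xy(1)]
      B'.cochain_closed[OF xy(2)] B.source_closed[OF xy] B.target_closed[OF xy] B'.target_closed[OF xy]
    have "b x p \<otimes>\<^bsub>vals F p\<^esub> b' x p \<otimes>\<^bsub>vals F p\<^esub> c'' x y p =
        b x p \<otimes>\<^bsub>vals F p\<^esub> (c' x y p \<otimes>\<^bsub>vals F p\<^esub> b' y p)"
      using B'.coboundary[OF xy p(2)] p closed by (simp add: m_assoc)
    also have "\<dots> = c x y p \<otimes>\<^bsub>vals F p\<^esub> b y p \<otimes>\<^bsub>vals F p\<^esub> b' y p"
      using B.coboundary[OF xy p(1)] p closed by (simp add: m_assoc[symmetric])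
    finally show "b x p \<otimes>\<^bsub>vals F p\<^esub> b' x p \<otimes>\<^bsub>vals F p\<^esub> c'' x y p =
        c x y p \<otimes>\<^bsub>vals F p\<^esub> (b y p \<otimes>\<^bsub>vals F p\<^esub> b' y p)"
      using p closed by (simp add: m_assoc)
  qed (use B.source B'.target B.cover_mem B'.cover_mem B.cover_refines B'.cover_refines in blast)+
qed

subsection \<open>Cohomology classes\<close>

context ab_sheaf
begin

lemma cohomologousI: "coboundary T F U c U' c' V b \<Longrightarrow> ((U, c), (U', c')) \<in> cohomologous T F"
  unfolding cohomologous_iff by (intro exI)

lemma cohomologousE:
  assumes "(u, v) \<in> cohomologous T F"
  obtains U c U' c' V b where "u = (U, c)" "v = (U', c')" "coboundary T F U c U' c' V b"
proof -
  obtain U c U' c' where uv: "u = (U, c)" "v = (U', c')" by force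
  then obtain V b where "coboundary T F U c U' c' V b"
    using assms unfolding uv cohomologous_iff by (elim exE)
  with uv show thesis by (rule that)
qed

lemma cohomologous_refl: "u \<in> cocycles T F \<Longrightarrow> (u, u) \<in> cohomologous T F"
  by (cases u) (auto intro: cohomologousI[OF coboundary_refl])

lemma cohomologous_sym: "(u, v) \<in> cohomologous T F \<Longrightarrow> (v, u) \<in> cohomologous T F"
  by (elim cohomologousE) (simp add: cohomologousI[OF coboundary.coboundary_sym])

lemma cohomologous_trans:
  assumes "(u, v) \<in> cohomologous T F" "(v, w) \<in> cohomologous T F"
  shows "(u, w) \<in> cohomologous T F"
proof -
  obtain U c V d R b where uv: "u = (U, c)" "v = (V, d)" "coboundary T F U c V d R b"
    using assms(1) by (rule cohomologousE)
  obtain W e R' b' where vw: "w = (W, e)" "coboundary T F V d W e R' b'"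
    using assms(2) uv(2) by (auto elim: cohomologousE)
  show ?thesis
    unfolding uv(1) vw(1) by (rule cohomologousI[OF coboundary_trans[OF uv(3) vw(2)]])
qed

lemma coh_class_eq: "(u, v) \<in> cohomologous T F \<Longrightarrow> coh_class T F u = coh_class T F v"
  unfolding coh_class_def by (blast intro: cohomologous_trans dest: cohomologous_sym)

lemma UN_coh_class:
  assumes "\<And>i. i \<in> I \<Longrightarrow> (u, f i) \<in> cohomologous T F" and "I \<noteq> {}"
  shows "(\<Union>i\<in>I. coh_class T F (f i)) = coh_class T F u"
proof -
  have "coh_class T F (f i) = coh_class T F u" if "i \<in> I" for i
    using coh_class_eq[OF assms(1)[OF that]] by simp
  then show ?thesis using assms(2) by simp
qed

lemma coh_class_coboundary:
  assumes c: "(U, c) \<in> cocycles T F"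
    and V: "\<And>x. x \<in> topspace T \<Longrightarrow> x \<in> V x \<and> V x \<subseteq> U x"
    and b: "\<And>x. x \<in> topspace T \<Longrightarrow> b x \<in> sections F (V x)"
    and coboundary: "\<And>x y p. x \<in> topspace T \<Longrightarrow> y \<in> topspace T \<Longrightarrow> p \<in> V x \<inter> V y \<Longrightarrow>
      b x p = c x y p \<otimes>\<^bsub>vals F p\<^esub> b y p"
  shows "coh_class T F (U, c) = \<one>\<^bsub>H1 T F\<^esub>"
proof -
  have one: "(\<lambda>x. topspace T, \<lambda>x y p. \<one>\<^bsub>vals F p\<^esub>) \<in> cocycles T F"
    using section_one[OF openin_topspace] comm_group_vals
    by (auto simp: cocycles_def comm_group_def group_def monoid.l_one)
  have "coboundary T F U c (\<lambda>x. topspace T) (\<lambda>x y p. \<one>\<^bsub>vals F p\<^esub>) V b"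
  proof unfold_locales
    show op: "openin T (V x)" if "x \<in> topspace T" for x
      by (rule open_section[OF b[OF that]])
    show "V x \<subseteq> U x \<inter> topspace T" if "x \<in> topspace T" for x
      using V[OF that] openin_subset[OF op[OF that]] by blast
    fix x y p assume xy: "x \<in> topspace T" "y \<in> topspace T" and p: "p \<in> V x \<inter> V y"
    interpret comm_group "vals F p"
      using in_topspace[OF b[OF xy(1)]] p by (intro comm_group_vals) blast
    show "b x p \<otimes>\<^bsub>vals F p\<^esub> \<one>\<^bsub>vals F p\<^esub> = c x y p \<otimes>\<^bsub>vals F p\<^esub> b y p"
      unfolding coboundary[OF xy p, symmetric] using section_closed[OF b[OF xy(1)]] p by simp
  qed (use c one V b in auto)
  then show ?thesis
    unfolding H1_def monoid.simps by (intro coh_class_eq cohomologousI)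
qed

end

subsection \<open>Functoriality\<close>

definition map_cochain :: "('a \<Rightarrow> 's \<Rightarrow> 't) \<Rightarrow> ('a, 's) cochain \<Rightarrow> ('a, 't) cochain" where
  "map_cochain h u = (fst u, \<lambda>x y p. h p (snd u x y p))"

locale sheaf_hom = F: ab_sheaf T F + G: ab_sheaf T G
  for T :: "'a topology" and F :: "('a, 's, 'z) sheaf_scheme" and G :: "('a, 't, 'y) sheaf_scheme" +
  fixes h :: "'a \<Rightarrow> 's \<Rightarrow> 't"
  assumes hom: "p \<in> topspace T \<Longrightarrow> h p \<in> hom (vals F p) (vals G p)"
    and map_section: "s \<in> sections F U \<Longrightarrow> (\<lambda>p. h p (s p)) \<in> sections G U"
begin

lemma map_cochain_cocycle:
  assumes u: "u \<in> cocycles T F"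
  shows "map_cochain h u \<in> cocycles T G"
proof -
  obtain U c where uc: "u = (U, c)" by force
  note c = u[unfolded uc]
  have "h p (c x y p) \<otimes>\<^bsub>vals G p\<^esub> h p (c y z p) = h p (c x z p)"
    if xyz: "x \<in> topspace T" "y \<in> topspace T" "z \<in> topspace T" and p: "p \<in> U x \<inter> U y \<inter> U z" for x y z p
  proof -
    have pT: "p \<in> topspace T" using openin_subset[OF cocycle_cover_open[OF c xyz(1)]] p by blast
    have "c x y p \<in> carrier (vals F p)" "c y z p \<in> carrier (vals F p)"
      using F.cocycle_closed[OF c] xyz p by blast+
    then show ?thesis
      using hom_mult[OF hom[OF pT]] cocycle_mult[OF c xyz p] by metis
  qed
  then show ?thesis
    using c map_section by (auto simp: cocycles_def map_cochain_def uc)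
qed

lemma map_cochain_coboundary:
  assumes "coboundary T F U c U' c' V b"
  shows "coboundary T G U (\<lambda>x y p. h p (c x y p)) U' (\<lambda>x y p. h p (c' x y p)) V (\<lambda>x p. h p (b x p))"
proof -
  interpret coboundary T F U c U' c' V b by (rule assms)
  show ?thesis
  proof unfold_locales
    show "(U, \<lambda>x y p. h p (c x y p)) \<in> cocycles T G" "(U', \<lambda>x y p. h p (c' x y p)) \<in> cocycles T G"
      using map_cochain_cocycle[OF source] map_cochain_cocycle[OF target] by (simp_all add: map_cochain_def)
    fix x y p assume xy: "x \<in> topspace T" "y \<in> topspace T" and p: "p \<in> V x \<inter> V y"
    have hp: "h p \<in> hom (vals F p) (vals G p)"
      using cover_topspace[OF xy(1)] p by (intro hom) blast
    have "b x p \<in> carrier (vals F p)" "b y p \<in> carrier (vals F p)"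
      using cochain_closed xy p by blast+
    then show "h p (b x p) \<otimes>\<^bsub>vals G p\<^esub> h p (c' x y p) = h p (c x y p) \<otimes>\<^bsub>vals G p\<^esub> h p (b y p)"
      using coboundary[OF xy p] hom_mult[OF hp] source_closed[OF xy p] target_closed[OF xy p] by metis
  qed (use cover_open cover_mem cover_refines cochain map_section in auto)
qed

lemma H1_map_coh_class:
  assumes u: "u \<in> cocycles T F"
  shows "H1_map T G h (coh_class T F u) = coh_class T G (map_cochain h u)"
proof -
  have "(map_cochain h u, map_cochain h v) \<in> cohomologous T G" if "(u, v) \<in> cohomologous T F" for v
  proof -
    obtain U c U' c' V b where "u = (U, c)" "v = (U', c')" "coboundary T F U c U' c' V b"
      using \<open>(u, v) \<in> cohomologous T F\<close> by (rule F.cohomologousE)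
    then show ?thesis
      unfolding map_cochain_def by (simp add: G.cohomologousI[OF map_cochain_coboundary])
  qed
  then have "(\<Union>v\<in>coh_class T F u. coh_class T G (map_cochain h v)) = coh_class T G (map_cochain h u)"
    using F.cohomologous_refl[OF u] by (intro G.UN_coh_class) (auto simp: coh_class_def)
  then show ?thesis
    unfolding H1_map_def map_cochain_def by (simp add: split_beta)
qed

end

section \<open>Stalks and inverse images\<close>

subsection \<open>Germs\<close>

lemma germI: "openin T N \<Longrightarrow> y \<in> N \<Longrightarrow> (\<And>x. x \<in> N \<Longrightarrow> g x = f x) \<Longrightarrow> g \<in> germ T y f"
  unfolding germ_def by blast

lemma germE:
  assumes "g \<in> germ T y f"
  obtains N where "openin T N" "y \<in> N" "\<And>x. x \<in> N \<Longrightarrow> g x = f x"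
  using assms unfolding germ_def by blast

lemma germ_self: "y \<in> topspace T \<Longrightarrow> f \<in> germ T y f"
  by (rule germI[of T "topspace T"]) auto

lemma germ_mono_cong:
  assumes N: "openin T N" "y \<in> N" "\<And>x. x \<in> N \<Longrightarrow> f x = g x"
  shows "germ T y f \<subseteq> germ T y g"
proof
  fix k assume "k \<in> germ T y f"
  then obtain M where "openin T M" "y \<in> M" "\<And>x. x \<in> M \<Longrightarrow> k x = f x" by (rule germE) blast
  then show "k \<in> germ T y g" using N by (intro germI[of T "M \<inter> N"]) auto
qed

lemma germ_cong:
  assumes "openin T N" "y \<in> N" "\<And>x. x \<in> N \<Longrightarrow> f x = g x"
  shows "germ T y f = germ T y g"
proof
  show "germ T y f \<subseteq> germ T y g" by (rule germ_mono_cong[OF assms])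
  show "germ T y g \<subseteq> germ T y f" by (rule germ_mono_cong[OF assms(1,2)]) (simp add: assms(3))
qed

text \<open>The operations on stalks are defined by unions over representatives.  All representatives
  give the same germ, so the union may be evaluated at any of them.\<close>

lemma UN_germ:
  assumes y: "y \<in> topspace T"
    and local: "\<And>N f'. openin T N \<Longrightarrow> (\<forall>x\<in>N. f' x = f x) \<Longrightarrow> \<forall>x\<in>N. \<Phi> f' x = \<Phi> f x"
  shows "(\<Union>f'\<in>germ T y f. germ T y (\<Phi> f')) = germ T y (\<Phi> f)"
proof -
  have "germ T y (\<Phi> f') = germ T y (\<Phi> f)" if "f' \<in> germ T y f" for f'
    using that by (rule germE) (rule germ_cong, assumption+, use local in blast)
  then show ?thesis using germ_self[OF y] by auto
qed

lemma UN_germ_pair: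
  assumes y: "y \<in> topspace T" and y': "y \<in> topspace T'"
    and finer: "\<And>N. openin T N \<Longrightarrow> y \<in> N \<Longrightarrow> \<exists>M. openin T' M \<and> y \<in> M \<and> M \<subseteq> N"
  shows "(\<Union>f'\<in>germ T y f. \<Union>g'\<in>germ T' y g. germ T' y (\<lambda>x. m x (f' x) (g' x))) =
    germ T' y (\<lambda>x. m x (f x) (g x))"
proof -
  have "germ T' y (\<lambda>x. m x (f' x) (g' x)) = germ T' y (\<lambda>x. m x (f x) (g x))"
    if f': "f' \<in> germ T y f" and g': "g' \<in> germ T' y g" for f' g'
  proof -
    obtain N where N: "openin T N" "y \<in> N" "\<And>x. x \<in> N \<Longrightarrow> f' x = f x"
      using f' by (rule germE) blast
    obtain N' where N': "openin T' N'" "y \<in> N'" "\<And>x. x \<in> N' \<Longrightarrow> g' x = g x"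
      using g' by (rule germE) blast
    obtain M where "openin T' M" "y \<in> M" "M \<subseteq> N"
      using N finer by meson
    then show ?thesis
      using N N' by (intro germ_cong[of _ "M \<inter> N'"]) auto
  qed
  then show ?thesis using germ_self[OF y, of f] germ_self[OF y', of g] by blast
qed

subsection \<open>Stalks\<close>

lemma stalk_mult:
  "y \<in> topspace T \<Longrightarrow> germ T y f \<otimes>\<^bsub>stalk T F y\<^esub> germ T y g = germ T y (\<lambda>x. f x \<otimes>\<^bsub>vals F x\<^esub> g x)"
  unfolding stalk_def monoid.simps by (rule UN_germ_pair[where m = "\<lambda>x. mult (vals F x)"]) auto

lemma stalk_one: "\<one>\<^bsub>stalk T F y\<^esub> = germ T y (\<lambda>x. \<one>\<^bsub>vals F x\<^esub>)"
  by (simp add: stalk_def)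

context ab_sheaf
begin

lemma germ_in_stalk: "f \<in> sections F U \<Longrightarrow> y \<in> U \<Longrightarrow> germ T y f \<in> carrier (stalk T F y)"
  using open_section unfolding stalk_def by auto

lemma germ_eq_on_section:
  "f \<in> sections F U \<Longrightarrow> y \<in> U \<Longrightarrow> (\<And>p. p \<in> U \<Longrightarrow> f' p = g' p) \<Longrightarrow> germ T y f' = germ T y g'"
  by (rule germ_cong[OF open_section])

lemma stalkE:
  assumes "a \<in> carrier (stalk T F y)"
  obtains U f where "f \<in> sections F U" "y \<in> U" "a = germ T y f"
  using assms unfolding stalk_def by auto

lemma stalk_common_neighbourhood:
  assumes "finite M" "M \<subseteq> carrier (stalk T F y)" and y: "y \<in> topspace T"
  obtains U where "openin T U" "y \<in> U" "\<And>a. a \<in> M \<Longrightarrow> \<exists>f\<in>sections F U. a = germ T y f"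
  using assms(1,2)
proof (induction M arbitrary: thesis rule: finite_induct)
  case empty
  then show ?case using y by blast
next
  case (insert a M)
  have "M \<subseteq> carrier (stalk T F y)" using insert.prems(2) by blast
  then obtain U where U: "openin T U" "y \<in> U" "\<And>b. b \<in> M \<Longrightarrow> \<exists>f\<in>sections F U. b = germ T y f"
    by (rule insert.IH[rotated]) blast
  have "a \<in> carrier (stalk T F y)" using insert.prems(2) by blast
  then obtain V f where f: "f \<in> sections F V" "y \<in> V" "a = germ T y f" by (rule stalkE)
  show ?case
  proof (rule insert.prems(1)[of "U \<inter> V"])
    show UV: "openin T (U \<inter> V)" using U(1) open_section[OF f(1)] by blast
    show "y \<in> U \<inter> V" using U(2) f(2) by blast
    show "\<exists>g\<in>sections F (U \<inter> V). b = germ T y g" if "b \<in> insert a M" for b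
      using that U(3)[of b] f section_restrict[OF _ UV] by blast
  qed
qed

lemma comm_group_stalk:
  assumes y: "y \<in> topspace T"
  shows "comm_group (stalk T F y)"
proof (rule comm_groupI)
  show "\<one>\<^bsub>stalk T F y\<^esub> \<in> carrier (stalk T F y)"
    unfolding stalk_one by (rule germ_in_stalk[OF section_one[OF openin_topspace] y])
  fix a b c assume "a \<in> carrier (stalk T F y)" "b \<in> carrier (stalk T F y)" "c \<in> carrier (stalk T F y)"
  then obtain U where U: "openin T U" "y \<in> U"
      "\<And>d. d \<in> {a, b, c} \<Longrightarrow> \<exists>f\<in>sections F U. d = germ T y f"
    using stalk_common_neighbourhood[of "{a, b, c}" y] y by auto
  then obtain f g k where fgk: "f \<in> sections F U" "g \<in> sections F U" "k \<in> sections F U"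
      and abc: "a = germ T y f" "b = germ T y g" "c = germ T y k"
    by (metis insertCI)
  note group = comm_groupE[OF comm_group_vals[OF in_topspace[OF fgk(1)]]]
  note [simp] = fgk[THEN section_closed]
  show "a \<otimes>\<^bsub>stalk T F y\<^esub> b \<in> carrier (stalk T F y)"
    unfolding abc stalk_mult[OF y] by (rule germ_in_stalk[OF section_mult[OF fgk(1,2)] U(2)])
  show "a \<otimes>\<^bsub>stalk T F y\<^esub> b \<otimes>\<^bsub>stalk T F y\<^esub> c = a \<otimes>\<^bsub>stalk T F y\<^esub> (b \<otimes>\<^bsub>stalk T F y\<^esub> c)"
    unfolding abc stalk_mult[OF y] by (rule germ_cong[OF U(1,2)]) (simp add: group(3))
  show "a \<otimes>\<^bsub>stalk T F y\<^esub> b = b \<otimes>\<^bsub>stalk T F y\<^esub> a"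
    unfolding abc stalk_mult[OF y] by (rule germ_cong[OF U(1,2)]) (simp add: group(4))
  show "\<one>\<^bsub>stalk T F y\<^esub> \<otimes>\<^bsub>stalk T F y\<^esub> a = a"
    unfolding abc stalk_one stalk_mult[OF y] by (rule germ_cong[OF U(1,2)]) (simp add: group(5))
  have "germ T y (\<lambda>p. inv\<^bsub>vals F p\<^esub> (f p)) \<otimes>\<^bsub>stalk T F y\<^esub> a = \<one>\<^bsub>stalk T F y\<^esub>"
    unfolding abc stalk_one stalk_mult[OF y]
    by (rule germ_cong[OF U(1,2)])
      (simp add: group.l_inv[OF comm_group.axioms(2)[OF comm_group_vals[OF in_topspace[OF fgk(1)]]]])
  then show "\<exists>d\<in>carrier (stalk T F y). d \<otimes>\<^bsub>stalk T F y\<^esub> a = \<one>\<^bsub>stalk T F y\<^esub>"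
    using germ_in_stalk[OF section_inv[OF fgk(1)] U(2)] by blast
qed

lemma germ_inv:
  assumes f: "f \<in> sections F U" "y \<in> U"
  shows "germ T y (\<lambda>p. inv\<^bsub>vals F p\<^esub> (f p)) = inv\<^bsub>stalk T F y\<^esub> (germ T y f)"
proof -
  have y: "y \<in> topspace T" using in_topspace[OF f] .
  interpret S: comm_group "stalk T F y" by (rule comm_group_stalk[OF y])
  have "germ T y (\<lambda>p. inv\<^bsub>vals F p\<^esub> (f p)) \<otimes>\<^bsub>stalk T F y\<^esub> germ T y f = \<one>\<^bsub>stalk T F y\<^esub>"
    unfolding stalk_mult[OF y] stalk_one
    by (rule germ_eq_on_section[OF f])
      (simp add: group.l_inv[OF comm_group.axioms(2)[OF comm_group_vals[OF in_topspace[OF f(1)]]]]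
        section_closed[OF f(1)])
  then show ?thesis
    using f by (intro S.inv_equality[symmetric] germ_in_stalk section_inv)
qed

subsection \<open>Inverse images\<close>

definition germ_presheaf :: "'a set \<Rightarrow> ('a \<Rightarrow> ('a \<Rightarrow> 's) set) set" where
  "germ_presheaf N = {\<lambda>z. germ T z f |f U. f \<in> sections F U \<and> N \<subseteq> U}"

lemma germ_presheafI: "f \<in> sections F U \<Longrightarrow> N \<subseteq> U \<Longrightarrow> (\<lambda>z. germ T z f) \<in> germ_presheaf N"
  unfolding germ_presheaf_def by blast

lemma germ_presheafE:
  assumes "s \<in> germ_presheaf N"
  obtains f U where "f \<in> sections F U" "N \<subseteq> U" "s = (\<lambda>z. germ T z f)"
  using assms unfolding germ_presheaf_def by blast

lemma vals_inverse_image: "vals (inverse_image T Y F) = stalk T F"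
  by (simp add: inverse_image_def)

lemma inverse_image_sectionE:
  assumes "s \<in> sections (inverse_image T Y F) V" "y \<in> V"
  obtains U f where "f \<in> sections F U" "y \<in> U" "\<And>z. z \<in> U \<inter> V \<Longrightarrow> s z = germ T z f"
proof -
  have "\<exists>U f. openin T U \<and> y \<in> U \<and> f \<in> sections F U \<and> (\<forall>z\<in>U \<inter> V. s z = germ T z f)"
    using assms by (simp add: inverse_image_def)
  then show thesis using that by blast
qed

lemma inverse_image_sectionI:
  assumes "openin (subtopology T Y) V"
    and "\<And>y. y \<in> V \<Longrightarrow> \<exists>U f. f \<in> sections F U \<and> y \<in> U \<and> (\<forall>z\<in>U \<inter> V. s z = germ T z f)"
  shows "s \<in> sections (inverse_image T Y F) V"
  using assms open_section by (simp add: inverse_image_def) metis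

lemma germ_section_inverse_image:
  assumes "s \<in> sections F U" "openin (subtopology T Y) V" "V \<subseteq> U"
  shows "(\<lambda>p. germ T p s) \<in> sections (inverse_image T Y F) V"
  using assms by (intro inverse_image_sectionI exI[of _ U] exI[of _ s]) auto

lemma sections_inverse_image:
  "sections (inverse_image T Y F) = local_sections (subtopology T Y) germ_presheaf"
proof (rule ext, rule Set.set_eqI, rule iffI)
  fix V s assume s: "s \<in> sections (inverse_image T Y F) V"
  then have V: "openin (subtopology T Y) V" by (simp add: inverse_image_def)
  show "s \<in> local_sections (subtopology T Y) germ_presheaf V"
  proof (rule local_sectionsI[OF V])
    fix y assume y: "y \<in> V"
    with s obtain U f where f: "f \<in> sections F U" "y \<in> U" "\<And>z. z \<in> U \<inter> V \<Longrightarrow> s z = germ T z f"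
      by (rule inverse_image_sectionE) blast
    have "openin (subtopology T Y) (V \<inter> (U \<inter> Y))"
      using V open_section[OF f(1)] by (auto intro: openin_subtopology_Int)
    moreover have "V \<inter> (U \<inter> Y) = U \<inter> V"
      using openin_subset[OF V] by auto
    ultimately show "\<exists>N g. openin (subtopology T Y) N \<and> y \<in> N \<and> N \<subseteq> V \<and> g \<in> germ_presheaf N \<and>
        (\<forall>z\<in>N. s z = g z)"
      using f y germ_presheafI[OF f(1), of "U \<inter> V"]
      by (intro exI[of _ "U \<inter> V"] exI[of _ "\<lambda>z. germ T z f"]) auto
  qed
next
  fix V s assume s: "s \<in> local_sections (subtopology T Y) germ_presheaf V"
  note V = local_sections_open[OF s]
  show "s \<in> sections (inverse_image T Y F) V"
  proof (rule inverse_image_sectionI[OF V])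
    fix y assume "y \<in> V"
    with s obtain N g where N: "openin (subtopology T Y) N" "y \<in> N" "N \<subseteq> V" "g \<in> germ_presheaf N"
        "\<And>z. z \<in> N \<Longrightarrow> s z = g z"
      by (rule local_sectionsE) blast
    obtain f U where f: "f \<in> sections F U" "N \<subseteq> U" "g = (\<lambda>z. germ T z f)"
      using N(4) by (rule germ_presheafE)
    obtain W where W: "openin T W" "N = W \<inter> Y" using N(1) by (auto simp: openin_subtopology)
    have "f \<in> sections F (U \<inter> W)"
      using W(1) open_section[OF f(1)] by (intro section_restrict[OF f(1)]) auto
    then show "\<exists>U f. f \<in> sections F U \<and> y \<in> U \<and> (\<forall>z\<in>U \<inter> V. s z = germ T z f)"
      using N f W openin_subset[OF V] by (intro exI[of _ "U \<inter> W"] exI[of _ f]) auto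
  qed
qed

lemma ab_sheaf_inverse_image:
  assumes Y: "Y \<subseteq> topspace T"
  shows "ab_sheaf (subtopology T Y) (inverse_image T Y F)"
proof (rule ab_presheaf.ab_sheaf_local_sections[OF _ vals_inverse_image sections_inverse_image],
    rule ab_presheaf.intro)
  show "comm_group (stalk T F p)" if "p \<in> topspace (subtopology T Y)" for p
    using that by (intro comm_group_stalk) simp
  fix N s assume s: "s \<in> germ_presheaf N"
  then obtain f U where f: "f \<in> sections F U" "N \<subseteq> U" "s = (\<lambda>z. germ T z f)"
    by (rule germ_presheafE)
  show "s p \<in> carrier (stalk T F p)" if "p \<in> N" for p
    using that f(2) unfolding f(3) by (intro germ_in_stalk[OF f(1)]) blast
  show "s \<in> germ_presheaf M" if "M \<subseteq> N" for M
    unfolding f(3) using that f(2) by (intro germ_presheafI[OF f(1)]) blast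
  show "\<exists>k\<in>germ_presheaf N. \<forall>p\<in>N. k p = inv\<^bsub>stalk T F p\<^esub> (s p)"
    using f(2) germ_inv[OF f(1)] unfolding f(3)
    by (intro bexI[OF _ germ_presheafI[OF section_inv[OF f(1)] f(2)]]) auto
  fix t assume "t \<in> germ_presheaf N"
  then obtain g W where g: "g \<in> sections F W" "N \<subseteq> W" "t = (\<lambda>z. germ T z g)"
    by (rule germ_presheafE)
  have UW: "openin T (U \<inter> W)" using open_section f(1) g(1) by blast
  have "(\<lambda>p. f p \<otimes>\<^bsub>vals F p\<^esub> g p) \<in> sections F (U \<inter> W)"
    using section_restrict[OF f(1) UW] section_restrict[OF g(1) UW] by (intro section_mult) auto
  then show "\<exists>k\<in>germ_presheaf N. \<forall>p\<in>N. k p = s p \<otimes>\<^bsub>stalk T F p\<^esub> t p"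
    using f(2) g(2) openin_subset[OF UW] unfolding f(3) g(3)
    by (intro bexI[of _ "\<lambda>z. germ T z (\<lambda>p. f p \<otimes>\<^bsub>vals F p\<^esub> g p)"] ballI stalk_mult[symmetric]
        germ_presheafI[of _ "U \<inter> W"]) auto
next
  fix N assume "openin (subtopology T Y) N"
  then have "N \<subseteq> topspace T" using openin_subset by fastforce
  then show "\<exists>k\<in>germ_presheaf N. \<forall>p\<in>N. k p = \<one>\<^bsub>stalk T F p\<^esub>"
    using germ_presheafI[OF section_one[OF openin_topspace]] stalk_one by metis
qed

subsection \<open>Restriction of cohomology classes\<close>

definition restrict_cochain :: "'a set \<Rightarrow> ('a, 's) cochain \<Rightarrow> ('a, ('a \<Rightarrow> 's) set) cochain" where
  "restrict_cochain Y u = (\<lambda>x. fst u x \<inter> Y, \<lambda>x y p. germ T p (snd u x y))"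

lemma restrict_cochain_cocycle:
  assumes Y: "Y \<subseteq> topspace T" and u: "u \<in> cocycles T F"
  shows "restrict_cochain Y u \<in> cocycles (subtopology T Y) (inverse_image T Y F)"
proof -
  obtain U c where uc: "u = (U, c)" by force
  note c = u[unfolded uc]
  have op: "openin (subtopology T Y) (U x \<inter> Y)" if "x \<in> Y" for x
    using cocycle_cover_open[OF c] that Y by (auto intro: openin_subtopology_Int)
  have "germ T p (c x y) \<otimes>\<^bsub>stalk T F p\<^esub> germ T p (c y z) = germ T p (c x z)"
    if xyz: "x \<in> Y" "y \<in> Y" "z \<in> Y" and p: "p \<in> U x \<inter> U y \<inter> U z" for x y z p
  proof -
    have xyzT: "x \<in> topspace T" "y \<in> topspace T" "z \<in> topspace T" using xyz Y by auto
    then have op: "openin T (U x \<inter> U y \<inter> U z)" using cocycle_cover_open[OF c] by blast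
    from germ_cong[OF op p cocycle_mult[OF c xyzT]] show ?thesis
      using openin_subset[OF op] p by (subst stalk_mult) auto
  qed
  moreover have "(\<lambda>p. germ T p (c x y)) \<in> sections (inverse_image T Y F) ((U x \<inter> Y) \<inter> (U y \<inter> Y))"
    if "x \<in> Y" "y \<in> Y" for x y
    using that Y op by (intro germ_section_inverse_image[OF cocycle_section[OF c]]) auto
  ultimately show ?thesis
    using op cocycle_cover_mem[OF c] Y
    unfolding cocycles_def restrict_cochain_def uc vals_inverse_image
    by (auto simp: subset_iff Int_absorb1)
qed

lemma restrict_cochain_coboundary:
  assumes Y: "Y \<subseteq> topspace T" and "coboundary T F U c U' c' V b"
  shows "coboundary (subtopology T Y) (inverse_image T Y F) (\<lambda>x. U x \<inter> Y) (\<lambda>x y p. germ T p (c x y))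
    (\<lambda>x. U' x \<inter> Y) (\<lambda>x y p. germ T p (c' x y)) (\<lambda>x. V x \<inter> Y) (\<lambda>x p. germ T p (b x))"
proof -
  interpret coboundary T F U c U' c' V b by (rule assms(2))
  interpret I: ab_sheaf "subtopology T Y" "inverse_image T Y F"
    by (rule ab_sheaf_inverse_image[OF Y])
  show ?thesis
  proof (unfold_locales)
    show "(\<lambda>x. U x \<inter> Y, \<lambda>x y p. germ T p (c x y)) \<in> cocycles (subtopology T Y) (inverse_image T Y F)"
      "(\<lambda>x. U' x \<inter> Y, \<lambda>x y p. germ T p (c' x y)) \<in> cocycles (subtopology T Y) (inverse_image T Y F)"
      using restrict_cochain_cocycle[OF Y source] restrict_cochain_cocycle[OF Y target]
      by (simp_all add: restrict_cochain_def)
    fix x assume x: "x \<in> topspace (subtopology T Y)"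
    then show op: "openin (subtopology T Y) (V x \<inter> Y)"
      using cover_open by (auto intro: openin_subtopology_Int)
    show "x \<in> V x \<inter> Y" "V x \<inter> Y \<subseteq> U x \<inter> Y \<inter> (U' x \<inter> Y)"
      using x cover_mem cover_refines by auto
    show "(\<lambda>p. germ T p (b x)) \<in> sections (inverse_image T Y F) (V x \<inter> Y)"
      using x cochain by (intro germ_section_inverse_image[OF _ op]) auto
    fix y p assume "y \<in> topspace (subtopology T Y)" and p: "p \<in> V x \<inter> Y \<inter> (V y \<inter> Y)"
    then have xy: "x \<in> topspace T" "y \<in> topspace T" using x by auto
    have "openin T (V x \<inter> V y)" using cover_open xy by blast
    moreover have "p \<in> V x \<inter> V y" using p by blast
    ultimately show "germ T p (b x) \<otimes>\<^bsub>vals (inverse_image T Y F) p\<^esub> germ T p (c' x y) =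
        germ T p (c x y) \<otimes>\<^bsub>vals (inverse_image T Y F) p\<^esub> germ T p (b y)"
      unfolding vals_inverse_image stalk_mult[OF subsetD[OF Y IntD2[OF IntD1[OF p]]]]
      by (rule germ_cong) (rule coboundary[OF xy])
  qed
qed

lemma H1_restrict_coh_class:
  assumes Y: "Y \<subseteq> topspace T" and u: "u \<in> cocycles T F"
  shows "H1_restrict T Y F (coh_class T F u) =
    coh_class (subtopology T Y) (inverse_image T Y F) (restrict_cochain Y u)"
proof -
  interpret I: ab_sheaf "subtopology T Y" "inverse_image T Y F"
    by (rule ab_sheaf_inverse_image[OF Y])
  have "(restrict_cochain Y u, restrict_cochain Y v) \<in> cohomologous (subtopology T Y) (inverse_image T Y F)"
    if "(u, v) \<in> cohomologous T F" for v
  proof -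
    obtain U c U' c' V b where "u = (U, c)" "v = (U', c')" "coboundary T F U c U' c' V b"
      using \<open>(u, v) \<in> cohomologous T F\<close> by (rule cohomologousE)
    then show ?thesis
      unfolding restrict_cochain_def by (simp add: I.cohomologousI[OF restrict_cochain_coboundary[OF Y]])
  qed
  then have "(\<Union>v\<in>coh_class T F u. coh_class (subtopology T Y) (inverse_image T Y F) (restrict_cochain Y v)) =
      coh_class (subtopology T Y) (inverse_image T Y F) (restrict_cochain Y u)"
    using cohomologous_refl[OF u] by (intro I.UN_coh_class) (auto simp: coh_class_def)
  then show ?thesis
    unfolding H1_restrict_def restrict_cochain_def by (simp add: split_beta)
qed

end

subsection \<open>Operators between sheaves\<close>

locale sheaf_operator = F: ab_sheaf T F + G: ab_sheaf T G
  for T :: "'a topology" and F :: "('a, 's, 'z) sheaf_scheme" and G :: "('a, 't, 'y) sheaf_scheme" +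
  fixes \<Phi> :: "('a \<Rightarrow> 's) \<Rightarrow> 'a \<Rightarrow> 't"
  assumes local: "openin T N \<Longrightarrow> \<forall>x\<in>N. f' x = f x \<Longrightarrow> \<forall>x\<in>N. \<Phi> f' x = \<Phi> f x"
    and operator_section: "s \<in> sections F U \<Longrightarrow> \<Phi> s \<in> sections G U"
    and operator_mult: "s \<in> sections F U \<Longrightarrow> t \<in> sections F U \<Longrightarrow> x \<in> U \<Longrightarrow>
      \<Phi> (\<lambda>p. s p \<otimes>\<^bsub>vals F p\<^esub> t p) x = \<Phi> s x \<otimes>\<^bsub>vals G x\<^esub> \<Phi> t x"
begin

lemma operator_germ: "p \<in> topspace T \<Longrightarrow> (\<Union>f'\<in>germ T p f. germ T p (\<Phi> f')) = germ T p (\<Phi> f)"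
  by (rule UN_germ[OF _ local])

lemma operator_stalk_hom:
  assumes p: "p \<in> topspace T"
  shows "(\<lambda>a. \<Union>f\<in>a. germ T p (\<Phi> f)) \<in> hom (stalk T F p) (stalk T G p)"
proof (rule homI)
  show "(\<Union>f\<in>a. germ T p (\<Phi> f)) \<in> carrier (stalk T G p)" if "a \<in> carrier (stalk T F p)" for a
    using that by (elim F.stalkE) (simp add: operator_germ[OF p] G.germ_in_stalk[OF operator_section])
  fix a b assume "a \<in> carrier (stalk T F p)" "b \<in> carrier (stalk T F p)"
  then obtain U where U: "openin T U" "p \<in> U" "\<And>d. d \<in> {a, b} \<Longrightarrow> \<exists>f\<in>sections F U. d = germ T p f"
    using F.stalk_common_neighbourhood[of "{a, b}" p] p by auto
  then obtain f g where fg: "f \<in> sections F U" "g \<in> sections F U" and ab: "a = germ T p f" "b = germ T p g"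
    by (metis insertCI)
  show "(\<Union>f\<in>a \<otimes>\<^bsub>stalk T F p\<^esub> b. germ T p (\<Phi> f)) =
      (\<Union>f\<in>a. germ T p (\<Phi> f)) \<otimes>\<^bsub>stalk T G p\<^esub> (\<Union>f\<in>b. germ T p (\<Phi> f))"
    unfolding ab stalk_mult[OF p] operator_germ[OF p]
    by (rule germ_cong[OF U(1,2)]) (rule operator_mult[OF fg])
qed

lemma sheaf_hom_inverse_image:
  assumes Y: "Y \<subseteq> topspace T"
  shows "sheaf_hom (subtopology T Y) (inverse_image T Y F) (inverse_image T Y G)
    (\<lambda>p a. \<Union>f\<in>a. germ T p (\<Phi> f))"
proof -
  interpret IF: ab_sheaf "subtopology T Y" "inverse_image T Y F"
    by (rule F.ab_sheaf_inverse_image[OF Y])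
  interpret IG: ab_sheaf "subtopology T Y" "inverse_image T Y G"
    by (rule G.ab_sheaf_inverse_image[OF Y])
  show ?thesis
  proof unfold_locales
    show "(\<lambda>a. \<Union>f\<in>a. germ T p (\<Phi> f)) \<in> hom (vals (inverse_image T Y F) p) (vals (inverse_image T Y G) p)"
      if "p \<in> topspace (subtopology T Y)" for p
      using that operator_stalk_hom by (simp add: F.vals_inverse_image G.vals_inverse_image)
    fix s V assume s: "s \<in> sections (inverse_image T Y F) V"
    show "(\<lambda>p. \<Union>f\<in>s p. germ T p (\<Phi> f)) \<in> sections (inverse_image T Y G) V"
    proof (rule G.inverse_image_sectionI[OF IF.open_section[OF s]])
      fix y assume "y \<in> V"
      with s obtain U f where f: "f \<in> sections F U" "y \<in> U" "\<And>z. z \<in> U \<inter> V \<Longrightarrow> s z = germ T z f"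
        by (rule F.inverse_image_sectionE) blast
      then show "\<exists>U g. g \<in> sections G U \<and> y \<in> U \<and> (\<forall>z\<in>U \<inter> V. (\<Union>f\<in>s z. germ T z (\<Phi> f)) = germ T z g)"
        using operator_section operator_germ F.in_topspace[OF f(1)]
        by (intro exI[of _ U] exI[of _ "\<Phi> f"]) auto
    qed
  qed
qed

end

lemma sheaf_hom_inverse_image_inclusion:
  assumes F: "ab_sheaf T F" and G: "ab_sheaf T G" and Y: "Y \<subseteq> topspace T"
    and vals: "vals F = vals G" and sub: "\<And>U. sections F U \<subseteq> sections G U"
  shows "sheaf_hom (subtopology T Y) (inverse_image T Y F) (inverse_image T Y G) (\<lambda>p a. a)"
proof -
  interpret F: ab_sheaf T F by (rule F)
  interpret G: ab_sheaf T G by (rule G)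
  interpret IF: ab_sheaf "subtopology T Y" "inverse_image T Y F"
    by (rule F.ab_sheaf_inverse_image[OF Y])
  interpret IG: ab_sheaf "subtopology T Y" "inverse_image T Y G"
    by (rule G.ab_sheaf_inverse_image[OF Y])
  have "mult (stalk T F p) = mult (stalk T G p)" "carrier (stalk T F p) \<subseteq> carrier (stalk T G p)" for p
    using vals sub by (auto simp: stalk_def)
  then have stalk_hom: "(\<lambda>a. a) \<in> hom (stalk T F p) (stalk T G p)" for p
    by (auto simp: hom_def)
  show ?thesis
  proof unfold_locales
    show "(\<lambda>a. a) \<in> hom (vals (inverse_image T Y F) p) (vals (inverse_image T Y G) p)" for p
      unfolding F.vals_inverse_image G.vals_inverse_image by (rule stalk_hom)
    show "s \<in> sections (inverse_image T Y G) V" if s: "s \<in> sections (inverse_image T Y F) V" for s V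
    proof (rule G.inverse_image_sectionI[OF IF.open_section[OF s]])
      show "\<exists>U f. f \<in> sections G U \<and> y \<in> U \<and> (\<forall>z\<in>U \<inter> V. s z = germ T z f)" if "y \<in> V" for y
        using s that by (rule F.inverse_image_sectionE) (use sub in blast)
    qed
  qed
qed

section \<open>Holomorphic functions and 1-forms on complex manifolds\<close>

subsection \<open>Charts\<close>

definition holo_at :: "('a, 'n::finite) chart set \<Rightarrow> ('a \<Rightarrow> complex) \<Rightarrow> 'a \<Rightarrow> bool" where
  "holo_at A f x \<longleftrightarrow> (\<forall>(W, \<phi>)\<in>A. x \<in> W \<longrightarrow> cdiff_at (\<lambda>z. f (inv_into W \<phi> z)) (\<phi> x))"

lemma cgrad_nth: "cgrad (W, \<phi>) f x $ i = cpartial i (\<lambda>z. f (inv_into W \<phi> z)) (\<phi> x)"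
  by (simp add: cgrad_def cpartial_def)

locale holomorphic_atlas =
  fixes X :: "'a topology" and A :: "('a, 'n::finite) chart set"
  assumes complex_manifold: "complex_manifold X A"
begin

lemma
  assumes "(W, \<phi>) \<in> A"
  shows chart_open: "openin X W" and chart_image_open: "open (\<phi> ` W)"
    and chart_inj_on: "inj_on \<phi> W"
    and chart_homeomorphic_map: "homeomorphic_map (subtopology X W) (top_of_set (\<phi> ` W)) \<phi>"
proof -
  have chart: "is_chart X (W, \<phi>)"
    using complex_manifold assms unfolding complex_manifold_def by blast
  then show "openin X W" "open (\<phi> ` W)"
    and homeo: "homeomorphic_map (subtopology X W) (top_of_set (\<phi> ` W)) \<phi>"
    by (auto simp: is_chart_def)
  have "topspace (subtopology X W) = W"
    using chart openin_subset by (fastforce simp: is_chart_def)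
  then show "inj_on \<phi> W"
    using homeomorphic_imp_injective_map[OF homeo] by simp
qed

lemma chart_inverse: "(W, \<phi>) \<in> A \<Longrightarrow> x \<in> W \<Longrightarrow> inv_into W \<phi> (\<phi> x) = x"
  by (simp add: chart_inj_on)

lemma chart_exists:
  assumes "x \<in> topspace X"
  obtains W \<phi> where "(W, \<phi>) \<in> A" "x \<in> W"
proof -
  have "\<exists>c\<in>A. x \<in> fst c"
    using assms complex_manifold unfolding complex_manifold_def by blast
  then show thesis using that by force
qed

lemma chart_transition:
  assumes "(W, \<phi>) \<in> A" "(V, \<psi>) \<in> A"
  shows "cholo_on (\<phi> ` (W \<inter> V)) (\<lambda>z. \<psi> (inv_into W \<phi> z) $ i)"
proof -
  have "transition_holo (W, \<phi>) (V, \<psi>)"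
    using complex_manifold assms unfolding complex_manifold_def by blast
  then show ?thesis by (simp add: transition_holo_def)
qed

lemma open_chart_image:
  assumes chart: "(W, \<phi>) \<in> A" and U: "openin X U"
  shows "open (\<phi> ` (U \<inter> W))"
proof -
  have "openin (subtopology X W) (U \<inter> W)"
    using U by (auto simp: openin_subtopology)
  then have "openin (top_of_set (\<phi> ` W)) (\<phi> ` (U \<inter> W))"
    using homeomorphic_imp_open_map[OF chart_homeomorphic_map[OF chart]] by (auto simp: open_map_def)
  then show ?thesis
    using chart_image_open[OF chart] by (simp add: openin_open_eq)
qed

lemma openin_chart_preimage:
  assumes chart: "(W, \<phi>) \<in> A" and S: "open S"
  shows "openin X {x \<in> W. \<phi> x \<in> S}"
proof -
  have W: "W \<subseteq> topspace X" by (rule openin_subset[OF chart_open[OF chart]])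
  have "continuous_map (subtopology X W) (top_of_set (\<phi> ` W)) \<phi>"
    using chart_homeomorphic_map[OF chart] by (rule homeomorphic_imp_continuous_map)
  moreover have "openin (top_of_set (\<phi> ` W)) (\<phi> ` W \<inter> S)"
    using S by auto
  ultimately have "openin (subtopology X W) {x \<in> topspace (subtopology X W). \<phi> x \<in> \<phi> ` W \<inter> S}"
    by (rule openin_continuous_map_preimage)
  moreover have "{x \<in> topspace (subtopology X W). \<phi> x \<in> \<phi> ` W \<inter> S} = {x \<in> W. \<phi> x \<in> S}"
    using W by auto
  ultimately show ?thesis
    by (simp only: openin_open_subtopology[OF chart_open[OF chart]])
qed

lemma continuous_map_chart_inverse:
  assumes chart: "(W, \<phi>) \<in> A"
  shows "continuous_map (top_of_set (\<phi> ` W)) X (inv_into W \<phi>)"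
proof -
  obtain g where "homeomorphic_maps (subtopology X W) (top_of_set (\<phi> ` W)) \<phi> g"
    using chart_homeomorphic_map[OF chart] by (auto simp: homeomorphic_map_maps)
  then have g: "continuous_map (top_of_set (\<phi> ` W)) (subtopology X W) g"
      "\<And>x. x \<in> topspace (subtopology X W) \<Longrightarrow> g (\<phi> x) = x"
    by (auto simp: homeomorphic_maps_def)
  have "W \<subseteq> topspace X" by (rule openin_subset[OF chart_open[OF chart]])
  then have "g z = inv_into W \<phi> z" if "z \<in> topspace (top_of_set (\<phi> ` W))" for z
    using that g(2) chart_inverse[OF chart] by auto
  moreover have "continuous_map (top_of_set (\<phi> ` W)) X g"
    using g(1) by (simp add: continuous_map_in_subtopology)
  ultimately show ?thesis
    by (rule continuous_map_eq[rotated])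
qed

lemma chart_change:
  assumes "(W, \<phi>) \<in> A" "(V, \<psi>) \<in> A" "z \<in> \<psi> ` (W \<inter> V)"
  shows "f (inv_into W \<phi> (\<phi> (inv_into V \<psi> z))) = f (inv_into V \<psi> z)"
  using assms chart_inverse[of W \<phi>] chart_inverse[of V \<psi>] by auto

lemma continuous_map_if_isCont_in_charts:
  fixes f :: "'a \<Rightarrow> 'b::topological_space"
  assumes U: "openin X U"
    and cont: "\<And>x W \<phi>. x \<in> U \<Longrightarrow> (W, \<phi>) \<in> A \<Longrightarrow> x \<in> W \<Longrightarrow> isCont (\<lambda>z. f (inv_into W \<phi> z)) (\<phi> x)"
  shows "continuous_map (subtopology X U) euclidean f"
proof -
  have "openin X {x \<in> U. f x \<in> S}" if S: "open S" for S
  proof (subst openin_subopen, intro ballI)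
    fix x assume "x \<in> {x \<in> U. f x \<in> S}"
    then have x: "x \<in> U" "f x \<in> S" by auto
    obtain W \<phi> where chart: "(W, \<phi>) \<in> A" "x \<in> W"
      using chart_exists x(1) openin_subset[OF U] by blast
    obtain B where B: "open B" "\<phi> x \<in> B" "\<And>z. z \<in> B \<Longrightarrow> f (inv_into W \<phi> z) \<in> S"
      using cont[OF x(1) chart] S x(2) chart_inverse[OF chart] unfolding continuous_at_open by metis
    have "openin X ({y \<in> W. \<phi> y \<in> B} \<inter> U)"
      using openin_chart_preimage[OF chart(1) B(1)] U by blast
    moreover have "f y \<in> S" if "y \<in> W" "\<phi> y \<in> B" for y
      using B(3)[OF that(2)] chart_inverse[OF chart(1) that(1)] by simp
    ultimately show "\<exists>N. openin X N \<and> x \<in> N \<and> N \<subseteq> {x \<in> U. f x \<in> S}"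
      using chart x B(2) by (intro exI[of _ "{y \<in> W. \<phi> y \<in> B} \<inter> U"]) auto
  qed
  moreover have "topspace (subtopology X U) = U" using openin_subset[OF U] by auto
  ultimately show ?thesis
    unfolding continuous_map_def by (simp add: openin_open_subtopology[OF U])
qed

subsection \<open>Holomorphic functions\<close>

lemma holo_atD: "holo_at A f x \<Longrightarrow> (W, \<phi>) \<in> A \<Longrightarrow> x \<in> W \<Longrightarrow> cdiff_at (\<lambda>z. f (inv_into W \<phi> z)) (\<phi> x)"
  unfolding holo_at_def by blast

lemma holo_fun_iff: "holo_fun A U f \<longleftrightarrow> (\<forall>x\<in>U. holo_at A f x)"
  unfolding holo_fun_def holo_at_def cholo_on_iff by fastforce

lemma holo_at_if_cdiff_at:
  assumes chart: "(W, \<phi>) \<in> A" "x \<in> W" and f: "cdiff_at (\<lambda>z. f (inv_into W \<phi> z)) (\<phi> x)"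
  shows "holo_at A f x"
  unfolding holo_at_def
proof (safe)
  fix V \<psi> assume chart': "(V, \<psi>) \<in> A" "x \<in> V"
  have op: "open (\<psi> ` (W \<inter> V))"
    by (rule open_chart_image[OF chart'(1) chart_open[OF chart(1)]])
  have x: "\<psi> x \<in> \<psi> ` (W \<inter> V)" using chart chart' by auto
  have "cdiff_at (\<lambda>z. f (inv_into W \<phi> (\<phi> (inv_into V \<psi> z)))) (\<psi> x)"
  proof (rule cdiff_at_compose)
    show "cdiff_at (\<lambda>z. f (inv_into W \<phi> z)) (\<phi> (inv_into V \<psi> (\<psi> x)))"
      using f chart_inverse[OF chart'] by simp
    show "cdiff_at (\<lambda>z. \<phi> (inv_into V \<psi> z) $ i) (\<psi> x)" for i
      using chart_transition[OF chart'(1) chart(1)] x by (auto simp: cholo_on_iff Int_commute)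
  qed
  then show "cdiff_at (\<lambda>z. f (inv_into V \<psi> z)) (\<psi> x)"
    by (rule cdiff_at_cong[OF _ op x]) (rule chart_change[OF chart(1) chart'(1), symmetric])
qed

lemma holo_atI:
  assumes chart: "(W, \<phi>) \<in> A" "x \<in> W" and N: "openin X N" "x \<in> N"
    and g: "cdiff_at g (\<phi> x)" and eq: "\<And>y. y \<in> N \<Longrightarrow> y \<in> W \<Longrightarrow> f y = g (\<phi> y)"
  shows "holo_at A f x"
proof (rule holo_at_if_cdiff_at[OF chart], rule cdiff_at_cong[OF g])
  show "open (\<phi> ` (N \<inter> W))" by (rule open_chart_image[OF chart(1) N(1)])
  show "\<phi> x \<in> \<phi> ` (N \<inter> W)" using chart N by blast
  show "f (inv_into W \<phi> z) = g z" if "z \<in> \<phi> ` (N \<inter> W)" for z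
    using that eq chart_inverse[OF chart(1)] by auto
qed

lemma holo_at_cong:
  assumes f: "holo_at A f x" and N: "openin X N" "x \<in> N" and eq: "\<And>y. y \<in> N \<Longrightarrow> g y = f y"
  shows "holo_at A g x"
proof -
  obtain W \<phi> where chart: "(W, \<phi>) \<in> A" "x \<in> W"
    using chart_exists N openin_subset by (metis in_mono)
  show ?thesis
    using eq chart_inverse[OF chart(1)] by (intro holo_atI[OF chart N holo_atD[OF f chart]]) simp
qed

lemma holo_at_const: "holo_at A (\<lambda>y. c) x"
  by (auto simp: holo_at_def intro: cdiff_at_const)

lemma holo_at_add: "holo_at A f x \<Longrightarrow> holo_at A g x \<Longrightarrow> holo_at A (\<lambda>y. f y + g y) x"
  by (auto simp: holo_at_def intro!: cdiff_at_add)

lemma holo_at_mult: "holo_at A f x \<Longrightarrow> holo_at A g x \<Longrightarrow> holo_at A (\<lambda>y. f y * g y) x"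
  by (auto simp: holo_at_def intro!: cdiff_at_mult)

lemma holo_at_compose_field:
  "holo_at A f x \<Longrightarrow> (g has_field_derivative g') (at (f x)) \<Longrightarrow> holo_at A (\<lambda>y. g (f y)) x"
  using chart_inverse
  by (auto simp: holo_at_def intro!: cdiff_at_compose_field[where g = g and g' = g'])

lemma holo_at_minus: "holo_at A f x \<Longrightarrow> holo_at A (\<lambda>y. - f y) x"
  using holo_at_mult[OF holo_at_const[of "-1"]] by simp

lemma holo_at_inverse: "holo_at A f x \<Longrightarrow> f x \<noteq> 0 \<Longrightarrow> holo_at A (\<lambda>y. inverse (f y)) x"
  by (rule holo_at_compose_field[OF _ DERIV_inverse])

lemma holo_at_coordinate:
  assumes "(W, \<phi>) \<in> A" "x \<in> W"
  shows "holo_at A (\<lambda>y. \<phi> y $ i) x"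
  by (rule holo_atI[OF assms chart_open[OF assms(1)] assms(2) cdiff_at_nth]) simp

lemma openin_holo_preimage:
  assumes U: "openin X U" and f: "\<And>y. y \<in> U \<Longrightarrow> holo_at A f y" and S: "open S"
  shows "openin X {y \<in> U. f y \<in> S}"
proof -
  have "continuous_map (subtopology X U) euclidean f"
    using f by (intro continuous_map_if_isCont_in_charts[OF U] cdiff_at_isCont holo_atD)
  from openin_continuous_map_preimage[OF this, of S] S
  show ?thesis
    using openin_subset[OF U] by (simp add: openin_open_subtopology[OF U] Int_absorb1)
qed

subsection \<open>Gradients in charts\<close>

lemma holo_at_has_derivative:
  assumes "holo_at A f x" "(W, \<phi>) \<in> A" "x \<in> W"
  shows "((\<lambda>z. f (inv_into W \<phi> z)) has_derivative (\<lambda>v. \<Sum>i\<in>UNIV. v $ i * cgrad (W, \<phi>) f x $ i)) (at (\<phi> x))"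
  using cdiff_at_has_derivative[OF holo_atD[OF assms]] by (simp add: cgrad_nth)

lemma cgrad_eqI:
  assumes "((\<lambda>z. f (inv_into W \<phi> z)) has_derivative (\<lambda>v. \<Sum>i\<in>UNIV. v $ i * a $ i)) (at (\<phi> x))"
  shows "cgrad (W, \<phi>) f x = a"
  using cpartial_eqI[OF assms] by (simp add: vec_eq_iff cgrad_nth)

lemma cgrad_cong:
  assumes chart: "(W, \<phi>) \<in> A" "x \<in> W" and N: "openin X N" "x \<in> N" "\<And>y. y \<in> N \<Longrightarrow> f y = g y"
  shows "cgrad (W, \<phi>) f x = cgrad (W, \<phi>) g x"
proof -
  have "cpartial i (\<lambda>z. f (inv_into W \<phi> z)) (\<phi> x) = cpartial i (\<lambda>z. g (inv_into W \<phi> z)) (\<phi> x)" for i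
    using chart N chart_inverse[OF chart(1)]
    by (intro cpartial_cong[OF open_chart_image[OF chart(1) N(1)]]) auto
  then show ?thesis by (simp add: vec_eq_iff cgrad_nth)
qed

lemma cgrad_compose_field:
  assumes f: "holo_at A f x" and chart: "(W, \<phi>) \<in> A" "x \<in> W"
    and g: "(g has_field_derivative g') (at (f x))"
  shows "cgrad (W, \<phi>) (\<lambda>y. g (f y)) x = g' *s cgrad (W, \<phi>) f x"
proof (rule cgrad_eqI)
  have "(g has_derivative (*) g') (at (f (inv_into W \<phi> (\<phi> x))))"
    using g chart_inverse[OF chart] by (simp add: has_field_derivative_def)
  from has_derivative_compose[OF holo_at_has_derivative[OF f chart] this]
  show "((\<lambda>z. g (f (inv_into W \<phi> z))) has_derivative
      (\<lambda>v. \<Sum>i\<in>UNIV. v $ i * (g' *s cgrad (W, \<phi>) f x) $ i)) (at (\<phi> x))"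
    by (simp add: sum_distrib_left mult.left_commute)
qed

lemma cgrad_mult:
  assumes f: "holo_at A f x" and g: "holo_at A g x" and chart: "(W, \<phi>) \<in> A" "x \<in> W"
  shows "cgrad (W, \<phi>) (\<lambda>y. f y * g y) x = f x *s cgrad (W, \<phi>) g x + g x *s cgrad (W, \<phi>) f x"
proof (rule cgrad_eqI)
  from has_derivative_mult[OF holo_at_has_derivative[OF f chart] holo_at_has_derivative[OF g chart]]
  show "((\<lambda>z. f (inv_into W \<phi> z) * g (inv_into W \<phi> z)) has_derivative
      (\<lambda>v. \<Sum>i\<in>UNIV. v $ i * (f x *s cgrad (W, \<phi>) g x + g x *s cgrad (W, \<phi>) f x) $ i)) (at (\<phi> x))"
    using chart_inverse[OF chart]
    by (simp add: sum_distrib_left sum_distrib_right sum.distrib[symmetric] algebra_simps)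
qed

lemma cgrad_add:
  assumes f: "holo_at A f x" and g: "holo_at A g x" and chart: "(W, \<phi>) \<in> A" "x \<in> W"
  shows "cgrad (W, \<phi>) (\<lambda>y. f y + g y) x = cgrad (W, \<phi>) f x + cgrad (W, \<phi>) g x"
proof (rule cgrad_eqI)
  from has_derivative_add[OF holo_at_has_derivative[OF f chart] holo_at_has_derivative[OF g chart]]
  show "((\<lambda>z. f (inv_into W \<phi> z) + g (inv_into W \<phi> z)) has_derivative
      (\<lambda>v. \<Sum>i\<in>UNIV. v $ i * (cgrad (W, \<phi>) f x + cgrad (W, \<phi>) g x) $ i)) (at (\<phi> x))"
    by (simp add: sum.distrib[symmetric] algebra_simps)
qed

definition chart_jacobian :: "('a, 'n) chart \<Rightarrow> ('a, 'n) chart \<Rightarrow> 'a \<Rightarrow> complex^'n \<Rightarrow> complex^'n" where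
  "chart_jacobian c d x v = (\<chi> i. \<Sum>k\<in>UNIV. v $ k * cgrad d (\<lambda>y. snd c y $ i) x $ k)"

lemma has_derivative_chart_change:
  assumes "(W, \<phi>) \<in> A" "x \<in> W" "(V, \<psi>) \<in> A" "x \<in> V"
  shows "((\<lambda>z. \<phi> (inv_into V \<psi> z)) has_derivative chart_jacobian (W, \<phi>) (V, \<psi>) x) (at (\<psi> x))"
  unfolding chart_jacobian_def snd_conv
  by (intro has_derivative_vecI holo_at_has_derivative holo_at_coordinate[OF assms(1,2)] assms(3,4))

lemma has_derivative_in_chart:
  assumes chart: "(W, \<phi>) \<in> A" "x \<in> W" and chart': "(V, \<psi>) \<in> A" "x \<in> V"
    and f: "((\<lambda>z. f (inv_into W \<phi> z)) has_derivative D) (at (\<phi> x))"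
  shows "((\<lambda>z. f (inv_into V \<psi> z)) has_derivative (\<lambda>v. D (chart_jacobian (W, \<phi>) (V, \<psi>) x v))) (at (\<psi> x))"
proof -
  have "((\<lambda>z. f (inv_into W \<phi> (\<phi> (inv_into V \<psi> z)))) has_derivative
      (\<lambda>v. D (chart_jacobian (W, \<phi>) (V, \<psi>) x v))) (at (\<psi> x))"
    by (rule has_derivative_compose[OF has_derivative_chart_change[OF chart chart']])
      (simp add: chart_inverse[OF chart'] f)
  then show ?thesis
  proof (rule has_derivative_transform_within_open)
    show "open (\<psi> ` (W \<inter> V))"
      by (rule open_chart_image[OF chart'(1) chart_open[OF chart(1)]])
    show "\<psi> x \<in> \<psi> ` (W \<inter> V)" using chart chart' by blast
  qed (rule chart_change[OF chart(1) chart'(1)])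
qed

lemma cgrad_chain:
  assumes f: "holo_at A f x" and chart: "(W, \<phi>) \<in> A" "x \<in> W" and chart': "(V, \<psi>) \<in> A" "x \<in> V"
  shows "cgrad (V, \<psi>) f x = (\<Sum>i\<in>UNIV. (cgrad (W, \<phi>) f x $ i) *s cgrad (V, \<psi>) (\<lambda>y. \<phi> y $ i) x)"
proof (rule cgrad_eqI)
  let ?g = "cgrad (W, \<phi>) f x" and ?J = "\<lambda>i. cgrad (V, \<psi>) (\<lambda>y. \<phi> y $ i) x"
  have "(\<Sum>i\<in>UNIV. chart_jacobian (W, \<phi>) (V, \<psi>) x v $ i * ?g $ i) =
      (\<Sum>k\<in>UNIV. v $ k * (\<Sum>i\<in>UNIV. ?g $ i *s ?J i) $ k)" for v
  proof -
    have "(\<Sum>i\<in>UNIV. chart_jacobian (W, \<phi>) (V, \<psi>) x v $ i * ?g $ i) =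
        (\<Sum>i\<in>UNIV. \<Sum>k\<in>UNIV. v $ k * (?g $ i * ?J i $ k))"
      by (simp add: chart_jacobian_def sum_distrib_left sum_distrib_right mult_ac)
    also have "\<dots> = (\<Sum>k\<in>UNIV. \<Sum>i\<in>UNIV. v $ k * (?g $ i * ?J i $ k))"
      by (rule sum.swap)
    finally show ?thesis by (simp add: sum_distrib_left)
  qed
  with has_derivative_in_chart[OF chart chart' holo_at_has_derivative[OF f chart]]
  show "((\<lambda>z. f (inv_into V \<psi> z)) has_derivative
      (\<lambda>v. \<Sum>k\<in>UNIV. v $ k * (\<Sum>i\<in>UNIV. ?g $ i *s ?J i) $ k)) (at (\<psi> x))"
    by simp
qed

lemma holo_at_cgrad:
  assumes U: "openin X U" "\<And>y. y \<in> U \<Longrightarrow> holo_at A f y" and chart: "(W, \<phi>) \<in> A" and x: "x \<in> U" "x \<in> W"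
  shows "holo_at A (\<lambda>y. cgrad (W, \<phi>) f y $ i) x"
proof (rule holo_atI[OF chart x(2) U(1) x(1)])
  have "cholo_on (\<phi> ` (U \<inter> W)) (\<lambda>z. f (inv_into W \<phi> z))"
    using U(2) chart by (auto simp: cholo_on_iff intro!: holo_atD)
  then have "cholo_on (\<phi> ` (U \<inter> W)) (cpartial i (\<lambda>z. f (inv_into W \<phi> z)))"
    by (rule cholo_on_cpartial[OF open_chart_image[OF chart U(1)]])
  then show "cdiff_at (cpartial i (\<lambda>z. f (inv_into W \<phi> z))) (\<phi> x)"
    using x unfolding cholo_on_iff by blast
qed (rule cgrad_nth)

subsection \<open>The differential and the logarithmic derivative\<close>

lemma ext_d_chart: "(W, \<phi>) \<in> A \<Longrightarrow> x \<in> W \<Longrightarrow> ext_d A f x (W, \<phi>) = cgrad (W, \<phi>) f x"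
  by (simp add: ext_d_def)

lemma ext_d_cotangent:
  assumes "holo_at A f x"
  shows "ext_d A f x \<in> cotangent A x"
  unfolding cotangent_def mem_Collect_eq
proof (intro conjI allI ballI impI)
  fix c d assume "c \<in> A" "d \<in> A" "x \<in> fst c \<and> x \<in> fst d"
  moreover obtain W \<phi> V \<psi> where "c = (W, \<phi>)" "d = (V, \<psi>)" by force
  ultimately show "ext_d A f x d = (\<Sum>i\<in>UNIV. (ext_d A f x c $ i) *s cgrad d (\<lambda>p. snd c p $ i) x)"
    using cgrad_chain[OF assms, of W \<phi> V \<psi>] by (simp add: ext_d_def)
qed (auto simp: ext_d_def)

lemma ext_d_cong:
  assumes "openin X N" "x \<in> N" "\<And>y. y \<in> N \<Longrightarrow> f y = g y"
  shows "ext_d A f x = ext_d A g x"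
  unfolding ext_d_def using cgrad_cong[OF _ _ assms] by fastforce

lemma ext_d_add:
  "holo_at A f x \<Longrightarrow> holo_at A g x \<Longrightarrow> ext_d A (\<lambda>y. f y + g y) x = (\<lambda>c. ext_d A f x c + ext_d A g x c)"
  unfolding ext_d_def using cgrad_add by (fastforce simp: fun_eq_iff)

lemma ext_d_compose_field:
  assumes "holo_at A f x" "(g has_field_derivative g') (at (f x))"
  shows "ext_d A (\<lambda>y. g (f y)) x = (\<lambda>c. g' *s ext_d A f x c)"
  unfolding ext_d_def using cgrad_compose_field[OF assms(1) _ _ assms(2)]
  by (fastforce simp: fun_eq_iff)

lemma ext_d_minus: "holo_at A f x \<Longrightarrow> ext_d A (\<lambda>y. - f y) x = (\<lambda>c. - ext_d A f x c)"
  using ext_d_compose_field[of f x uminus "-1"]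
  by (simp add: fun_eq_iff vec_eq_iff DERIV_minus[OF DERIV_ident])

lemma ext_d_const: "ext_d A (\<lambda>y. c) x = (\<lambda>c. 0)"
  using ext_d_compose_field[OF holo_at_const[of 0 x], of "\<lambda>w. c" 0] by (simp add: fun_eq_iff vec_eq_iff)

lemma dlog_mult:
  assumes "holo_at A f x" "holo_at A g x" "f x \<noteq> 0" "g x \<noteq> 0"
  shows "dlog A (\<lambda>y. f y * g y) x = (\<lambda>c. dlog A f x c + dlog A g x c)"
proof
  fix c
  show "dlog A (\<lambda>y. f y * g y) x c = dlog A f x c + dlog A g x c"
  proof (cases "c \<in> A \<and> x \<in> fst c")
    case True
    obtain W \<phi> where c: "c = (W, \<phi>)" by force
    show ?thesis
      using True cgrad_mult[OF assms(1,2), of W \<phi>] assms(3,4)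
      by (simp add: dlog_def ext_d_def c vec_eq_iff field_simps)
  next
    case False
    then have "ext_d A h x c = 0" for h by (auto simp: ext_d_def)
    then show ?thesis by (simp add: dlog_def vec_eq_iff)
  qed
qed

lemma dlog_local_log:
  assumes U: "openin X U" and f: "\<And>y. y \<in> U \<Longrightarrow> holo_at A f y" and x: "x \<in> U" and nz: "f x \<noteq> 0"
  obtains N where "openin X N" "x \<in> N" "N \<subseteq> U"
    "\<And>y. y \<in> N \<Longrightarrow> holo_at A (\<lambda>y. Ln (f y / f x)) y"
    "\<And>y. y \<in> N \<Longrightarrow> dlog A f y = ext_d A (\<lambda>y. Ln (f y / f x)) y"
proof -
  define N where "N = {y \<in> U. f y \<in> {w. Re (w / f x) > 0}}"
  have "open {w. Re (w / f x) > 0}"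
    using nz by (intro open_Collect_less continuous_intros) auto
  then have "openin X N" unfolding N_def by (intro openin_holo_preimage U f)
  have halfplane: "y \<in> U" "Re (f y / f x) > 0" if "y \<in> N" for y
    using that by (auto simp: N_def)
  have deriv: "((\<lambda>w. Ln (w / f x)) has_field_derivative 1 / f y) (at (f y))" if "y \<in> N" for y
  proof -
    have "f y / f x \<notin> \<real>\<^sub>\<le>\<^sub>0" "f y \<noteq> 0"
      using halfplane(2)[OF that] by (auto simp: complex_nonpos_Reals_iff)
    then show ?thesis using nz by (auto intro!: derivative_eq_intros simp: field_simps)
  qed
  show thesis
  proof
    show "openin X N" by fact
    show "x \<in> N" using x nz by (simp add: N_def)
    show "N \<subseteq> U" using halfplane by blast
    show "holo_at A (\<lambda>y. Ln (f y / f x)) y" if "y \<in> N" for y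
      by (rule holo_at_compose_field[OF f[OF halfplane(1)[OF that]] deriv[OF that]])
    show "dlog A f y = ext_d A (\<lambda>y. Ln (f y / f x)) y" if "y \<in> N" for y
      unfolding ext_d_compose_field[OF f[OF halfplane(1)[OF that]] deriv[OF that]]
      by (simp add: dlog_def)
  qed
qed

subsection \<open>Cotangent vectors\<close>

lemma cotangent_transform:
  "\<omega> \<in> cotangent A x \<Longrightarrow> c \<in> A \<Longrightarrow> d \<in> A \<Longrightarrow> x \<in> fst c \<and> x \<in> fst d \<Longrightarrow>
    \<omega> d = (\<Sum>i\<in>UNIV. (\<omega> c $ i) *s cgrad d (\<lambda>p. snd c p $ i) x)"
  unfolding cotangent_def by blast

lemma cotangent_outside: "\<omega> \<in> cotangent A x \<Longrightarrow> \<not> (c \<in> A \<and> x \<in> fst c) \<Longrightarrow> \<omega> c = 0"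
  unfolding cotangent_def by blast

lemma cotangent_expansion:
  assumes \<omega>: "\<omega> \<in> cotangent A x" and chart: "(W, \<phi>) \<in> A" "x \<in> W"
  shows "\<omega> = (\<lambda>d. \<Sum>i\<in>UNIV. (\<omega> (W, \<phi>) $ i) *s ext_d A (\<lambda>y. \<phi> y $ i) x d)"
proof
  fix d
  show "\<omega> d = (\<Sum>i\<in>UNIV. (\<omega> (W, \<phi>) $ i) *s ext_d A (\<lambda>y. \<phi> y $ i) x d)"
  proof (cases "d \<in> A \<and> x \<in> fst d")
    case True
    then show ?thesis
      using cotangent_transform[OF \<omega> chart(1), of d] chart by (simp add: ext_d_def)
  next
    case False
    then have "ext_d A h x d = 0" for h by (auto simp: ext_d_def)
    then show ?thesis using cotangent_outside[OF \<omega> False] by (simp add: vec_eq_iff)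
  qed
qed

lemma cotangent_zero: "(\<lambda>c. 0) \<in> cotangent A x"
  by (simp add: cotangent_def vec_eq_iff)

lemma cotangent_add:
  assumes \<omega>: "\<omega> \<in> cotangent A x" and \<eta>: "\<eta> \<in> cotangent A x"
  shows "(\<lambda>c. \<omega> c + \<eta> c) \<in> cotangent A x"
  unfolding cotangent_def mem_Collect_eq
proof (intro conjI allI ballI impI)
  fix c d assume cd: "c \<in> A" "d \<in> A" "x \<in> fst c \<and> x \<in> fst d"
  show "\<omega> d + \<eta> d = (\<Sum>i\<in>UNIV. ((\<omega> c + \<eta> c) $ i) *s cgrad d (\<lambda>p. snd c p $ i) x)"
    unfolding cotangent_transform[OF \<omega> cd] cotangent_transform[OF \<eta> cd]
    by (simp add: vec_eq_iff sum.distrib distrib_right)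
qed (use \<omega> \<eta> in \<open>simp add: cotangent_outside\<close>)

lemma cotangent_scale:
  assumes \<omega>: "\<omega> \<in> cotangent A x"
  shows "(\<lambda>c. a *s \<omega> c) \<in> cotangent A x"
  unfolding cotangent_def mem_Collect_eq
proof (intro conjI allI ballI impI)
  fix c d assume cd: "c \<in> A" "d \<in> A" "x \<in> fst c \<and> x \<in> fst d"
  show "a *s \<omega> d = (\<Sum>i\<in>UNIV. ((a *s \<omega> c) $ i) *s cgrad d (\<lambda>p. snd c p $ i) x)"
    unfolding cotangent_transform[OF \<omega> cd]
    by (simp add: vec_eq_iff sum_distrib_left mult.assoc)
qed (use \<omega> in \<open>simp add: cotangent_outside vec_eq_iff\<close>)

lemma cotangent_minus: "\<omega> \<in> cotangent A x \<Longrightarrow> (\<lambda>c. - \<omega> c) \<in> cotangent A x"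
  using cotangent_scale[of \<omega> x "-1"] by (simp add: vec_eq_iff fun_eq_iff)

lemma comm_group_cotangent: "comm_group (cotangent_group A x)"
proof (rule comm_groupI)
  fix \<omega> assume "\<omega> \<in> carrier (cotangent_group A x)"
  then show "\<exists>\<eta>\<in>carrier (cotangent_group A x). \<eta> \<otimes>\<^bsub>cotangent_group A x\<^esub> \<omega> = \<one>\<^bsub>cotangent_group A x\<^esub>"
    using cotangent_minus[of \<omega> x]
    by (intro bexI[of _ "\<lambda>c. - \<omega> c"]) (auto simp: cotangent_group_def)
qed (auto simp: cotangent_group_def cotangent_zero cotangent_add add_ac)

lemma cotangent_inv:
  assumes "\<omega> \<in> cotangent A x"
  shows "inv\<^bsub>cotangent_group A x\<^esub> \<omega> = (\<lambda>c. - \<omega> c)"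
proof -
  interpret comm_group "cotangent_group A x" by (rule comm_group_cotangent)
  show ?thesis
    using assms cotangent_minus[OF assms]
    by (intro inv_equality) (auto simp: cotangent_group_def)
qed

end

subsection \<open>The structure sheaf, its units, and the sheaves of forms\<close>

lemma comm_group_mult_complex: "comm_group mult_complex"
  by (rule comm_groupI) (auto simp: mult_complex_def intro!: bexI[of _ "inverse _"])

lemma inv_mult_complex: "a \<noteq> 0 \<Longrightarrow> inv\<^bsub>mult_complex\<^esub> a = inverse a"
  using comm_group_mult_complex
  by (intro group.inv_equality) (auto simp: mult_complex_def comm_group_def)

lemma comm_group_add_complex: "comm_group add_complex"
  by (rule comm_groupI) (auto simp: add_complex_def intro!: exI[of _ "- _"])

lemma inv_add_complex: "inv\<^bsub>add_complex\<^esub> a = - a"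
  using comm_group_add_complex
  by (intro group.inv_equality) (auto simp: add_complex_def comm_group_def)

lemma vals_sheaves [simp]:
  "vals (Omega1 X A) = cotangent_group A" "vals (dO_sheaf X A) = cotangent_group A"
  "vals (O_sheaf X A) = (\<lambda>x. add_complex)" "vals (units_sheaf F) = (\<lambda>x. mult_complex)"
  "vals (O_sub X A Y) = (\<lambda>x. add_complex)"
  by (simp_all add: Omega1_def dO_sheaf_def O_sheaf_def units_sheaf_def O_sub_def)

context holomorphic_atlas
begin

lemma O_section_iff: "f \<in> sections (O_sheaf X A) U \<longleftrightarrow> openin X U \<and> (\<forall>x\<in>U. holo_at A f x)"
  by (simp add: O_sheaf_def holo_fun_iff)

lemma units_section_iff:
  "f \<in> sections (units_sheaf (O_sheaf X A)) U \<longleftrightarrow> openin X U \<and> (\<forall>x\<in>U. holo_at A f x \<and> f x \<noteq> 0)"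
  by (auto simp: units_sheaf_def O_section_iff)

lemma Omega1_section_iff:
  "\<omega> \<in> sections (Omega1 X A) U \<longleftrightarrow> openin X U \<and> (\<forall>x\<in>U. \<omega> x \<in> cotangent A x) \<and>
     (\<forall>W \<phi> i x. (W, \<phi>) \<in> A \<longrightarrow> x \<in> U \<longrightarrow> x \<in> W \<longrightarrow> holo_at A (\<lambda>y. \<omega> y (W, \<phi>) $ i) x)"
  by (auto simp: Omega1_def holo_fun_iff)

lemma ab_sheaf_O: "ab_sheaf X (O_sheaf X A)"
proof (rule ab_sheaf.intro, unfold O_section_iff vals_sheaves)
  show "comm_group add_complex" by (rule comm_group_add_complex)
qed (auto simp: inv_add_complex intro!: holo_at_minus, auto simp: add_complex_def intro!: holo_at_add holo_at_const)

lemma ab_sheaf_units: "ab_sheaf X (units_sheaf (O_sheaf X A))"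
proof (rule ab_sheaf.intro, unfold units_section_iff vals_sheaves)
  show "comm_group mult_complex" by (rule comm_group_mult_complex)
  fix f U assume f: "openin X U \<and> (\<forall>x\<in>U. holo_at A f x \<and> f x \<noteq> 0)"
  have "holo_at A (\<lambda>p. inv\<^bsub>mult_complex\<^esub> (f p)) x" if "x \<in> U" for x
    by (rule holo_at_cong[OF holo_at_inverse[of f x], of U]) (use f that in \<open>auto simp: inv_mult_complex\<close>)
  then show "openin X U \<and> (\<forall>x\<in>U. holo_at A (\<lambda>p. inv\<^bsub>mult_complex\<^esub> (f p)) x \<and> inv\<^bsub>mult_complex\<^esub> (f x) \<noteq> 0)"
    using f by (auto simp: inv_mult_complex)
qed (auto simp: mult_complex_def intro!: holo_at_mult holo_at_const)

lemma ab_sheaf_Omega1: "ab_sheaf X (Omega1 X A)"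
proof (rule ab_sheaf.intro, unfold vals_sheaves)
  show "comm_group (cotangent_group A p)" for p by (rule comm_group_cotangent)
  show "openin X U \<Longrightarrow> (\<lambda>p. \<one>\<^bsub>cotangent_group A p\<^esub>) \<in> sections (Omega1 X A) U" for U
    by (auto simp: Omega1_section_iff cotangent_group_def cotangent_zero holo_at_const)
  fix \<omega> U assume \<omega>: "\<omega> \<in> sections (Omega1 X A) U"
  then show "openin X U" "\<And>p. p \<in> U \<Longrightarrow> \<omega> p \<in> carrier (cotangent_group A p)"
    "\<And>V. openin X V \<Longrightarrow> V \<subseteq> U \<Longrightarrow> \<omega> \<in> sections (Omega1 X A) V"
    by (auto simp: Omega1_section_iff cotangent_group_def)
  have "holo_at A (\<lambda>p. (inv\<^bsub>cotangent_group A p\<^esub> (\<omega> p)) (W, \<phi>) $ i) x"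
    if "(W, \<phi>) \<in> A" "x \<in> U" "x \<in> W" for W \<phi> i x
    by (rule holo_at_cong[OF holo_at_minus[of "\<lambda>p. \<omega> p (W, \<phi>) $ i" x], of U])
      (use \<omega> that in \<open>auto simp: Omega1_section_iff cotangent_inv\<close>)
  then show "(\<lambda>p. inv\<^bsub>cotangent_group A p\<^esub> (\<omega> p)) \<in> sections (Omega1 X A) U"
    using \<omega> by (auto simp: Omega1_section_iff cotangent_inv intro: cotangent_minus)
  fix \<eta> assume \<eta>: "\<eta> \<in> sections (Omega1 X A) U"
  show "(\<lambda>p. \<omega> p \<otimes>\<^bsub>cotangent_group A p\<^esub> \<eta> p) \<in> sections (Omega1 X A) U"
    using \<omega> \<eta> by (auto simp: Omega1_section_iff cotangent_group_def intro!: cotangent_add holo_at_add)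
qed

lemma Omega1_scale:
  assumes "\<omega> \<in> sections (Omega1 X A) U" "\<And>x. x \<in> U \<Longrightarrow> holo_at A f x"
  shows "(\<lambda>x c. f x *s \<omega> x c) \<in> sections (Omega1 X A) U"
  using assms by (auto simp: Omega1_section_iff intro: cotangent_scale holo_at_mult)

lemma ext_d_section:
  assumes U: "openin X U" "\<And>y. y \<in> U \<Longrightarrow> holo_at A f y"
  shows "ext_d A f \<in> sections (Omega1 X A) U"
proof -
  have "holo_at A (\<lambda>y. ext_d A f y (W, \<phi>) $ i) x" if "(W, \<phi>) \<in> A" "x \<in> U" "x \<in> W" for W \<phi> i x
  proof (rule holo_at_cong[OF holo_at_cgrad[OF U that]])
    show "openin X W" by (rule chart_open[OF that(1)])
    show "ext_d A f y (W, \<phi>) $ i = cgrad (W, \<phi>) f y $ i" if "y \<in> W" for y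
      by (simp add: ext_d_chart[OF \<open>(W, \<phi>) \<in> A\<close> that])
  qed (use that(3) in auto)
  then show ?thesis
    using U ext_d_cotangent by (auto simp: Omega1_section_iff)
qed

definition exact_forms :: "'a set \<Rightarrow> ('a \<Rightarrow> ('a, 'n) covector) set" where
  "exact_forms N = {ext_d A f |f. \<forall>y\<in>N. holo_at A f y}"

lemma sections_dO_sheaf: "sections (dO_sheaf X A) = local_sections X exact_forms"
proof -
  have "(\<exists>N f. x \<in> N \<and> N \<subseteq> U \<and> f \<in> sections (O_sheaf X A) N \<and> (\<forall>y\<in>N. \<omega> y = ext_d A f y)) \<longleftrightarrow>
      (\<exists>N \<eta>. openin X N \<and> x \<in> N \<and> N \<subseteq> U \<and> \<eta> \<in> exact_forms N \<and> (\<forall>z\<in>N. \<omega> z = \<eta> z))" for x U \<omega>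
    unfolding O_section_iff exact_forms_def by blast
  then show ?thesis
    unfolding dO_sheaf_def local_sections_def by simp
qed

lemma dO_sectionE:
  assumes "\<omega> \<in> sections (dO_sheaf X A) U" "x \<in> U"
  obtains N f where "openin X N" "x \<in> N" "N \<subseteq> U" "\<And>y. y \<in> N \<Longrightarrow> holo_at A f y"
    "\<And>y. y \<in> N \<Longrightarrow> \<omega> y = ext_d A f y"
proof -
  obtain N \<eta> where N: "openin X N" "x \<in> N" "N \<subseteq> U" "\<eta> \<in> exact_forms N" "\<And>y. y \<in> N \<Longrightarrow> \<omega> y = \<eta> y"
    using assms unfolding sections_dO_sheaf by (rule local_sectionsE) blast
  from N(4) obtain f where "\<eta> = ext_d A f" "\<forall>y\<in>N. holo_at A f y"
    unfolding exact_forms_def by blast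
  with N show thesis by (intro that[of N f]) auto
qed

lemma ab_sheaf_dO: "ab_sheaf X (dO_sheaf X A)"
proof (rule ab_presheaf.ab_sheaf_local_sections[OF _ vals_sheaves(2) sections_dO_sheaf],
    rule ab_presheaf.intro)
  show "comm_group (cotangent_group A p)" for p by (rule comm_group_cotangent)
  have add: "ext_d A (\<lambda>y. f y + g y) p = ext_d A f p \<otimes>\<^bsub>cotangent_group A p\<^esub> ext_d A g p"
    if "holo_at A f p" "holo_at A g p" for f g p
    using ext_d_add[OF that] by (simp add: cotangent_group_def)
  show "\<exists>\<kappa>\<in>exact_forms N. \<forall>p\<in>N. \<kappa> p = \<one>\<^bsub>cotangent_group A p\<^esub>" for N
    by (rule bexI[of _ "ext_d A (\<lambda>y. 0)"])
      (auto simp: exact_forms_def cotangent_group_def ext_d_const holo_at_const)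
  fix N \<omega> assume "\<omega> \<in> exact_forms N"
  then obtain f where f: "\<omega> = ext_d A f" "\<forall>y\<in>N. holo_at A f y" by (auto simp: exact_forms_def)
  show "\<omega> p \<in> carrier (cotangent_group A p)" if "p \<in> N" for p
    using f ext_d_cotangent that by (simp add: cotangent_group_def)
  show "\<omega> \<in> exact_forms M" if "M \<subseteq> N" for M
    using f that by (auto simp: exact_forms_def)
  have "ext_d A (\<lambda>y. - f y) \<in> exact_forms N"
    using f(2) holo_at_minus by (auto simp: exact_forms_def)
  then show "\<exists>\<kappa>\<in>exact_forms N. \<forall>p\<in>N. \<kappa> p = inv\<^bsub>cotangent_group A p\<^esub> (\<omega> p)"
    by (rule bexI[rotated]) (use f in \<open>simp add: ext_d_minus cotangent_inv[OF ext_d_cotangent]\<close>)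
  fix \<eta> assume "\<eta> \<in> exact_forms N"
  then obtain g where g: "\<eta> = ext_d A g" "\<forall>y\<in>N. holo_at A g y" by (auto simp: exact_forms_def)
  have "ext_d A (\<lambda>y. f y + g y) \<in> exact_forms N"
    using f(2) g(2) holo_at_add by (auto simp: exact_forms_def)
  then show "\<exists>\<kappa>\<in>exact_forms N. \<forall>p\<in>N. \<kappa> p = \<omega> p \<otimes>\<^bsub>cotangent_group A p\<^esub> \<eta> p"
    by (rule bexI[rotated]) (use f g add in simp)
qed

lemma dO_subset_Omega1: "sections (dO_sheaf X A) U \<subseteq> sections (Omega1 X A) U"
proof
  fix \<omega> assume \<omega>: "\<omega> \<in> sections (dO_sheaf X A) U"
  have "\<omega> x \<in> cotangent A x \<and>
      (\<forall>W \<phi> i. (W, \<phi>) \<in> A \<longrightarrow> x \<in> W \<longrightarrow> holo_at A (\<lambda>y. \<omega> y (W, \<phi>) $ i) x)" if "x \<in> U" for x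
  proof -
    obtain N f where N: "openin X N" "x \<in> N" "\<And>y. y \<in> N \<Longrightarrow> holo_at A f y"
        and eq: "\<And>y. y \<in> N \<Longrightarrow> \<omega> y = ext_d A f y"
      using \<omega> \<open>x \<in> U\<close> by (rule dO_sectionE) blast
    have "ext_d A f \<in> sections (Omega1 X A) N" by (rule ext_d_section[OF N(1,3)])
    then have ext_d: "ext_d A f x \<in> cotangent A x"
        "\<And>W \<phi> i. (W, \<phi>) \<in> A \<Longrightarrow> x \<in> W \<Longrightarrow> holo_at A (\<lambda>y. ext_d A f y (W, \<phi>) $ i) x"
      using N(2) by (auto simp: Omega1_section_iff)
    have "holo_at A (\<lambda>y. \<omega> y (W, \<phi>) $ i) x" if "(W, \<phi>) \<in> A" "x \<in> W" for W \<phi> i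
      by (rule holo_at_cong[OF ext_d(2)[OF that] N(1,2)]) (simp add: eq)
    then show ?thesis
      using ext_d(1) eq[OF N(2)] by simp
  qed
  then show "\<omega> \<in> sections (Omega1 X A) U"
    using ab_sheaf.open_section[OF ab_sheaf_dO \<omega>] by (auto simp: Omega1_section_iff)
qed

lemma dlog_section:
  assumes "f \<in> sections (units_sheaf (O_sheaf X A)) U"
  shows "dlog A f \<in> sections (dO_sheaf X A) U"
  unfolding sections_dO_sheaf
proof (rule local_sectionsI)
  have U: "openin X U" and f: "\<And>x. x \<in> U \<Longrightarrow> holo_at A f x" "\<And>x. x \<in> U \<Longrightarrow> f x \<noteq> 0"
    using assms by (auto simp: units_section_iff)
  show "openin X U" by (rule U)
  fix x assume x: "x \<in> U"
  obtain N where N: "openin X N" "x \<in> N" "N \<subseteq> U"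
    "\<And>y. y \<in> N \<Longrightarrow> holo_at A (\<lambda>y. Ln (f y / f x)) y"
    "\<And>y. y \<in> N \<Longrightarrow> dlog A f y = ext_d A (\<lambda>y. Ln (f y / f x)) y"
    using dlog_local_log[OF U f(1) x f(2)[OF x]] by blast
  then have "ext_d A (\<lambda>y. Ln (f y / f x)) \<in> exact_forms N"
    by (auto simp: exact_forms_def)
  with N show "\<exists>N \<eta>. openin X N \<and> x \<in> N \<and> N \<subseteq> U \<and> \<eta> \<in> exact_forms N \<and> (\<forall>z\<in>N. dlog A f z = \<eta> z)"
    by blast
qed

lemma sheaf_operator_dlog: "sheaf_operator X (units_sheaf (O_sheaf X A)) (dO_sheaf X A) (dlog A)"
proof (intro sheaf_operator.intro sheaf_operator_axioms.intro ab_sheaf_units ab_sheaf_dO dlog_section)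
  show "\<forall>x\<in>N. dlog A f' x = dlog A f x" if "openin X N" "\<forall>x\<in>N. f' x = f x" for N f f'
    using ext_d_cong[of N _ f' f] that by (simp add: dlog_def)
  show "dlog A (\<lambda>p. s p \<otimes>\<^bsub>vals (units_sheaf (O_sheaf X A)) p\<^esub> t p) x =
      dlog A s x \<otimes>\<^bsub>vals (dO_sheaf X A) x\<^esub> dlog A t x"
    if "s \<in> sections (units_sheaf (O_sheaf X A)) U" "t \<in> sections (units_sheaf (O_sheaf X A)) U" "x \<in> U"
    for s t U x
    using dlog_mult[of s x t] that by (simp add: units_section_iff mult_complex_def cotangent_group_def)
qed

end

section \<open>Tensor products and the pullback of a module\<close>

subsection \<open>Finite products in commutative groups\<close>

lemma hom_finprod:
  assumes G: "comm_group G" and H: "comm_group H" and h: "h \<in> hom G H"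
    and f: "\<And>i. i \<in> I \<Longrightarrow> f i \<in> carrier G"
  shows "h (finprod G f I) = finprod H (\<lambda>i. h (f i)) I"
proof -
  interpret G: comm_group G by (rule G)
  interpret H: comm_group H by (rule H)
  interpret group_hom G H h by unfold_locales (rule h)
  show ?thesis
    using f by (induction I rule: infinite_finite_induct) (simp_all add: Pi_def)
qed

lemma (in comm_group) finprod_inv:
  assumes "\<And>i. i \<in> I \<Longrightarrow> f i \<in> carrier G"
  shows "finprod G (\<lambda>i. inv (f i)) I = inv (finprod G f I)"
proof -
  have "(\<lambda>x. inv x) \<in> hom G G" by (intro homI) (simp_all add: inv_mult)
  from hom_finprod[OF comm_group_axioms comm_group_axioms this, of I f] assms show ?thesis by simp
qed

lemma (in comm_monoid) finprod_lessThan_add: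
  fixes k l :: nat
  assumes f: "\<And>j. j < k \<Longrightarrow> f j \<in> carrier G" and g: "\<And>j. j < l \<Longrightarrow> g j \<in> carrier G"
  shows "finprod G (\<lambda>j. if j < k then f j else g (j - k)) {..<k + l} = finprod G f {..<k} \<otimes> finprod G g {..<l}"
proof -
  let ?h = "\<lambda>j. if j < k then f j else g (j - k)"
  have "{..<k + l} = {..<k} \<union> (+) k ` {..<l}"
    by (auto simp: image_iff Bex_def intro: le_Suc_ex) (metis add_diff_inverse_nat nat_add_left_cancel_less)
  then have "finprod G ?h {..<k + l} = finprod G ?h {..<k} \<otimes> finprod G ?h ((+) k ` {..<l})"
    using f g by (simp only:) (intro finprod_Un_disjoint, auto)
  moreover have "finprod G ?h {..<k} = finprod G f {..<k}"
    using f by (intro finprod_cong) (auto simp: simp_implies_def)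
  moreover have "finprod G ?h ((+) k ` {..<l}) = finprod G g {..<l}"
    using g by (subst finprod_reindex) (auto simp: Pi_def inj_on_def)
  ultimately show ?thesis by simp
qed

lemma (in comm_monoid) finprod_swap:
  assumes "finite I" "finite J" "\<And>i j. i \<in> I \<Longrightarrow> j \<in> J \<Longrightarrow> f i j \<in> carrier G"
  shows "finprod G (\<lambda>i. finprod G (f i) J) I = finprod G (\<lambda>j. finprod G (\<lambda>i. f i j) I) J"
  using assms(1,3)
proof (induction I rule: finite_induct)
  case (insert i I)
  have "finprod G (\<lambda>j. finprod G (\<lambda>i. f i j) (insert i I)) J =
      finprod G (\<lambda>j. f i j \<otimes> finprod G (\<lambda>i. f i j) I) J"
    using insert.prems insert.hyps
    by (intro finprod_cong) (auto simp: simp_implies_def Pi_def intro!: m_closed finprod_closed)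
  also have "\<dots> = finprod G (f i) J \<otimes> finprod G (\<lambda>j. finprod G (\<lambda>i. f i j) I) J"
    using insert.prems by (intro finprod_multf) (auto intro!: finprod_closed)
  finally show ?case
    using insert by (simp add: Pi_def)
qed simp

lemma finprod_add_complex: "finprod add_complex f J = sum f J"
proof -
  interpret comm_group add_complex by (rule comm_group_add_complex)
  show ?thesis
    by (induction J rule: infinite_finite_induct) (simp_all add: add_complex_def[THEN arg_cong, of carrier] Pi_def,
      simp_all add: add_complex_def)
qed

lemma (in ab_sheaf) germ_finprod:
  assumes U: "openin T U" "y \<in> U" and s: "\<And>j. j \<in> J \<Longrightarrow> s j \<in> sections F U"
  shows "germ T y (\<lambda>x. finprod (vals F x) (\<lambda>j. s j x) J) = finprod (stalk T F y) (\<lambda>j. germ T y (s j)) J"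
proof -
  have y: "y \<in> topspace T" and group: "\<And>x. x \<in> U \<Longrightarrow> comm_group (vals F x)"
    using openin_subset[OF U(1)] U(2) comm_group_vals by auto
  interpret S: comm_group "stalk T F y" by (rule comm_group_stalk[OF y])
  show ?thesis
    using s
  proof (induction J rule: infinite_finite_induct)
    case empty
    have "finprod (vals F x) (\<lambda>j. s j x) {} = \<one>\<^bsub>vals F x\<^esub>" if "x \<in> U" for x
      using comm_monoid.finprod_empty[OF comm_group.axioms(1)[OF group[OF that]]] .
    from germ_cong[OF U this] show ?case by (simp add: stalk_one)
  next
    case (insert j J)
    have "germ T y (\<lambda>x. finprod (vals F x) (\<lambda>j. s j x) (insert j J)) =
        germ T y (\<lambda>x. s j x \<otimes>\<^bsub>vals F x\<^esub> finprod (vals F x) (\<lambda>j. s j x) J)"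
    proof (rule germ_cong[OF U])
      fix x assume x: "x \<in> U"
      interpret comm_group "vals F x" by (rule group[OF x])
      show "finprod (vals F x) (\<lambda>j. s j x) (insert j J) = s j x \<otimes>\<^bsub>vals F x\<^esub> finprod (vals F x) (\<lambda>j. s j x) J"
        using insert.hyps section_closed[OF insert.prems x] by (intro finprod_insert) auto
    qed
    also have "\<dots> = finprod (stalk T F y) (\<lambda>j. germ T y (s j)) (insert j J)"
      using insert germ_in_stalk[OF insert.prems U(2)] by (simp add: stalk_mult[OF y, symmetric] Pi_def)
    finally show ?case .
  qed (simp add: finprod_def stalk_one)
qed

subsection \<open>Tensor products\<close>

locale module_pair =
  fixes R :: "'r ring" and M :: "('r, 'm) module" and N :: "('r, 'k) module"
  assumes add_M: "m \<in> carrier M \<Longrightarrow> m' \<in> carrier M \<Longrightarrow> m \<oplus>\<^bsub>M\<^esub> m' \<in> carrier M"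
    and add_N: "n \<in> carrier N \<Longrightarrow> n' \<in> carrier N \<Longrightarrow> n \<oplus>\<^bsub>N\<^esub> n' \<in> carrier N"
    and smult_M: "a \<in> carrier R \<Longrightarrow> m \<in> carrier M \<Longrightarrow> a \<odot>\<^bsub>M\<^esub> m \<in> carrier M"
    and smult_N: "a \<in> carrier R \<Longrightarrow> n \<in> carrier N \<Longrightarrow> a \<odot>\<^bsub>N\<^esub> n \<in> carrier N"
begin

abbreviation "free_group \<equiv> free_Abelian_group (carrier M \<times> carrier N)"
abbreviation "kernel_coset x \<equiv> tensor_kernel R M N #>\<^bsub>free_group\<^esub> x"

lemma frag_of_closed: "m \<in> carrier M \<Longrightarrow> n \<in> carrier N \<Longrightarrow> frag_of (m, n) \<in> carrier free_group"
  by (simp only: frag_of_in_free_Abelian_group mem_Times_iff fst_conv snd_conv)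

lemma tensor_relations_subset: "tensor_relations R M N \<subseteq> carrier free_group"
proof -
  have diff: "x - y \<in> carrier free_group" if "x \<in> carrier free_group" "y \<in> carrier free_group" for x y
    using that keys_diff[of x y] by auto
  show ?thesis
    unfolding tensor_relations_def
    by (intro Un_least subsetI)
      (elim CollectE exE conjE, simp only:, intro diff frag_of_closed add_M add_N smult_M smult_N, assumption+)+
qed

lemma subgroup_tensor_kernel: "subgroup (tensor_kernel R M N) free_group"
  unfolding tensor_kernel_def
  by (rule group.generate_is_subgroup[OF group_free_Abelian_group tensor_relations_subset])

lemma comm_group_tensor_group: "comm_group (tensor_group R M N)"
  unfolding tensor_group_def
  by (rule comm_group.abelian_FactGroup[OF abelian_free_Abelian_group subgroup_tensor_kernel])

lemma kernel_coset_subset: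
  assumes "x - y \<in> tensor_kernel R M N"
  shows "kernel_coset x \<subseteq> kernel_coset y"
proof
  fix w assume "w \<in> kernel_coset x"
  then obtain a where a: "a \<in> tensor_kernel R M N" "w = a + x" by (auto simp: r_coset_def)
  then have "a + (x - y) \<in> tensor_kernel R M N"
    using subgroup.m_closed[OF subgroup_tensor_kernel a(1) assms] by simp
  then show "w \<in> kernel_coset y"
    using a(2) by (auto simp: r_coset_def intro!: bexI[of _ "a + (x - y)"])
qed

lemma kernel_coset_eq:
  assumes "x - y \<in> tensor_relations R M N"
  shows "kernel_coset x = kernel_coset y"
proof
  have xy: "x - y \<in> tensor_kernel R M N"
    unfolding tensor_kernel_def using assms by (rule generate.incl)
  then show "kernel_coset x \<subseteq> kernel_coset y" by (rule kernel_coset_subset)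
  have "y - x \<in> tensor_kernel R M N"
    using subgroup.m_inv_closed[OF subgroup_tensor_kernel xy] subgroup.mem_carrier[OF subgroup_tensor_kernel xy]
    by simp
  then show "kernel_coset y \<subseteq> kernel_coset x" by (rule kernel_coset_subset)
qed

lemma kernel_coset_mult:
  assumes "x \<in> carrier free_group" "y \<in> carrier free_group"
  shows "kernel_coset x \<otimes>\<^bsub>tensor_group R M N\<^esub> kernel_coset y = kernel_coset (x + y)"
proof -
  have "tensor_kernel R M N \<lhd> free_group"
    by (rule comm_group.subgroup_imp_normal[OF abelian_free_Abelian_group subgroup_tensor_kernel])
  from normal.rcos_sum[OF this assms] show ?thesis
    by (simp add: tensor_group_def FactGroup_def)
qed

lemma tensor_elem_closed:
  "m \<in> carrier M \<Longrightarrow> n \<in> carrier N \<Longrightarrow> tensor_elem R M N m n \<in> carrier (tensor_group R M N)"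
  unfolding tensor_group_def tensor_elem_def FactGroup_def RCOSETS_def by auto

lemma tensor_elem_add_left:
  assumes "m \<in> carrier M" "m' \<in> carrier M" "n \<in> carrier N"
  shows "tensor_elem R M N (m \<oplus>\<^bsub>M\<^esub> m') n = tensor_elem R M N m n \<otimes>\<^bsub>tensor_group R M N\<^esub> tensor_elem R M N m' n"
  unfolding tensor_elem_def kernel_coset_mult[OF frag_of_closed[OF assms(1,3)] frag_of_closed[OF assms(2,3)]]
  by (rule kernel_coset_eq) (unfold tensor_relations_def diff_diff_eq[symmetric], use assms in blast)

lemma tensor_elem_add_right:
  assumes "m \<in> carrier M" "n \<in> carrier N" "n' \<in> carrier N"
  shows "tensor_elem R M N m (n \<oplus>\<^bsub>N\<^esub> n') = tensor_elem R M N m n \<otimes>\<^bsub>tensor_group R M N\<^esub> tensor_elem R M N m n'"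
  unfolding tensor_elem_def kernel_coset_mult[OF frag_of_closed[OF assms(1,2)] frag_of_closed[OF assms(1,3)]]
  by (rule kernel_coset_eq) (unfold tensor_relations_def diff_diff_eq[symmetric], use assms in blast)

lemma tensor_elem_smult:
  assumes "a \<in> carrier R" "m \<in> carrier M" "n \<in> carrier N"
  shows "tensor_elem R M N (a \<odot>\<^bsub>M\<^esub> m) n = tensor_elem R M N m (a \<odot>\<^bsub>N\<^esub> n)"
  unfolding tensor_elem_def
  by (rule kernel_coset_eq) (unfold tensor_relations_def, use assms in blast)

end

subsection \<open>Restrictions of holomorphic functions\<close>

locale holomorphic_atlas_subset = holomorphic_atlas X A
  for X :: "'a topology" and A :: "('a, 'n::finite) chart set" +
  fixes Y :: "'a set"
  assumes Y_subset: "Y \<subseteq> topspace X"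
begin

abbreviation "X\<^sub>Y \<equiv> subtopology X Y"
abbreviation "O\<^sub>Y \<equiv> O_sub X A Y"

lemma topspace_subset: "topspace X\<^sub>Y = Y"
  using Y_subset by auto

lemma openin_Int_Y: "openin X U \<Longrightarrow> openin X\<^sub>Y (U \<inter> Y)"
  by (auto simp: openin_subtopology)

lemma openin_subset_Y: "openin X\<^sub>Y V \<Longrightarrow> V \<subseteq> Y"
  using openin_subset[of X\<^sub>Y V] topspace_subset by simp

definition holo_restrictions :: "'a set \<Rightarrow> ('a \<Rightarrow> complex) set" where
  "holo_restrictions N = {f. \<exists>U. openin X U \<and> N \<subseteq> U \<and> (\<forall>x\<in>U. holo_at A f x)}"

lemma O_sub_sectionE:
  assumes "f \<in> sections O\<^sub>Y V" "y \<in> V"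
  obtains U g where "openin X U" "y \<in> U" "\<And>x. x \<in> U \<Longrightarrow> holo_at A g x" "\<And>x. x \<in> U \<inter> V \<Longrightarrow> f x = g x"
proof -
  have "\<exists>U g. y \<in> U \<and> g \<in> sections (O_sheaf X A) U \<and> (\<forall>x\<in>U \<inter> V. f x = g x)"
    using assms by (simp add: O_sub_def)
  then show thesis using that unfolding O_section_iff by blast
qed

lemma O_sub_sectionI:
  assumes "openin X\<^sub>Y V"
    and "\<And>y. y \<in> V \<Longrightarrow> \<exists>U g. openin X U \<and> y \<in> U \<and> (\<forall>x\<in>U. holo_at A g x) \<and> (\<forall>x\<in>U \<inter> V. f x = g x)"
  shows "f \<in> sections O\<^sub>Y V"
proof -
  have "\<exists>U g. y \<in> U \<and> g \<in> sections (O_sheaf X A) U \<and> (\<forall>x\<in>U \<inter> V. f x = g x)" if "y \<in> V" for y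
    using assms(2)[OF that] unfolding O_section_iff by blast
  with assms(1) show ?thesis by (simp add: O_sub_def)
qed

lemma sections_O_sub: "sections O\<^sub>Y = local_sections X\<^sub>Y holo_restrictions"
proof (rule ext, rule Set.set_eqI, rule iffI)
  fix V f assume f: "f \<in> sections O\<^sub>Y V"
  then have V: "openin X\<^sub>Y V" by (simp add: O_sub_def)
  show "f \<in> local_sections X\<^sub>Y holo_restrictions V"
  proof (rule local_sectionsI[OF V])
    fix y assume y: "y \<in> V"
    with f obtain U g where U: "openin X U" "y \<in> U" "\<And>x. x \<in> U \<Longrightarrow> holo_at A g x"
        and eq: "\<And>x. x \<in> U \<inter> V \<Longrightarrow> f x = g x"
      by (rule O_sub_sectionE) blast
    have "U \<inter> V = (U \<inter> Y) \<inter> V" using openin_subset_Y[OF V] by blast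
    then have "openin X\<^sub>Y (U \<inter> V)" using V openin_Int_Y[OF U(1)] by (simp add: openin_Int)
    then show "\<exists>N k. openin X\<^sub>Y N \<and> y \<in> N \<and> N \<subseteq> V \<and> k \<in> holo_restrictions N \<and> (\<forall>z\<in>N. f z = k z)"
      using U eq y by (intro exI[of _ "U \<inter> V"] exI[of _ g]) (auto simp: holo_restrictions_def)
  qed
next
  fix V f assume f: "f \<in> local_sections X\<^sub>Y holo_restrictions V"
  note V = local_sections_open[OF f]
  show "f \<in> sections O\<^sub>Y V"
  proof (rule O_sub_sectionI[OF V])
    fix y assume "y \<in> V"
    with f obtain N g where N: "openin X\<^sub>Y N" "y \<in> N" "g \<in> holo_restrictions N" "\<And>z. z \<in> N \<Longrightarrow> f z = g z"
      by (rule local_sectionsE) blast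
    obtain U where U: "openin X U" "N \<subseteq> U" "\<forall>x\<in>U. holo_at A g x"
      using N(3) by (auto simp: holo_restrictions_def)
    obtain W where W: "openin X W" "N = W \<inter> Y" using N(1) by (auto simp: openin_subtopology)
    have "openin X (U \<inter> W)" using U(1) W(1) by blast
    then show "\<exists>U g. openin X U \<and> y \<in> U \<and> (\<forall>x\<in>U. holo_at A g x) \<and> (\<forall>x\<in>U \<inter> V. f x = g x)"
      using U N W openin_subset_Y[OF V] by (intro exI[of _ "U \<inter> W"] exI[of _ g]) auto
  qed
qed

lemma ab_sheaf_O_sub: "ab_sheaf X\<^sub>Y O\<^sub>Y"
proof (rule ab_presheaf.ab_sheaf_local_sections[OF _ vals_sheaves(5) sections_O_sub],
    rule ab_presheaf.intro)
  show "comm_group add_complex" by (rule comm_group_add_complex)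
  show "f p \<in> carrier add_complex" for f :: "'a \<Rightarrow> complex" and p by (simp add: add_complex_def)
  show "f \<in> holo_restrictions M" if "f \<in> holo_restrictions N" "M \<subseteq> N" for f M N
    using that by (auto simp: holo_restrictions_def)
  show "\<exists>k\<in>holo_restrictions N. \<forall>p\<in>N. k p = \<one>\<^bsub>add_complex\<^esub>" if "openin X\<^sub>Y N" for N
    using openin_subset_Y[OF that] Y_subset
    by (intro bexI[of _ "\<lambda>x. 0"]) (auto simp: holo_restrictions_def add_complex_def holo_at_const)
  fix f N assume "f \<in> holo_restrictions N"
  then obtain U where U: "openin X U" "N \<subseteq> U" "\<forall>x\<in>U. holo_at A f x" by (auto simp: holo_restrictions_def)
  then show "\<exists>k\<in>holo_restrictions N. \<forall>p\<in>N. k p = inv\<^bsub>add_complex\<^esub> (f p)"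
    using holo_at_minus by (intro bexI[of _ "\<lambda>x. - f x"]) (auto simp: holo_restrictions_def inv_add_complex)
  fix g assume "g \<in> holo_restrictions N"
  then obtain W where W: "openin X W" "N \<subseteq> W" "\<forall>x\<in>W. holo_at A g x" by (auto simp: holo_restrictions_def)
  have "openin X (U \<inter> W)" "\<forall>x\<in>U \<inter> W. holo_at A (\<lambda>x. f x + g x) x"
    using U W holo_at_add by auto
  then have "(\<lambda>x. f x + g x) \<in> holo_restrictions N"
    using U(2) W(2) unfolding holo_restrictions_def by blast
  then show "\<exists>k\<in>holo_restrictions N. \<forall>p\<in>N. k p = f p \<otimes>\<^bsub>add_complex\<^esub> g p"
    by (intro bexI[of _ "\<lambda>x. f x + g x"]) (auto simp: add_complex_def)
qed

sublocale OY: ab_sheaf X\<^sub>Y O\<^sub>Y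
  by (rule ab_sheaf_O_sub)

lemma O_sub_const: "openin X\<^sub>Y V \<Longrightarrow> (\<lambda>x. c) \<in> sections O\<^sub>Y V"
  using openin_subset_Y[of V] Y_subset
  by (intro O_sub_sectionI) (auto intro!: exI[of _ "topspace X"] exI[of _ "\<lambda>x. c"] holo_at_const)

lemma O_sub_one: "(\<lambda>x. 1) \<in> sections O\<^sub>Y Y"
  using O_sub_const[OF openin_topspace] topspace_subset by simp

lemma O_sub_minus: "f \<in> sections O\<^sub>Y V \<Longrightarrow> (\<lambda>x. - f x) \<in> sections O\<^sub>Y V"
  using OY.section_inv[of f V] by (simp add: inv_add_complex)

lemma O_sub_mult_holo:
  assumes g: "g \<in> sections O\<^sub>Y V" and U: "openin X U" "V \<subseteq> U" and f: "\<And>x. x \<in> U \<Longrightarrow> holo_at A f x"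
  shows "(\<lambda>x. f x * g x) \<in> sections O\<^sub>Y V"
proof (rule O_sub_sectionI[OF OY.open_section[OF g]])
  fix y assume y: "y \<in> V"
  with g obtain W k where W: "openin X W" "y \<in> W" "\<And>x. x \<in> W \<Longrightarrow> holo_at A k x"
      "\<And>x. x \<in> W \<inter> V \<Longrightarrow> g x = k x"
    by (rule O_sub_sectionE) blast
  have "openin X (U \<inter> W)" using U W by blast
  then show "\<exists>U h. openin X U \<and> y \<in> U \<and> (\<forall>x\<in>U. holo_at A h x) \<and> (\<forall>x\<in>U \<inter> V. f x * g x = h x)"
    using W U y f by (intro exI[of _ "U \<inter> W"] exI[of _ "\<lambda>x. f x * k x"]) (auto intro: holo_at_mult)
qed

end

subsection \<open>The pullback of a module\<close>

locale O_module_pullback = holomorphic_atlas_subset X A Y + F: ab_sheaf X F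
  for X :: "'a topology" and A :: "('a, 'n::finite) chart set" and Y :: "'a set"
    and F :: "('a, 's) O_module" +
  assumes act_section: "s \<in> sections F U \<Longrightarrow> (\<And>x. x \<in> U \<Longrightarrow> holo_at A f x) \<Longrightarrow>
    (\<lambda>x. act F (f x) (s x)) \<in> sections F U"
begin

abbreviation "P \<equiv> pullback_stalk X A Y F"
abbreviation "tens \<equiv> pullback_elem X A Y F"

lemma stalk_module_simps:
  "carrier (stalk_module X F z) = carrier (stalk X F z)"
  "add (stalk_module X F z) = mult (stalk X F z)"
  "carrier (O_sub_stalk_module X A Y z) = carrier (stalk X\<^sub>Y O\<^sub>Y z)"
  "add (O_sub_stalk_module X A Y z) = mult (stalk X\<^sub>Y O\<^sub>Y z)"
  "carrier (O_stalk X A z) = carrier (stalk X (O_sheaf X A) z)"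
  by (simp_all add: stalk_module_def O_sub_stalk_module_def O_stalk_def)

lemma smult_germ:
  assumes "z \<in> Y"
  shows "germ X z f \<odot>\<^bsub>stalk_module X F z\<^esub> germ X z s = germ X z (\<lambda>x. act F (f x) (s x))"
proof -
  have "z \<in> topspace X" using assms Y_subset by blast
  from UN_germ_pair[OF this this, where m = "\<lambda>x. act F" and f = f and g = s] show ?thesis
    by (simp add: stalk_module_def) blast
qed

lemma smult_germ_O_sub:
  assumes z: "z \<in> Y"
  shows "germ X z f \<odot>\<^bsub>O_sub_stalk_module X A Y z\<^esub> germ X\<^sub>Y z g = germ X\<^sub>Y z (\<lambda>x. f x * g x)"
proof -
  have "(\<Union>f'\<in>germ X z f. \<Union>g'\<in>germ X\<^sub>Y z g. germ X\<^sub>Y z (\<lambda>x. (\<lambda>_. (*)) x (f' x) (g' x))) =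
      germ X\<^sub>Y z (\<lambda>x. (\<lambda>_. (*)) x (f x) (g x))"
  proof (rule UN_germ_pair)
    show "z \<in> topspace X" "z \<in> topspace X\<^sub>Y" using z Y_subset by auto
    show "\<exists>M. openin X\<^sub>Y M \<and> z \<in> M \<and> M \<subseteq> N" if "openin X N" "z \<in> N" for N
      using that z openin_Int_Y by (intro exI[of _ "N \<inter> Y"]) auto
  qed
  then show ?thesis by (simp add: O_sub_stalk_module_def)
qed

lemma module_pair_stalks:
  assumes z: "z \<in> Y"
  shows "module_pair (O_stalk X A z) (stalk_module X F z) (O_sub_stalk_module X A Y z)"
proof -
  interpret S: comm_group "stalk X F z"
    using z Y_subset by (intro F.comm_group_stalk) blast
  interpret S': comm_group "stalk X\<^sub>Y O\<^sub>Y z"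
    using z topspace_subset by (intro OY.comm_group_stalk) simp
  show ?thesis
  proof (rule module_pair.intro, unfold stalk_module_simps)
    fix a assume "a \<in> carrier (stalk X (O_sheaf X A) z)"
    then obtain U f where f: "openin X U" "z \<in> U" "\<And>x. x \<in> U \<Longrightarrow> holo_at A f x" "a = germ X z f"
      by (rule ab_sheaf.stalkE[OF ab_sheaf_O]) (auto simp: O_section_iff)
    show "a \<odot>\<^bsub>stalk_module X F z\<^esub> m \<in> carrier (stalk X F z)" if m: "m \<in> carrier (stalk X F z)" for m
    proof -
      obtain V s where s: "s \<in> sections F V" "z \<in> V" "m = germ X z s"
        using m by (rule F.stalkE)
      have "openin X (U \<inter> V)" using f(1) F.open_section[OF s(1)] by blast
      then have "s \<in> sections F (U \<inter> V)" by (rule F.section_restrict[OF s(1)]) auto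
      from F.germ_in_stalk[OF act_section[OF this], of f z] show ?thesis
        using f s by (simp add: smult_germ[OF z])
    qed
    show "a \<odot>\<^bsub>O_sub_stalk_module X A Y z\<^esub> n \<in> carrier (stalk X\<^sub>Y O\<^sub>Y z)"
      if n: "n \<in> carrier (stalk X\<^sub>Y O\<^sub>Y z)" for n
    proof -
      obtain V g where g: "g \<in> sections O\<^sub>Y V" "z \<in> V" "n = germ X\<^sub>Y z g"
        using n by (rule OY.stalkE)
      have "openin X\<^sub>Y (V \<inter> (U \<inter> Y))"
        using OY.open_section[OF g(1)] openin_Int_Y[OF f(1)] by (rule openin_Int)
      then have "g \<in> sections O\<^sub>Y (V \<inter> (U \<inter> Y))" by (rule OY.section_restrict[OF g(1)]) auto
      then have "(\<lambda>x. f x * g x) \<in> sections O\<^sub>Y (V \<inter> (U \<inter> Y))"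
        by (rule O_sub_mult_holo[OF _ f(1)]) (use f(3) in auto)
      from OY.germ_in_stalk[OF this, of z] show ?thesis
        using f g z by (simp add: smult_germ_O_sub[OF z])
    qed
  qed (rule S.m_closed S'.m_closed; assumption)+
qed

lemma comm_group_pullback_stalk: "z \<in> Y \<Longrightarrow> comm_group (P z)"
  unfolding pullback_stalk_def by (rule module_pair.comm_group_tensor_group[OF module_pair_stalks])

lemma tens_hom_left:
  assumes "z \<in> Y" "n \<in> carrier (stalk X\<^sub>Y O\<^sub>Y z)"
  shows "(\<lambda>m. tens z m n) \<in> hom (stalk X F z) (P z)"
  using assms module_pair.tensor_elem_closed[OF module_pair_stalks]
    module_pair.tensor_elem_add_left[OF module_pair_stalks]
  unfolding pullback_stalk_def pullback_elem_def by (auto simp: hom_def stalk_module_simps)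

lemma tens_hom_right:
  assumes "z \<in> Y" "m \<in> carrier (stalk X F z)"
  shows "tens z m \<in> hom (stalk X\<^sub>Y O\<^sub>Y z) (P z)"
  using assms module_pair.tensor_elem_closed[OF module_pair_stalks]
    module_pair.tensor_elem_add_right[OF module_pair_stalks]
  unfolding pullback_stalk_def pullback_elem_def by (auto simp: hom_def stalk_module_simps)

lemma tens_closed:
  "z \<in> Y \<Longrightarrow> m \<in> carrier (stalk X F z) \<Longrightarrow> n \<in> carrier (stalk X\<^sub>Y O\<^sub>Y z) \<Longrightarrow> tens z m n \<in> carrier (P z)"
  using tens_hom_left by (auto simp: hom_def)

lemma tens_act:
  assumes z: "z \<in> Y" and s: "s \<in> sections F U" "z \<in> U" and f: "\<And>x. x \<in> U \<Longrightarrow> holo_at A f x"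
    and g: "g \<in> sections O\<^sub>Y V" "z \<in> V"
  shows "tens z (germ X z (\<lambda>x. act F (f x) (s x))) (germ X\<^sub>Y z g) =
    tens z (germ X z s) (germ X\<^sub>Y z (\<lambda>x. f x * g x))"
proof -
  have "f \<in> sections (O_sheaf X A) U"
    using F.open_section[OF s(1)] f by (simp add: O_section_iff)
  then have "germ X z f \<in> carrier (O_stalk X A z)"
    using ab_sheaf.germ_in_stalk[OF ab_sheaf_O _ s(2)] by (simp add: stalk_module_simps)
  then show ?thesis
    using module_pair.tensor_elem_smult[OF module_pair_stalks[OF z], of "germ X z f" "germ X z s" "germ X\<^sub>Y z g"]
      F.germ_in_stalk[OF s] OY.germ_in_stalk[OF g]
    by (simp add: pullback_elem_def stalk_module_simps smult_germ[OF z] smult_germ_O_sub[OF z])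
qed

lemma tens_add_right:
  assumes z: "z \<in> Y" "z \<in> V" and f: "f \<in> sections O\<^sub>Y V" and g: "g \<in> sections O\<^sub>Y V"
    and m: "m \<in> carrier (stalk X F z)"
  shows "tens z m (germ X\<^sub>Y z (\<lambda>x. f x + g x)) = tens z m (germ X\<^sub>Y z f) \<otimes>\<^bsub>P z\<^esub> tens z m (germ X\<^sub>Y z g)"
proof -
  have "germ X\<^sub>Y z (\<lambda>x. f x + g x) = germ X\<^sub>Y z f \<otimes>\<^bsub>stalk X\<^sub>Y O\<^sub>Y z\<^esub> germ X\<^sub>Y z g"
    using z(1) topspace_subset by (subst stalk_mult) (auto simp: add_complex_def)
  then show ?thesis
    using hom_mult[OF tens_hom_right[OF z(1) m]] OY.germ_in_stalk[OF f z(2)] OY.germ_in_stalk[OF g z(2)]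
    by simp
qed

lemma tens_minus_right:
  assumes z: "z \<in> Y" "z \<in> V" and g: "g \<in> sections O\<^sub>Y V" and m: "m \<in> carrier (stalk X F z)"
  shows "tens z m (germ X\<^sub>Y z (\<lambda>x. - g x)) = inv\<^bsub>P z\<^esub> (tens z m (germ X\<^sub>Y z g))"
proof -
  interpret P: comm_group "P z" by (rule comm_group_pullback_stalk[OF z(1)])
  interpret S: comm_group "stalk X\<^sub>Y O\<^sub>Y z"
    using z topspace_subset by (intro OY.comm_group_stalk) simp
  interpret group_hom "stalk X\<^sub>Y O\<^sub>Y z" "P z" "tens z m"
    by unfold_locales (rule tens_hom_right[OF z(1) m])
  show ?thesis
    using OY.germ_inv[OF g z(2)] hom_inv[OF OY.germ_in_stalk[OF g z(2)]] by (simp add: inv_add_complex)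
qed

lemma tens_sum_right:
  assumes z: "z \<in> Y" "z \<in> V" and V: "openin X\<^sub>Y V" and g: "\<And>j. j \<in> J \<Longrightarrow> g j \<in> sections O\<^sub>Y V"
    and m: "m \<in> carrier (stalk X F z)"
  shows "tens z m (germ X\<^sub>Y z (\<lambda>x. \<Sum>j\<in>J. g j x)) = finprod (P z) (\<lambda>j. tens z m (germ X\<^sub>Y z (g j))) J"
proof -
  have "germ X\<^sub>Y z (\<lambda>x. \<Sum>j\<in>J. g j x) = finprod (stalk X\<^sub>Y O\<^sub>Y z) (\<lambda>j. germ X\<^sub>Y z (g j)) J"
    using OY.germ_finprod[OF V z(2), of J g] g by (simp add: finprod_add_complex)
  moreover have "comm_group (stalk X\<^sub>Y O\<^sub>Y z)"
    using z topspace_subset by (intro OY.comm_group_stalk) simp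
  ultimately show ?thesis
    using hom_finprod[OF _ comm_group_pullback_stalk[OF z(1)] tens_hom_right[OF z(1) m],
        of J "\<lambda>j. germ X\<^sub>Y z (g j)"] OY.germ_in_stalk[OF g z(2)] by simp
qed

definition tensor_sums where
  "tensor_sums N = {\<lambda>z. finprod (P z) (\<lambda>j. tens z (m j z) (germ X\<^sub>Y z (h j))) {..<k::nat} |k m h.
     \<forall>j<k. m j \<in> sections (inverse_image X Y F) N \<and> h j \<in> sections O\<^sub>Y N}"

lemma tensor_sumsI:
  "(\<And>j. j < k \<Longrightarrow> m j \<in> sections (inverse_image X Y F) N) \<Longrightarrow> (\<And>j. j < k \<Longrightarrow> h j \<in> sections O\<^sub>Y N) \<Longrightarrow>
    (\<lambda>z. finprod (P z) (\<lambda>j. tens z (m j z) (germ X\<^sub>Y z (h j))) {..<k::nat}) \<in> tensor_sums N"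
  unfolding tensor_sums_def by blast

lemma tensor_sumsE:
  assumes "s \<in> tensor_sums N"
  obtains k :: nat and m h where "\<And>j. j < k \<Longrightarrow> m j \<in> sections (inverse_image X Y F) N"
    "\<And>j. j < k \<Longrightarrow> h j \<in> sections O\<^sub>Y N"
    "s = (\<lambda>z. finprod (P z) (\<lambda>j. tens z (m j z) (germ X\<^sub>Y z (h j))) {..<k})"
  using assms unfolding tensor_sums_def by blast

lemma vals_module_pullback: "vals (module_pullback X A Y F) = P"
  by (simp add: module_pullback_def)

lemma sections_module_pullback: "sections (module_pullback X A Y F) = local_sections X\<^sub>Y tensor_sums"
proof -
  have "(\<exists>N (k::nat) m h. y \<in> N \<and> N \<subseteq> V \<and> openin X\<^sub>Y N \<and>
        (\<forall>j<k. m j \<in> sections (inverse_image X Y F) N \<and> h j \<in> sections O\<^sub>Y N) \<and>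
        (\<forall>z\<in>N. s z = finprod (P z) (\<lambda>j. tens z (m j z) (germ X\<^sub>Y z (h j))) {..<k})) \<longleftrightarrow>
      (\<exists>N f. openin X\<^sub>Y N \<and> y \<in> N \<and> N \<subseteq> V \<and> f \<in> tensor_sums N \<and> (\<forall>z\<in>N. s z = f z))"
    (is "?sums \<longleftrightarrow> ?local") for y V and s :: "'a \<Rightarrow> _"
  proof
    assume ?sums
    then obtain N k m h where N: "y \<in> N" "N \<subseteq> V" "openin X\<^sub>Y N"
        and "\<forall>j<k. m j \<in> sections (inverse_image X Y F) N \<and> h j \<in> sections O\<^sub>Y N"
        and eq: "\<forall>z\<in>N. s z = finprod (P z) (\<lambda>j. tens z (m j z) (germ X\<^sub>Y z (h j))) {..<k::nat}"
      by (elim exE conjE)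
    then have "(\<lambda>z. finprod (P z) (\<lambda>j. tens z (m j z) (germ X\<^sub>Y z (h j))) {..<k}) \<in> tensor_sums N"
      by (intro tensor_sumsI) auto
    with N eq show ?local by (intro exI conjI)
  next
    assume ?local
    then obtain N f where N: "openin X\<^sub>Y N" "y \<in> N" "N \<subseteq> V" and f: "f \<in> tensor_sums N"
        and eq: "\<forall>z\<in>N. s z = f z"
      by (elim exE conjE)
    from f obtain k m h where "\<And>j. j < k \<Longrightarrow> m j \<in> sections (inverse_image X Y F) N"
      "\<And>j. j < k \<Longrightarrow> h j \<in> sections O\<^sub>Y N"
      "f = (\<lambda>z. finprod (P z) (\<lambda>j. tens z (m j z) (germ X\<^sub>Y z (h j))) {..<k::nat})"
      by (rule tensor_sumsE) blast
    with N eq show ?sums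
      by (intro exI[of _ N] exI[of _ k] exI[of _ m] exI[of _ h]) simp
  qed
  then show ?thesis
    unfolding module_pullback_def local_sections_def by simp
qed

lemma tensor_sums_section:
  assumes V: "openin X\<^sub>Y V" and t: "t \<in> tensor_sums V" and eq: "\<And>z. z \<in> V \<Longrightarrow> s z = t z"
  shows "s \<in> sections (module_pullback X A Y F) V"
  unfolding sections_module_pullback
  by (rule local_sectionsI[OF V]) (intro exI[of _ V] exI[of _ t], use V t eq in simp)

sublocale inverse: ab_sheaf X\<^sub>Y "inverse_image X Y F"
  by (rule F.ab_sheaf_inverse_image[OF Y_subset])

lemma tens_sections_closed:
  assumes m: "m \<in> sections (inverse_image X Y F) V" and h: "h \<in> sections O\<^sub>Y V" and z: "z \<in> V"
  shows "tens z (m z) (germ X\<^sub>Y z h) \<in> carrier (P z)"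
  using inverse.in_topspace[OF m z] inverse.section_closed[OF m z] OY.germ_in_stalk[OF h z] topspace_subset
  by (intro tens_closed) (auto simp: F.vals_inverse_image)

lemma tensor_sums_closed:
  assumes s: "s \<in> tensor_sums N" and p: "p \<in> N" "p \<in> Y"
  shows "s p \<in> carrier (P p)"
proof -
  interpret comm_group "P p" by (rule comm_group_pullback_stalk[OF p(2)])
  obtain k :: nat and m h where m: "\<And>j. j < k \<Longrightarrow> m j \<in> sections (inverse_image X Y F) N"
    and h: "\<And>j. j < k \<Longrightarrow> h j \<in> sections O\<^sub>Y N"
    and s: "s = (\<lambda>z. finprod (P z) (\<lambda>j. tens z (m j z) (germ X\<^sub>Y z (h j))) {..<k})"
    using s by (rule tensor_sumsE) blast
  show ?thesis
    unfolding s using tens_sections_closed[OF m h p(1)] by (intro finprod_closed) auto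
qed

lemma tensor_sums_inverse:
  assumes s: "s \<in> tensor_sums N" and N: "N \<subseteq> Y"
  shows "\<exists>t\<in>tensor_sums N. \<forall>p\<in>N. t p = inv\<^bsub>P p\<^esub> (s p)"
proof -
  obtain k :: nat and m h where m: "\<And>j. j < k \<Longrightarrow> m j \<in> sections (inverse_image X Y F) N"
    and h: "\<And>j. j < k \<Longrightarrow> h j \<in> sections O\<^sub>Y N"
    and s: "s = (\<lambda>z. finprod (P z) (\<lambda>j. tens z (m j z) (germ X\<^sub>Y z (h j))) {..<k})"
    using s by (rule tensor_sumsE) blast
  have "finprod (P p) (\<lambda>j. tens p (m j p) (germ X\<^sub>Y p (\<lambda>x. - h j x))) {..<k} = inv\<^bsub>P p\<^esub> (s p)"
    if p: "p \<in> N" for p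
  proof -
    have pY: "p \<in> Y" using p N by blast
    interpret comm_group "P p" by (rule comm_group_pullback_stalk[OF pY])
    have "m j p \<in> carrier (stalk X F p)" if "j < k" for j
      using inverse.section_closed[OF m[OF that] p] by (simp add: F.vals_inverse_image)
    then have "finprod (P p) (\<lambda>j. tens p (m j p) (germ X\<^sub>Y p (\<lambda>x. - h j x))) {..<k} =
        finprod (P p) (\<lambda>j. inv\<^bsub>P p\<^esub> (tens p (m j p) (germ X\<^sub>Y p (h j)))) {..<k}"
      using tens_sections_closed[OF m h p] tens_minus_right[OF pY p h]
      by (intro finprod_cong') auto
    also have "\<dots> = inv\<^bsub>P p\<^esub> (s p)"
      unfolding s using tens_sections_closed[OF m h p] by (intro finprod_inv) auto
    finally show ?thesis .
  qed
  then show ?thesis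
    using m O_sub_minus[OF h] by (intro bexI[OF _ tensor_sumsI[where k = k]]) auto
qed

lemma tensor_sums_mult:
  assumes s: "s \<in> tensor_sums N" and t: "t \<in> tensor_sums N" and N: "N \<subseteq> Y"
  shows "\<exists>u\<in>tensor_sums N. \<forall>p\<in>N. u p = s p \<otimes>\<^bsub>P p\<^esub> t p"
proof -
  obtain k :: nat and m h where m: "\<And>j. j < k \<Longrightarrow> m j \<in> sections (inverse_image X Y F) N"
    and h: "\<And>j. j < k \<Longrightarrow> h j \<in> sections O\<^sub>Y N"
    and s: "s = (\<lambda>z. finprod (P z) (\<lambda>j. tens z (m j z) (germ X\<^sub>Y z (h j))) {..<k})"
    using s by (rule tensor_sumsE) blast
  obtain k' :: nat and m' h' where m': "\<And>j. j < k' \<Longrightarrow> m' j \<in> sections (inverse_image X Y F) N"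
    and h': "\<And>j. j < k' \<Longrightarrow> h' j \<in> sections O\<^sub>Y N"
    and t: "t = (\<lambda>z. finprod (P z) (\<lambda>j. tens z (m' j z) (germ X\<^sub>Y z (h' j))) {..<k'})"
    using t by (rule tensor_sumsE) blast
  define M where "M j = (if j < k then m j else m' (j - k))" for j
  define H where "H j = (if j < k then h j else h' (j - k))" for j
  have "finprod (P p) (\<lambda>j. tens p (M j p) (germ X\<^sub>Y p (H j))) {..<k + k'} = s p \<otimes>\<^bsub>P p\<^esub> t p"
    if p: "p \<in> N" for p
  proof -
    interpret comm_group "P p" using p N by (intro comm_group_pullback_stalk) blast
    have "(\<lambda>j. tens p (M j p) (germ X\<^sub>Y p (H j))) =
        (\<lambda>j. if j < k then tens p (m j p) (germ X\<^sub>Y p (h j)) else tens p (m' (j - k) p) (germ X\<^sub>Y p (h' (j - k))))"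
      by (simp add: M_def H_def fun_eq_iff)
    then show ?thesis
      unfolding s t
      using finprod_lessThan_add[of k "\<lambda>j. tens p (m j p) (germ X\<^sub>Y p (h j))" k'
          "\<lambda>j. tens p (m' j p) (germ X\<^sub>Y p (h' j))"]
        tens_sections_closed[OF m h p] tens_sections_closed[OF m' h' p] by simp
  qed
  moreover have "M j \<in> sections (inverse_image X Y F) N" "H j \<in> sections O\<^sub>Y N" if "j < k + k'" for j
    using that m h m'[of "j - k"] h'[of "j - k"] by (auto simp: M_def H_def)
  ultimately show ?thesis
    by (intro bexI[OF _ tensor_sumsI[where k = "k + k'" and m = M and h = H]]) auto
qed

lemma ab_sheaf_module_pullback: "ab_sheaf X\<^sub>Y (module_pullback X A Y F)"
proof (rule ab_presheaf.ab_sheaf_local_sections[OF _ vals_module_pullback sections_module_pullback],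
    rule ab_presheaf.intro)
  show "comm_group (P p)" if "p \<in> topspace X\<^sub>Y" for p
    using that comm_group_pullback_stalk by (simp add: topspace_subset)
  fix N assume N: "openin X\<^sub>Y N"
  have "finprod (P p) f {..<0::nat} = \<one>\<^bsub>P p\<^esub>" if "p \<in> N" for p f
    using that openin_subset_Y[OF N] comm_group_pullback_stalk
    by (auto intro!: comm_monoid.finprod_empty comm_group.axioms(1))
  then show "\<exists>t\<in>tensor_sums N. \<forall>p\<in>N. t p = \<one>\<^bsub>P p\<^esub>"
    by (intro bexI[OF _ tensor_sumsI[where k = 0]]) auto
  fix s assume s: "s \<in> tensor_sums N"
  show "s p \<in> carrier (P p)" if "p \<in> N" for p
    using tensor_sums_closed[OF s that] openin_subset_Y[OF N] that by blast
  show "\<exists>t\<in>tensor_sums N. \<forall>p\<in>N. t p = inv\<^bsub>P p\<^esub> (s p)"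
    by (rule tensor_sums_inverse[OF s openin_subset_Y[OF N]])
  show "\<exists>u\<in>tensor_sums N. \<forall>p\<in>N. u p = s p \<otimes>\<^bsub>P p\<^esub> t p" if "t \<in> tensor_sums N" for t
    by (rule tensor_sums_mult[OF s that openin_subset_Y[OF N]])
next
  fix s N M assume s: "s \<in> tensor_sums N" and M: "openin X\<^sub>Y M" "M \<subseteq> N"
  from s show "s \<in> tensor_sums M"
    using inverse.section_restrict[OF _ M] OY.section_restrict[OF _ M]
    by (elim tensor_sumsE) (auto intro!: tensor_sumsI)
qed

sublocale pullback: ab_sheaf X\<^sub>Y "module_pullback X A Y F"
  by (rule ab_sheaf_module_pullback)

lemma tensor_sum_section:
  assumes I: "finite I" and V: "openin X\<^sub>Y V"
    and m: "\<And>i. i \<in> I \<Longrightarrow> m i \<in> sections (inverse_image X Y F) V"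
    and h: "\<And>i. i \<in> I \<Longrightarrow> h i \<in> sections O\<^sub>Y V"
  shows "(\<lambda>z. finprod (P z) (\<lambda>i. tens z (m i z) (germ X\<^sub>Y z (h i))) I) \<in> sections (module_pullback X A Y F) V"
proof -
  obtain e where "bij_betw e {..<card I} I"
    using ex_bij_betw_nat_finite[OF I] by (auto simp: atLeast0LessThan)
  then have e: "e ` {..<card I} = I" "inj_on e {..<card I}" by (auto simp: bij_betw_def)
  have eq: "finprod (P z) (\<lambda>i. tens z (m i z) (germ X\<^sub>Y z (h i))) I =
      finprod (P z) (\<lambda>j. tens z (m (e j) z) (germ X\<^sub>Y z (h (e j)))) {..<card I}" if z: "z \<in> V" for z
  proof -
    interpret comm_group "P z"
      using openin_subset_Y[OF V] z by (intro comm_group_pullback_stalk) blast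
    show ?thesis
      using finprod_reindex[of "\<lambda>i. tens z (m i z) (germ X\<^sub>Y z (h i))" e "{..<card I}"]
        tens_sections_closed[OF m h z] e by auto
  qed
  show ?thesis
    by (rule tensor_sums_section[OF V tensor_sumsI eq]) (use m h e(1) in auto)
qed

lemma sheaf_hom_module_pullback:
  "sheaf_hom X\<^sub>Y (inverse_image X Y F) (module_pullback X A Y F) (\<lambda>p m. tens p m (germ X\<^sub>Y p (\<lambda>x. 1)))"
proof unfold_locales
  show "(\<lambda>m. tens p m (germ X\<^sub>Y p (\<lambda>x. 1))) \<in> hom (vals (inverse_image X Y F) p) (vals (module_pullback X A Y F) p)"
    if "p \<in> topspace X\<^sub>Y" for p
    using that tens_hom_left OY.germ_in_stalk[OF O_sub_one]
    by (simp add: topspace_subset F.vals_inverse_image vals_module_pullback)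
  fix U s assume s: "s \<in> sections (inverse_image X Y F) U"
  have U: "openin X\<^sub>Y U" by (rule inverse.open_section[OF s])
  show "(\<lambda>p. tens p (s p) (germ X\<^sub>Y p (\<lambda>x. 1))) \<in> sections (module_pullback X A Y F) U"
  proof (rule tensor_sums_section[OF U tensor_sumsI[where k = 1 and m = "\<lambda>j. s" and h = "\<lambda>j x. 1"]])
    fix z assume z: "z \<in> U"
    interpret comm_group "P z"
      using openin_subset_Y[OF U] z by (intro comm_group_pullback_stalk) blast
    show "tens z (s z) (germ X\<^sub>Y z (\<lambda>x. 1)) = finprod (P z) (\<lambda>j. tens z (s z) (germ X\<^sub>Y z (\<lambda>x. 1))) {..<1::nat}"
      using tens_sections_closed[OF s O_sub_const[OF U] z] by (simp add: lessThan_Suc)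
  qed (use s O_sub_const[OF U] in auto)
qed

end

subsection \<open>The pullback of the cotangent sheaf\<close>

context holomorphic_atlas_subset
begin

sublocale \<Omega>: O_module_pullback X A Y "Omega1 X A"
proof (intro O_module_pullback.intro O_module_pullback_axioms.intro holomorphic_atlas_subset_axioms
    ab_sheaf_Omega1)
  show "(\<lambda>x. act (Omega1 X A) (f x) (\<omega> x)) \<in> sections (Omega1 X A) U"
    if "\<omega> \<in> sections (Omega1 X A) U" "\<And>x. x \<in> U \<Longrightarrow> holo_at A f x" for \<omega> U f
    using Omega1_scale[OF that] by (simp add: Omega1_def)
qed

lemma finprod_cotangent:
  assumes "\<And>j. j \<in> J \<Longrightarrow> \<omega> j \<in> cotangent A x"
  shows "finprod (cotangent_group A x) \<omega> J = (\<lambda>c. \<Sum>j\<in>J. \<omega> j c)"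
proof -
  interpret comm_group "cotangent_group A x" by (rule comm_group_cotangent)
  have carrier: "carrier (cotangent_group A x) = cotangent A x"
    and mult: "\<omega> \<otimes>\<^bsub>cotangent_group A x\<^esub> \<eta> = (\<lambda>c. \<omega> c + \<eta> c)"
    and one: "\<one>\<^bsub>cotangent_group A x\<^esub> = (\<lambda>c. 0)" for \<omega> \<eta>
    by (simp_all add: cotangent_group_def)
  show ?thesis
    using assms by (induction J rule: infinite_finite_induct) (simp_all add: carrier mult one Pi_def)
qed

definition coordinate_form where
  "coordinate_form c \<beta> z = finprod (\<Omega>.P z)
     (\<lambda>j. \<Omega>.tens z (germ X z (ext_d A (\<lambda>x. snd c x $ j))) (germ X\<^sub>Y z (\<beta> j))) UNIV"

lemma coordinate_differential_section:
  "(W, \<phi>) \<in> A \<Longrightarrow> ext_d A (\<lambda>x. \<phi> x $ j) \<in> sections (Omega1 X A) W"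
  by (intro ext_d_section chart_open holo_at_coordinate)

lemma coordinate_germ_closed:
  "(W, \<phi>) \<in> A \<Longrightarrow> z \<in> W \<Longrightarrow> germ X z (ext_d A (\<lambda>x. \<phi> x $ j)) \<in> carrier (stalk X (Omega1 X A) z)"
  by (rule \<Omega>.F.germ_in_stalk[OF coordinate_differential_section])

lemma germ_coordinate_expansion:
  assumes chart: "(W, \<phi>) \<in> A" "z \<in> W" and \<omega>: "\<omega> \<in> sections (Omega1 X A) U" "z \<in> U"
  shows "germ X z \<omega> = finprod (stalk X (Omega1 X A) z)
    (\<lambda>j. germ X z (\<lambda>x c. (\<omega> x (W, \<phi>) $ j) *s ext_d A (\<lambda>y. \<phi> y $ j) x c)) UNIV"
proof -
  define \<eta> where "\<eta> j x c = (\<omega> x (W, \<phi>) $ j) *s ext_d A (\<lambda>y. \<phi> y $ j) x c" for j x c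
  have \<omega>_U: "openin X U" "\<And>x. x \<in> U \<Longrightarrow> \<omega> x \<in> cotangent A x"
    "\<And>x j. x \<in> U \<Longrightarrow> x \<in> W \<Longrightarrow> holo_at A (\<lambda>x. \<omega> x (W, \<phi>) $ j) x"
    using \<omega>(1) chart(1) by (auto simp: Omega1_section_iff)
  have UW: "openin X (U \<inter> W)" using \<omega>_U(1) chart_open[OF chart(1)] by blast
  have "ext_d A (\<lambda>y. \<phi> y $ j) \<in> sections (Omega1 X A) (U \<inter> W)" for j
    by (rule \<Omega>.F.section_restrict[OF coordinate_differential_section[OF chart(1)] UW]) blast
  from Omega1_scale[OF this \<omega>_U(3)] have \<eta>: "\<eta> j \<in> sections (Omega1 X A) (U \<inter> W)" for j
    unfolding \<eta>_def by auto
  have "germ X z \<omega> = germ X z (\<lambda>x. finprod (vals (Omega1 X A) x) (\<lambda>j. \<eta> j x) UNIV)"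
  proof (rule germ_cong[OF UW])
    fix x assume x: "x \<in> U \<inter> W"
    have "\<eta> j x \<in> cotangent A x" for j using \<eta> x unfolding Omega1_section_iff by blast
    then show "\<omega> x = finprod (vals (Omega1 X A) x) (\<lambda>j. \<eta> j x) UNIV"
      using cotangent_expansion[OF \<omega>_U(2) chart(1), of x] x by (simp add: finprod_cotangent \<eta>_def)
  qed (use chart(2) \<omega>(2) in blast)
  also have "\<dots> = finprod (stalk X (Omega1 X A) z) (\<lambda>j. germ X z (\<eta> j)) UNIV"
    using chart(2) \<omega>(2) \<eta> by (intro \<Omega>.F.germ_finprod[OF UW]) auto
  finally show ?thesis unfolding \<eta>_def .
qed

lemma tens_eq_coordinate_form:
  assumes z: "z \<in> Y" and chart: "(W, \<phi>) \<in> A" "z \<in> W"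
    and \<omega>: "\<omega> \<in> sections (Omega1 X A) U" "z \<in> U" and g: "g \<in> sections O\<^sub>Y V" "z \<in> V"
  shows "\<Omega>.tens z (germ X z \<omega>) (germ X\<^sub>Y z g) = coordinate_form (W, \<phi>) (\<lambda>j x. \<omega> x (W, \<phi>) $ j * g x) z"
proof -
  let ?S = "stalk X (Omega1 X A) z"
  define \<eta> where "\<eta> j x c = (\<omega> x (W, \<phi>) $ j) *s ext_d A (\<lambda>y. \<phi> y $ j) x c" for j x c
  have UW: "openin X (U \<inter> W)"
    using \<Omega>.F.open_section[OF \<omega>(1)] chart_open[OF chart(1)] by blast
  have coeff: "holo_at A (\<lambda>x. \<omega> x (W, \<phi>) $ j) x" if "x \<in> U \<inter> W" for x j
    using \<omega>(1) chart(1) that by (auto simp: Omega1_section_iff)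
  have dz: "ext_d A (\<lambda>y. \<phi> y $ j) \<in> sections (Omega1 X A) (U \<inter> W)" for j
    by (rule \<Omega>.F.section_restrict[OF coordinate_differential_section[OF chart(1)] UW]) blast
  have zUW: "z \<in> U \<inter> W" using chart(2) \<omega>(2) by blast
  have "\<eta> j \<in> sections (Omega1 X A) (U \<inter> W)" for j
    unfolding \<eta>_def by (rule Omega1_scale[OF dz coeff])
  from \<Omega>.F.germ_in_stalk[OF this zUW] have \<eta>: "germ X z (\<eta> j) \<in> carrier ?S" for j .
  have "\<Omega>.tens z (germ X z \<omega>) (germ X\<^sub>Y z g) =
      finprod (\<Omega>.P z) (\<lambda>j. \<Omega>.tens z (germ X z (\<eta> j)) (germ X\<^sub>Y z g)) UNIV"
    unfolding germ_coordinate_expansion[OF chart \<omega>] \<eta>_def[symmetric]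
    using Y_subset z \<eta>
    by (intro hom_finprod \<Omega>.F.comm_group_stalk \<Omega>.comm_group_pullback_stalk \<Omega>.tens_hom_left
        OY.germ_in_stalk[OF g]) auto
  moreover have "\<Omega>.tens z (germ X z (\<eta> j)) (germ X\<^sub>Y z g) =
      \<Omega>.tens z (germ X z (ext_d A (\<lambda>x. \<phi> x $ j))) (germ X\<^sub>Y z (\<lambda>x. \<omega> x (W, \<phi>) $ j * g x))" for j
    using \<Omega>.tens_act[OF z dz zUW coeff g, of j j] by (simp add: Omega1_def \<eta>_def[abs_def])
  ultimately show ?thesis by (simp add: coordinate_form_def)
qed

lemma coordinate_form_section:
  assumes chart: "(W, \<phi>) \<in> A" and V: "openin X\<^sub>Y V" "V \<subseteq> W" and \<beta>: "\<And>j. \<beta> j \<in> sections O\<^sub>Y V"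
  shows "coordinate_form (W, \<phi>) \<beta> \<in> sections (module_pullback X A Y (Omega1 X A)) V"
  unfolding coordinate_form_def[abs_def] snd_conv
  using \<beta> \<Omega>.F.germ_section_inverse_image[OF coordinate_differential_section[OF chart] V]
  by (intro \<Omega>.tensor_sum_section V) auto

lemma coordinate_form_cong:
  assumes "openin X\<^sub>Y V" "z \<in> V" "\<And>j q. q \<in> V \<Longrightarrow> \<beta> j q = \<beta>' j q"
  shows "coordinate_form c \<beta> z = coordinate_form c \<beta>' z"
proof -
  have "germ X\<^sub>Y z (\<beta> j) = germ X\<^sub>Y z (\<beta>' j)" for j
    using assms by (intro germ_cong)
  then show ?thesis by (simp add: coordinate_form_def)
qed

lemma coordinate_form_add:
  assumes chart: "(W, \<phi>) \<in> A" "z \<in> W" and z: "z \<in> Y" "z \<in> V"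
    and \<beta>: "\<And>j. \<beta> j \<in> sections O\<^sub>Y V" and \<beta>': "\<And>j. \<beta>' j \<in> sections O\<^sub>Y V"
  shows "coordinate_form (W, \<phi>) (\<lambda>j q. \<beta> j q + \<beta>' j q) z =
    coordinate_form (W, \<phi>) \<beta> z \<otimes>\<^bsub>\<Omega>.P z\<^esub> coordinate_form (W, \<phi>) \<beta>' z"
proof -
  interpret P: comm_group "\<Omega>.P z" by (rule \<Omega>.comm_group_pullback_stalk[OF z(1)])
  note dz = coordinate_germ_closed[OF chart]
  show ?thesis
    unfolding coordinate_form_def snd_conv \<Omega>.tens_add_right[OF z \<beta> \<beta>' dz]
    by (intro P.finprod_multf) (auto intro: \<Omega>.tens_closed z dz OY.germ_in_stalk \<beta> \<beta>')
qed

lemma coordinate_form_change: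
  assumes chart: "(W, \<phi>) \<in> A" and chart': "(W', \<phi>') \<in> A" and z: "z \<in> Y" "z \<in> V"
    and V: "openin X\<^sub>Y V" "V \<subseteq> W \<inter> W'" and \<beta>: "\<And>k. \<beta> k \<in> sections O\<^sub>Y V"
  shows "coordinate_form (W', \<phi>') \<beta> z =
    coordinate_form (W, \<phi>) (\<lambda>j q. \<Sum>k\<in>UNIV. cgrad (W, \<phi>) (\<lambda>y. \<phi>' y $ k) q $ j * \<beta> k q) z"
proof -
  interpret P: comm_group "\<Omega>.P z" by (rule \<Omega>.comm_group_pullback_stalk[OF z(1)])
  have W: "z \<in> W" "z \<in> W'" "openin X (W \<inter> W')"
    using z(2) V(2) chart_open[OF chart] chart_open[OF chart'] by auto
  define \<gamma> where "\<gamma> k j q = cgrad (W, \<phi>) (\<lambda>y. \<phi>' y $ k) q $ j * \<beta> k q" for k j q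
  have \<gamma>: "\<gamma> k j \<in> sections O\<^sub>Y V" for k j
    unfolding \<gamma>_def
    using chart_open[OF chart'] holo_at_coordinate[OF chart']
    by (intro O_sub_mult_holo[OF \<beta> W(3) V(2)] holo_at_cgrad[OF _ _ chart, of W']) auto
  let ?dz = "\<lambda>j. germ X z (ext_d A (\<lambda>x. \<phi> x $ j))"
  note dz = coordinate_germ_closed[OF chart W(1)]
  have "\<Omega>.tens z (germ X z (ext_d A (\<lambda>x. \<phi>' x $ k))) (germ X\<^sub>Y z (\<beta> k)) =
      coordinate_form (W, \<phi>) (\<gamma> k) z" for k
    unfolding tens_eq_coordinate_form[OF z(1) chart W(1) coordinate_differential_section[OF chart'] W(2) \<beta> z(2)]
    by (rule coordinate_form_cong[OF V(1) z(2)])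
      (use V(2) in \<open>auto simp: \<gamma>_def ext_d_chart[OF chart]\<close>)
  then have "coordinate_form (W', \<phi>') \<beta> z =
      finprod (\<Omega>.P z) (\<lambda>k. finprod (\<Omega>.P z) (\<lambda>j. \<Omega>.tens z (?dz j) (germ X\<^sub>Y z (\<gamma> k j))) UNIV) UNIV"
    by (simp add: coordinate_form_def)
  also have "\<dots> = finprod (\<Omega>.P z) (\<lambda>j. finprod (\<Omega>.P z) (\<lambda>k. \<Omega>.tens z (?dz j) (germ X\<^sub>Y z (\<gamma> k j))) UNIV) UNIV"
    by (rule P.finprod_swap) (auto intro: \<Omega>.tens_closed z dz OY.germ_in_stalk \<gamma>)
  also have "\<dots> = coordinate_form (W, \<phi>) (\<lambda>j q. \<Sum>k\<in>UNIV. \<gamma> k j q) z"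
    by (simp add: coordinate_form_def \<Omega>.tens_sum_right[OF z V(1) \<gamma> dz])
  finally show ?thesis by (simp only: \<gamma>_def)
qed

end

section \<open>Line bundles\<close>

subsection \<open>Local trivializations and frames\<close>

lemma local_triv_open: "local_triv T L t \<Longrightarrow> openin T (fst t)"
  by (cases t) (simp add: local_triv_def)

lemma local_triv_bij_betw:
  assumes "local_triv T L t"
  shows "bij_betw (\<lambda>e. (bundle_proj L e, snd t e)) (over L (fst t)) (fst t \<times> UNIV)"
proof -
  have homeo: "homeomorphic_map (subtopology (bundle_space L) (over L (fst t)))
      (prod_topology (subtopology T (fst t)) euclidean) (\<lambda>e. (bundle_proj L e, snd t e))"
    using assms by (simp add: local_triv_def split_beta)
  have "topspace (subtopology (bundle_space L) (over L (fst t))) = over L (fst t)"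
    by (auto simp: over_def)
  moreover have "topspace (prod_topology (subtopology T (fst t)) (euclidean :: complex topology)) = fst t \<times> UNIV"
    using openin_subset[OF local_triv_open[OF assms]] by auto
  ultimately show ?thesis
    using homeomorphic_imp_injective_map[OF homeo] homeomorphic_imp_surjective_map[OF homeo]
    by (simp add: bij_betw_def)
qed

lemma
  assumes t: "local_triv T L t" "x \<in> fst t"
  shows local_frame_over: "local_frame L t x \<in> over L {x}"
    and local_frame_coordinate: "snd t (local_frame L t x) = 1"
proof -
  note bij = local_triv_bij_betw[OF t(1)]
  have "(x, 1) \<in> (\<lambda>e. (bundle_proj L e, snd t e)) ` over L (fst t)"
    using bij_betw_imp_surj_on[OF bij] t(2) by simp
  then obtain e where e: "e \<in> over L (fst t)" "bundle_proj L e = x" "snd t e = 1"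
    by auto
  have "\<exists>!e. e \<in> over L {x} \<and> snd t e = 1"
  proof (rule ex1I[of _ e])
    show "e \<in> over L {x} \<and> snd t e = 1" using e by (auto simp: over_def)
    fix e' assume "e' \<in> over L {x} \<and> snd t e' = 1"
    then show "e' = e"
      using inj_onD[OF bij_betw_imp_inj_on[OF bij], of e' e] e t(2) by (auto simp: over_def)
  qed
  from theI'[OF this] show "local_frame L t x \<in> over L {x}" "snd t (local_frame L t x) = 1"
    unfolding local_frame_def by auto
qed

lemma coordinate_eq_transition_mult:
  assumes "trivs_compatible S L t t'" "e \<in> over L {x}" "x \<in> fst t" "x \<in> fst t'"
  shows "snd t e = transition L t t' x * snd t' e"
  using assms unfolding trivs_compatible_def over_def by fastforce

subsection \<open>Holomorphic line bundles on complex manifolds\<close>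

locale holomorphic_bundle = holomorphic_atlas X A
  for X :: "'a topology" and A :: "('a, 'n::finite) chart set" +
  fixes L :: "('a, 'e) line_bundle"
  assumes line_bundle: "holomorphic_line_bundle X (O_sheaf X A) L"
begin

abbreviation "holo_trivialization \<equiv> holo_triv X (O_sheaf X A) L"

sublocale units: ab_sheaf X "units_sheaf (O_sheaf X A)"
  by (rule ab_sheaf_units)

lemma bundle_triv_holo: "t \<in> bundle_trivs L \<Longrightarrow> holo_trivialization t"
  using line_bundle unfolding holomorphic_line_bundle_def holo_triv_def by blast

lemma holo_trivialization_local: "holo_trivialization t \<Longrightarrow> local_triv X L t"
  by (simp add: holo_triv_def)

lemma holo_trivialization_open: "holo_trivialization t \<Longrightarrow> openin X (fst t)"
  by (rule local_triv_open[OF holo_trivialization_local])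

lemma bundle_triv_open: "t \<in> bundle_trivs L \<Longrightarrow> openin X (fst t)"
  by (rule holo_trivialization_open[OF bundle_triv_holo])

lemma bundle_triv_exists:
  assumes "x \<in> topspace X"
  obtains t where "t \<in> bundle_trivs L" "x \<in> fst t"
  using assms line_bundle unfolding holomorphic_line_bundle_def by blast

lemma transition_via:
  assumes "holo_trivialization t" "holo_trivialization t'" "s \<in> bundle_trivs L"
    and "x \<in> fst t" "x \<in> fst t'" "x \<in> fst s"
  shows "transition L t t' x = transition L t s x * transition L s t' x"
  unfolding transition_def[of L t t'] transition_def[of L s t']
proof (rule coordinate_eq_transition_mult)
  show "trivs_compatible (O_sheaf X A) L t s" using assms(1,3) unfolding holo_triv_def by blast
  show "local_frame L t' x \<in> over L {x}"
    by (rule local_frame_over[OF holo_trivialization_local[OF assms(2)] assms(5)])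
qed (use assms in auto)

lemma transition_inverse:
  assumes "holo_trivialization t" "s \<in> bundle_trivs L" "x \<in> fst t" "x \<in> fst s"
  shows "transition L s t x * transition L t s x = 1"
proof -
  note s = holo_trivialization_local[OF bundle_triv_holo[OF assms(2)]]
  have "trivs_compatible (O_sheaf X A) L s t" using assms(1,2) unfolding holo_triv_def by blast
  from coordinate_eq_transition_mult[OF this local_frame_over[OF s assms(4)] assms(4,3)]
  show ?thesis
    unfolding local_frame_coordinate[OF s assms(4)] by (simp add: transition_def[of L t s])
qed

lemma transition_cocycle:
  assumes trivs: "holo_trivialization t" "holo_trivialization t'" "holo_trivialization t''"
    and x: "x \<in> fst t" "x \<in> fst t'" "x \<in> fst t''"
  shows "transition L t t' x * transition L t' t'' x = transition L t t'' x"
proof -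
  have "x \<in> topspace X" using holo_trivialization_open[OF trivs(1)] x(1) openin_subset by blast
  then obtain s where s: "s \<in> bundle_trivs L" "x \<in> fst s" by (rule bundle_triv_exists)
  have "transition L t t' x * transition L t' t'' x =
      transition L t s x * (transition L s t' x * transition L t' s x) * transition L s t'' x"
    using trivs x s by (simp add: transition_via[of t t' s] transition_via[of t' t'' s])
  also have "\<dots> = transition L t t'' x"
    using trivs x s by (simp add: transition_inverse transition_via[of t t'' s])
  finally show ?thesis .
qed

lemma transition_section:
  assumes trivs: "holo_trivialization t" "holo_trivialization t'"
  shows "transition L t t' \<in> sections (units_sheaf (O_sheaf X A)) (fst t \<inter> fst t')"
  unfolding units_section_iff
proof (intro conjI ballI)
  show op: "openin X (fst t \<inter> fst t')" using holo_trivialization_open trivs by blast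
  fix x assume x: "x \<in> fst t \<inter> fst t'"
  then have "x \<in> topspace X" using op openin_subset by blast
  then obtain s where s: "s \<in> bundle_trivs L" "x \<in> fst s" by (rule bundle_triv_exists)
  have sections: "transition L t s \<in> sections (units_sheaf (O_sheaf X A)) (fst t \<inter> fst s)"
    "transition L s t' \<in> sections (units_sheaf (O_sheaf X A)) (fst s \<inter> fst t')"
    using trivs s unfolding holo_triv_def trivs_compatible_def by blast+
  have "holo_at A (\<lambda>y. transition L t s y * transition L s t' y) x"
    using sections x s by (intro holo_at_mult) (auto simp: units_section_iff)
  then show "holo_at A (transition L t t') x"
  proof (rule holo_at_cong)
    show "openin X (fst t \<inter> fst t' \<inter> fst s)" using op bundle_triv_open[OF s(1)] by blast
  qed (use x s trivs transition_via in auto)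
  show "transition L t t' x \<noteq> 0"
    using sections x s trivs transition_via[of t t' s x] by (auto simp: units_section_iff)
qed

definition triv_family :: "('a \<Rightarrow> 'a set \<times> ('e \<Rightarrow> complex)) \<Rightarrow> bool" where
  "triv_family t \<longleftrightarrow> (\<forall>x\<in>topspace X. holo_trivialization (t x) \<and> x \<in> fst (t x))"

definition triv_cochain :: "('a \<Rightarrow> 'a set \<times> ('e \<Rightarrow> complex)) \<Rightarrow> ('a, complex) cochain" where
  "triv_cochain t = (\<lambda>x. fst (t x), \<lambda>x y. transition L (t x) (t y))"

lemma triv_cochain_cocycle:
  assumes "triv_family t"
  shows "triv_cochain t \<in> cocycles X (units_sheaf (O_sheaf X A))"
  using assms holo_trivialization_open transition_section transition_cocycle
  unfolding triv_family_def triv_cochain_def cocycles_def by (auto simp: mult_complex_def)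

lemma triv_cochain_cohomologous:
  assumes t: "triv_family t" and t': "triv_family t'"
  shows "(triv_cochain t, triv_cochain t') \<in> cohomologous X (units_sheaf (O_sheaf X A))"
  unfolding triv_cochain_def
proof (rule units.cohomologousI, intro coboundary.intro units.ab_sheaf_axioms coboundary_axioms.intro)
  show "(\<lambda>x. fst (t x), \<lambda>x y. transition L (t x) (t y)) \<in> cocycles X (units_sheaf (O_sheaf X A))"
    "(\<lambda>x. fst (t' x), \<lambda>x y. transition L (t' x) (t' y)) \<in> cocycles X (units_sheaf (O_sheaf X A))"
    using triv_cochain_cocycle[OF t] triv_cochain_cocycle[OF t'] by (simp_all add: triv_cochain_def)
  have trivs: "holo_trivialization (t x)" "holo_trivialization (t' x)" "x \<in> fst (t x) \<inter> fst (t' x)"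
    if "x \<in> topspace X" for x
    using t t' that unfolding triv_family_def by auto
  fix x assume x: "x \<in> topspace X"
  show "openin X (fst (t x) \<inter> fst (t' x))"
    using trivs[OF x] holo_trivialization_open by blast
  show "transition L (t x) (t' x) \<in> sections (units_sheaf (O_sheaf X A)) (fst (t x) \<inter> fst (t' x))"
    by (rule transition_section[OF trivs(1,2)[OF x]])
  show "x \<in> fst (t x) \<inter> fst (t' x)" by (rule trivs(3)[OF x])
  fix y p assume "y \<in> topspace X" "p \<in> fst (t x) \<inter> fst (t' x) \<inter> (fst (t y) \<inter> fst (t' y))"
  then show "transition L (t x) (t' x) p \<otimes>\<^bsub>vals (units_sheaf (O_sheaf X A)) p\<^esub> transition L (t' x) (t' y) p =
      transition L (t x) (t y) p \<otimes>\<^bsub>vals (units_sheaf (O_sheaf X A)) p\<^esub> transition L (t y) (t' y) p"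
    using trivs x transition_cocycle by (simp add: mult_complex_def)
qed simp

lemma bundle_class_eq:
  assumes "triv_family t"
  shows "bundle_class X (O_sheaf X A) L = coh_class X (units_sheaf (O_sheaf X A)) (triv_cochain t)"
proof -
  have "bundle_class X (O_sheaf X A) L =
      (\<Union>t\<in>{t. triv_family t}. coh_class X (units_sheaf (O_sheaf X A)) (triv_cochain t))"
    by (simp add: bundle_class_def triv_family_def triv_cochain_def)
  also have "\<dots> = coh_class X (units_sheaf (O_sheaf X A)) (triv_cochain t)"
    using assms triv_cochain_cohomologous by (intro units.UN_coh_class) auto
  finally show ?thesis .
qed

lemma weight_pos: "hermitian_metric L h \<Longrightarrow> t \<in> bundle_trivs L \<Longrightarrow> x \<in> fst t \<Longrightarrow> weight L h t x > 0"
  unfolding hermitian_metric_def by blast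

lemma square_norm_eq_weight:
  assumes h: "hermitian_metric L h" and t: "t \<in> bundle_trivs L" "x \<in> fst t" and e: "e \<in> over L {x}"
  shows "Re (h e e) = weight L h t x * (cmod (snd t e))\<^sup>2"
proof -
  have "h e e = of_real (weight L h t x) * snd t e * cnj (snd t e)"
    using h t e unfolding hermitian_metric_def by blast
  also have "\<dots> = of_real (weight L h t x * (cmod (snd t e))\<^sup>2)"
    using complex_norm_square[of "snd t e"] by simp
  finally show ?thesis by simp
qed

lemma weight_transition:
  assumes "hermitian_metric L h" and "t \<in> bundle_trivs L" "x \<in> fst t"
    and t': "t' \<in> bundle_trivs L" "x \<in> fst t'"
  shows "weight L h t' x = weight L h t x * (cmod (transition L t t' x))\<^sup>2"
  unfolding weight_def[of L h t'] transition_def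
  by (rule square_norm_eq_weight[OF assms(1-3)])
    (rule local_frame_over[OF holo_trivialization_local[OF bundle_triv_holo[OF t'(1)]] t'(2)])

end

subsection \<open>The Ueda cocycle\<close>

locale holomorphic_bundle_subset = holomorphic_atlas_subset X A Y + holomorphic_bundle X A L
  for X :: "'a topology" and A :: "('a, 'n::finite) chart set" and Y :: "'a set"
    and L :: "('a, 'e) line_bundle"
begin

sublocale dlog: sheaf_operator X "units_sheaf (O_sheaf X A)" "dO_sheaf X A" "dlog A"
  by (rule sheaf_operator_dlog)

sublocale dlog_germs: sheaf_hom X\<^sub>Y "inverse_image X Y (units_sheaf (O_sheaf X A))"
    "inverse_image X Y (dO_sheaf X A)" "\<lambda>p a. \<Union>f\<in>a. germ X p (dlog A f)"
  by (rule dlog.sheaf_hom_inverse_image[OF Y_subset])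

sublocale exact_forms_inclusion: sheaf_hom X\<^sub>Y "inverse_image X Y (dO_sheaf X A)"
    "inverse_image X Y (Omega1 X A)" "\<lambda>p m. m"
  by (rule sheaf_hom_inverse_image_inclusion[OF ab_sheaf_dO ab_sheaf_Omega1 Y_subset _ dO_subset_Omega1])
    simp

sublocale to_pullback: sheaf_hom X\<^sub>Y "inverse_image X Y (Omega1 X A)"
    "module_pullback X A Y (Omega1 X A)" "\<lambda>p m. \<Omega>.tens p m (germ X\<^sub>Y p (\<lambda>x. 1))"
  by (rule \<Omega>.sheaf_hom_module_pullback)

definition ueda_cochain where
  "ueda_cochain t = map_cochain (\<lambda>p m. \<Omega>.tens p m (germ X\<^sub>Y p (\<lambda>x. 1)))
     (map_cochain (\<lambda>p m. m) (map_cochain (\<lambda>p a. \<Union>f\<in>a. germ X p (dlog A f))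
       (units.restrict_cochain Y (triv_cochain t))))"

lemma
  assumes t: "triv_family t"
  shows ueda_cochain_cocycle: "ueda_cochain t \<in> cocycles X\<^sub>Y (module_pullback X A Y (Omega1 X A))"
    and ueda_class_eq: "ueda_class X A Y L = coh_class X\<^sub>Y (module_pullback X A Y (Omega1 X A)) (ueda_cochain t)"
proof -
  note restricted = units.restrict_cochain_cocycle[OF Y_subset triv_cochain_cocycle[OF t]]
  note dlog = dlog_germs.map_cochain_cocycle[OF restricted]
  note form = exact_forms_inclusion.map_cochain_cocycle[OF dlog]
  show "ueda_cochain t \<in> cocycles X\<^sub>Y (module_pullback X A Y (Omega1 X A))"
    unfolding ueda_cochain_def by (rule to_pullback.map_cochain_cocycle[OF form])
  show "ueda_class X A Y L = coh_class X\<^sub>Y (module_pullback X A Y (Omega1 X A)) (ueda_cochain t)"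
    unfolding ueda_class_def Let_def ueda_cochain_def bundle_class_eq[OF t]
      units.H1_restrict_coh_class[OF Y_subset triv_cochain_cocycle[OF t]]
      dlog_germs.H1_map_coh_class[OF restricted] exact_forms_inclusion.H1_map_coh_class[OF dlog]
      to_pullback.H1_map_coh_class[OF form] ..
qed

lemma fst_ueda_cochain: "fst (ueda_cochain t) = (\<lambda>x. fst (t x) \<inter> Y)"
  by (simp add: ueda_cochain_def map_cochain_def units.restrict_cochain_def triv_cochain_def)

lemma snd_ueda_cochain:
  assumes "p \<in> Y"
  shows "snd (ueda_cochain t) x y p =
    \<Omega>.tens p (germ X p (dlog A (transition L (t x) (t y)))) (germ X\<^sub>Y p (\<lambda>x. 1))"
  using dlog.operator_germ[of p "transition L (t x) (t y)"] assms Y_subset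
  by (auto simp: ueda_cochain_def map_cochain_def units.restrict_cochain_def triv_cochain_def)

subsection \<open>Square norms of flat frames\<close>

abbreviation "L\<^sub>Y \<equiv> restrict_bundle L Y"

text \<open>\<open>F\<close> is the coordinate of a frame over \<open>N\<close> in the trivialization \<open>t\<close>.\<close>

definition frame_with_square_norm ::
    "('e \<Rightarrow> 'e \<Rightarrow> complex) \<Rightarrow> ('a \<Rightarrow> real) \<Rightarrow> 'a set \<times> ('e \<Rightarrow> complex) \<Rightarrow> 'a set \<Rightarrow> ('a \<Rightarrow> complex) \<Rightarrow> bool" where
  "frame_with_square_norm h G t N F \<longleftrightarrow> t \<in> bundle_trivs L \<and> openin X N \<and> N \<subseteq> fst t \<and>
     (\<forall>p\<in>N. holo_at A F p \<and> F p \<noteq> 0) \<and> (\<forall>p\<in>N \<inter> Y. G p = weight L h t p * (cmod (F p))\<^sup>2)"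

lemma over_restrict_bundle: "x \<in> Y \<Longrightarrow> over L\<^sub>Y {x} = over L {x}"
  by (auto simp: over_def restrict_bundle_def)

lemma restrict_bundle_triv: "s \<in> bundle_trivs L \<Longrightarrow> (fst s \<inter> Y, snd s) \<in> bundle_trivs L\<^sub>Y"
  by (force simp: restrict_bundle_def)

end

locale unitary_trivializations = holomorphic_bundle_subset X A Y L
  for X :: "'a topology" and A :: "('a, 'n::finite) chart set" and Y :: "'a set"
    and L :: "('a, 'e) line_bundle" +
  fixes \<T> :: "('a set \<times> ('e \<Rightarrow> complex)) set"
  assumes holo_triv: "t \<in> \<T> \<Longrightarrow> holo_triv X\<^sub>Y O\<^sub>Y L\<^sub>Y t"
    and cover: "y \<in> Y \<Longrightarrow> \<exists>t\<in>\<T>. y \<in> fst t"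
    and cmod_transition: "t \<in> \<T> \<Longrightarrow> t' \<in> \<T> \<Longrightarrow> y \<in> fst t \<inter> fst t' \<Longrightarrow> cmod (transition L\<^sub>Y t t' y) = 1"
begin

abbreviation "frame \<equiv> local_frame L\<^sub>Y"

lemma frame_over:
  assumes "t \<in> \<T>" "y \<in> fst t" "y \<in> Y"
  shows "frame t y \<in> over L {y}"
  using local_frame_over[of X\<^sub>Y L\<^sub>Y t y] holo_triv[OF assms(1)] assms over_restrict_bundle
  by (simp add: holo_triv_def)

lemma cmod_frame_coordinate_eq:
  assumes t: "t \<in> \<T>" "y \<in> fst t" and t': "t' \<in> \<T>" "y \<in> fst t'"
    and s: "s \<in> bundle_trivs L" "y \<in> fst s" and y: "y \<in> Y"
  shows "cmod (snd s (frame t y)) = cmod (snd s (frame t' y))"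
proof -
  have "trivs_compatible O\<^sub>Y L\<^sub>Y (fst s \<inter> Y, snd s) t"
    using holo_triv[OF t(1)] restrict_bundle_triv[OF s(1)] unfolding holo_triv_def by blast
  from coordinate_eq_transition_mult[OF this, of "frame t' y" y]
  have "snd s (frame t' y) = snd s (frame t y) * transition L\<^sub>Y t t' y"
    using frame_over[OF t' y] over_restrict_bundle[OF y] s(2) t(2) y by (simp add: transition_def)
  then show ?thesis
    using cmod_transition[OF t(1) t'(1)] t(2) t'(2) by (simp add: norm_mult)
qed

definition flat_square_norm :: "('e \<Rightarrow> 'e \<Rightarrow> complex) \<Rightarrow> 'a \<Rightarrow> real" where
  "flat_square_norm h y = (let e = frame (SOME t. t \<in> \<T> \<and> y \<in> fst t) y in Re (h e e))"

lemma flat_square_norm_eq: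
  assumes h: "hermitian_metric L h" and t: "t \<in> \<T>" "y \<in> fst t"
    and s: "s \<in> bundle_trivs L" "y \<in> fst s" and y: "y \<in> Y"
  shows "flat_square_norm h y = weight L h s y * (cmod (snd s (frame t y)))\<^sup>2"
proof -
  define t' where "t' = (SOME t. t \<in> \<T> \<and> y \<in> fst t)"
  have "\<exists>t. t \<in> \<T> \<and> y \<in> fst t" using cover[OF y] by blast
  then have t': "t' \<in> \<T>" "y \<in> fst t'" unfolding t'_def by (rule someI2_ex, blast)+
  show ?thesis
    using square_norm_eq_weight[OF h s frame_over[OF t' y]] cmod_frame_coordinate_eq[OF t' t s y]
    by (simp add: flat_square_norm_def Let_def t'_def)
qed

lemma frame_coordinate_holomorphic:
  assumes t: "t \<in> \<T>" "y \<in> fst t" and s: "s \<in> bundle_trivs L" "y \<in> fst s" and y: "y \<in> Y"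
  obtains N F where "openin X N" "y \<in> N" "N \<subseteq> fst s" "N \<inter> Y \<subseteq> fst t"
    "\<And>p. p \<in> N \<Longrightarrow> holo_at A F p \<and> F p \<noteq> 0" "\<And>p. p \<in> N \<inter> Y \<Longrightarrow> snd s (frame t p) = F p"
proof -
  let ?D = "fst s \<inter> Y \<inter> fst t"
  have "trivs_compatible O\<^sub>Y L\<^sub>Y (fst s \<inter> Y, snd s) t"
    using holo_triv[OF t(1)] restrict_bundle_triv[OF s(1)] unfolding holo_triv_def by blast
  then have "(\<lambda>p. snd s (frame t p)) \<in> sections (units_sheaf O\<^sub>Y) ?D"
    by (simp add: trivs_compatible_def transition_def[abs_def])
  then have coordinate: "(\<lambda>p. snd s (frame t p)) \<in> sections O\<^sub>Y ?D" "snd s (frame t y) \<noteq> 0"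
    using t s y by (auto simp: units_sheaf_def)
  obtain U F where U: "openin X U" "y \<in> U" "\<And>x. x \<in> U \<Longrightarrow> holo_at A F x"
      and F: "\<And>x. x \<in> U \<inter> ?D \<Longrightarrow> snd s (frame t x) = F x"
    by (rule O_sub_sectionE[OF coordinate(1), of y]) (use t s y in blast)+
  have "openin X\<^sub>Y (fst t)"
    using holo_triv[OF t(1)] local_triv_open unfolding holo_triv_def by blast
  then obtain M where M: "openin X M" "fst t = M \<inter> Y" by (auto simp: openin_subtopology)
  define N where "N = {x \<in> U. F x \<in> - {0}} \<inter> M \<inter> fst s"
  show thesis
  proof (rule that[of N F])
    have "openin X {x \<in> U. F x \<in> - {0}}"
      by (rule openin_holo_preimage[OF U(1,3)]) auto
    then show "openin X N" unfolding N_def using M(1) bundle_triv_open[OF s(1)] by blast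
    show "y \<in> N" using U(2) F[of y] coordinate(2) t s y M(2) by (auto simp: N_def)
  qed (use U(3) F M(2) in \<open>auto simp: N_def\<close>)
qed

lemma flat_square_norm_frame:
  assumes h: "hermitian_metric L h" and y: "y \<in> Y" and s: "s \<in> bundle_trivs L" "y \<in> fst s"
  shows "\<exists>N F. frame_with_square_norm h (flat_square_norm h) s N F \<and> y \<in> N"
proof -
  obtain t where t: "t \<in> \<T>" "y \<in> fst t" using cover[OF y] by blast
  obtain N F where N: "openin X N" "y \<in> N" "N \<subseteq> fst s" "N \<inter> Y \<subseteq> fst t"
      "\<And>p. p \<in> N \<Longrightarrow> holo_at A F p \<and> F p \<noteq> 0" "\<And>p. p \<in> N \<inter> Y \<Longrightarrow> snd s (frame t p) = F p"
    using t s y by (rule frame_coordinate_holomorphic) blast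
  have "flat_square_norm h p = weight L h s p * (cmod (F p))\<^sup>2" if "p \<in> N \<inter> Y" for p
    using flat_square_norm_eq[OF h t(1) _ s(1), of p] N(3,4,6) that by auto
  then show ?thesis
    unfolding frame_with_square_norm_def using N s by blast
qed

end

lemma (in holomorphic_bundle_subset) unitary_flat_trivializations:
  assumes "unitary_flat X\<^sub>Y O\<^sub>Y L\<^sub>Y"
  obtains \<T> where "unitary_trivializations X A Y L \<T>"
proof -
  obtain \<T> where "\<forall>t\<in>\<T>. holo_triv X\<^sub>Y O\<^sub>Y L\<^sub>Y t" "\<forall>x\<in>topspace X\<^sub>Y. \<exists>t\<in>\<T>. x \<in> fst t"
    "\<forall>t\<in>\<T>. \<forall>t'\<in>\<T>. \<forall>x\<in>fst t \<inter> fst t'. cmod (transition L\<^sub>Y t t' x) = 1"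
    using assms unfolding unitary_flat_def by blast
  then have "unitary_trivializations X A Y L \<T>"
    using topspace_subset by unfold_locales auto
  then show thesis by (rule that)
qed

section \<open>The Levi form\<close>

subsection \<open>Functions of class C2\<close>

definition C2_on :: "'v::real_normed_vector set \<Rightarrow> ('v \<Rightarrow> real) \<Rightarrow> bool" where
  "C2_on S u \<longleftrightarrow> (\<forall>z\<in>S. u differentiable (at z)) \<and>
     (\<forall>v. \<forall>z\<in>S. (\<lambda>z. frechet_derivative u (at z) v) differentiable (at z))"

definition hessian :: "('v::real_normed_vector \<Rightarrow> real) \<Rightarrow> 'v \<Rightarrow> 'v \<Rightarrow> 'v \<Rightarrow> real" where
  "hessian u z v w = frechet_derivative (\<lambda>z. frechet_derivative u (at z) v) (at z) w"

lemma C2_on_has_derivative: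
  "C2_on S u \<Longrightarrow> z \<in> S \<Longrightarrow> (u has_derivative frechet_derivative u (at z)) (at z)"
  by (simp add: C2_on_def flip: frechet_derivative_works)

lemma C2_on_has_derivative_hessian:
  assumes "C2_on S u" "z \<in> S"
  shows "((\<lambda>z. frechet_derivative u (at z) v) has_derivative hessian u z v) (at z)"
proof -
  have "(\<lambda>z. frechet_derivative u (at z) v) differentiable (at z)"
    using assms by (simp add: C2_on_def)
  then show ?thesis
    unfolding frechet_derivative_works hessian_def[abs_def] .
qed

lemma C2_on_subset: "C2_on S u \<Longrightarrow> T \<subseteq> S \<Longrightarrow> C2_on T u"
  by (auto simp: C2_on_def)

lemma Cr_on_imp_C2_on:
  assumes "Cr_on r S w" "2 \<le> r"
  shows "C2_on S w"
proof -
  obtain k where "r = Suc (Suc k)" using assms(2) by (metis add_2_eq_Suc le_Suc_ex)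
  then show ?thesis using assms(1) by (simp add: C2_on_def)
qed

lemma C2_on_ln:
  assumes S: "open S" and w: "C2_on S w" and pos: "\<And>z. z \<in> S \<Longrightarrow> w z > 0"
  shows "C2_on S (\<lambda>z. ln (w z))"
proof -
  have ln: "((\<lambda>z. ln (w z)) has_derivative (\<lambda>v. frechet_derivative w (at z) v / w z)) (at z)" if "z \<in> S" for z
    using C2_on_has_derivative[OF w that] pos[OF that]
    by (auto intro!: derivative_eq_intros simp: divide_inverse mult.commute)
  have "(\<lambda>z. frechet_derivative (\<lambda>z. ln (w z)) (at z) v) differentiable (at z)" if z: "z \<in> S" for v z
  proof -
    have "(\<lambda>z. frechet_derivative w (at z) v / w z) differentiable (at z)"
      using w z pos[OF z] by (intro differentiable_divide) (auto simp: C2_on_def)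
    then obtain D where "((\<lambda>z. frechet_derivative w (at z) v / w z) has_derivative D) (at z)"
      by (auto simp: differentiable_def)
    then have "((\<lambda>z. frechet_derivative (\<lambda>z. ln (w z)) (at z) v) has_derivative D) (at z)"
      by (rule has_derivative_transform_within_open[OF _ S z])
        (rule fun_cong[OF frechet_derivative_at[OF ln]])
    then show ?thesis by (rule differentiableI)
  qed
  moreover have "(\<lambda>z. ln (w z)) differentiable (at z)" if "z \<in> S" for z
    using ln[OF that] by (rule differentiableI)
  ultimately show ?thesis unfolding C2_on_def by blast
qed

lemma has_laplacian_hessian:
  fixes u :: "complex^'n::finite \<Rightarrow> real"
  assumes S: "open S" "z + \<zeta> *s v \<in> S" and u: "C2_on S u"
  shows "has_laplacian (\<lambda>\<xi>. u (z + \<xi> *s v))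
    (hessian u (z + \<zeta> *s v) v v + hessian u (z + \<zeta> *s v) (\<i> *s v) (\<i> *s v)) \<zeta>"
proof (rule has_laplacian_complex_line[where H = "hessian u (z + \<zeta> *s v)"])
  show "\<forall>\<^sub>F w in nhds (z + \<zeta> *s v). (u has_derivative frechet_derivative u (at w)) (at w)"
    using S by (intro eventually_nhds[THEN iffD2] exI[of _ S]) (auto intro: C2_on_has_derivative[OF u])
qed (rule C2_on_has_derivative_hessian[OF u S(2)])

subsection \<open>Wirtinger derivatives\<close>

lemma linear_axis_expansion:
  fixes K :: "complex^'n::finite \<Rightarrow> complex"
  assumes "linear K"
  shows "K v = (\<Sum>i\<in>UNIV. Re (v $ i) *\<^sub>R K (axis i 1) + Im (v $ i) *\<^sub>R K (axis i \<i>))"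
proof -
  have "axis i (v $ i) = Re (v $ i) *\<^sub>R axis i 1 + Im (v $ i) *\<^sub>R (axis i \<i> :: complex^'n)" for i
    by (simp add: vec_eq_iff axis_def complex_eq_iff)
  then have "K (axis i (v $ i)) = Re (v $ i) *\<^sub>R K (axis i 1) + Im (v $ i) *\<^sub>R K (axis i \<i>)" for i
    using assms by (simp add: linear_add linear_scale)
  moreover have "K v = (\<Sum>i\<in>UNIV. K (axis i (v $ i)))"
    using linear_sum[OF assms, of "\<lambda>i. axis i (v $ i)" UNIV] by (simp add: sum_axis_nth)
  ultimately show ?thesis by simp
qed

lemma wirtinger_eq:
  assumes "(f has_derivative D) (at z)"
  shows "wirtinger i f z = (D (axis i 1) - \<i> * D (axis i \<i>)) / 2"
  unfolding wirtinger_def frechet_derivative_at[OF assms, symmetric] ..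

lemma wirtinger_bar_eq:
  assumes "(f has_derivative D) (at z)"
  shows "wirtinger_bar i f z = (D (axis i 1) + \<i> * D (axis i \<i>)) / 2"
  unfolding wirtinger_bar_def frechet_derivative_at[OF assms, symmetric] ..

lemma sum_mult_wirtinger:
  assumes D: "(f has_derivative D) (at z)"
  shows "(\<Sum>i\<in>UNIV. v $ i * wirtinger i f z) = (D v - \<i> * D (\<i> *s v)) / 2"
  unfolding wirtinger_eq[OF D] linear_axis_expansion[OF has_derivative_linear[OF D], of v]
    linear_axis_expansion[OF has_derivative_linear[OF D], of "\<i> *s v"]
    sum_distrib_left sum_subtractf[symmetric] sum_divide_distrib
  by (rule sum.cong) (auto simp: complex_eq_iff algebra_simps)

lemma sum_cnj_mult_wirtinger_bar:
  assumes D: "(f has_derivative D) (at z)"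
  shows "(\<Sum>i\<in>UNIV. cnj (v $ i) * wirtinger_bar i f z) = (D v + \<i> * D (\<i> *s v)) / 2"
  unfolding wirtinger_bar_eq[OF D] linear_axis_expansion[OF has_derivative_linear[OF D], of v]
    linear_axis_expansion[OF has_derivative_linear[OF D], of "\<i> *s v"]
    sum_distrib_left sum.distrib[symmetric] sum_divide_distrib
  by (rule sum.cong) (auto simp: complex_eq_iff algebra_simps)

lemma wirtinger_add:
  assumes "(f has_derivative D) (at z)" "(g has_derivative E) (at z)"
  shows "wirtinger i (\<lambda>w. f w + g w) z = wirtinger i f z + wirtinger i g z"
  unfolding wirtinger_eq[OF has_derivative_add[OF assms]] wirtinger_eq[OF assms(1)] wirtinger_eq[OF assms(2)]
  by (simp add: field_simps)

lemma wirtinger_sum_mult: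
  assumes D: "\<And>j. j \<in> J \<Longrightarrow> (f j has_derivative D j) (at z)"
  shows "wirtinger i (\<lambda>w. \<Sum>j\<in>J. a j * f j w) z = (\<Sum>j\<in>J. a j * wirtinger i (f j) z)"
proof -
  have "((\<lambda>w. \<Sum>j\<in>J. a j * f j w) has_derivative (\<lambda>v. \<Sum>j\<in>J. a j * D j v)) (at z)"
    by (intro has_derivative_sum has_derivative_mult_right D)
  moreover have "(\<Sum>j\<in>J. a j * wirtinger i (f j) z) =
      (\<Sum>j\<in>J. a j * ((D j (axis i 1) - \<i> * D j (axis i \<i>)) / 2))"
    by (intro sum.cong refl) (simp add: wirtinger_eq[OF D])
  ultimately show ?thesis
    by (simp add: wirtinger_eq sum_distrib_left sum_subtractf[symmetric] sum_divide_distrib algebra_simps)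
qed

lemma wirtinger_cong:
  assumes D: "(f has_derivative D) (at z)" and N: "open N" "z \<in> N" "\<And>w. w \<in> N \<Longrightarrow> f w = g w"
  shows "wirtinger i f z = wirtinger i g z"
  by (rule trans[OF wirtinger_eq[OF D] wirtinger_eq[OF has_derivative_transform_within_open[OF D N], symmetric]])

lemma wirtinger_compose_holomorphic:
  fixes J :: "complex^'n::finite^'m::finite"
  assumes f: "(f has_derivative D) (at (g z))"
    and g: "(g has_derivative (\<lambda>v. \<chi> i. \<Sum>k\<in>UNIV. v $ k * J $ i $ k)) (at z)"
  shows "wirtinger k (\<lambda>w. f (g w)) z = (\<Sum>i\<in>UNIV. J $ i $ k * wirtinger i f (g z))"
proof -
  define v where "v = (\<chi> i. J $ i $ k)"
  have "(\<Sum>l\<in>UNIV. axis k s $ l * J $ i $ l) = (\<Sum>l\<in>UNIV. if l = k then s * J $ i $ k else 0)" for s i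
    by (intro sum.cong) (auto simp: axis_def)
  then have axis: "(\<chi> i. \<Sum>l\<in>UNIV. axis k s $ l * J $ i $ l) = s *s v" for s
    by (simp add: vec_eq_iff v_def)
  have "wirtinger k (\<lambda>w. f (g w)) z = (D v - \<i> * D (\<i> *s v)) / 2"
    unfolding wirtinger_eq[OF has_derivative_compose[OF g f]] axis by simp
  then show ?thesis
    unfolding sum_mult_wirtinger[OF f, symmetric] by (simp add: v_def)
qed

lemma wirtinger_ln_norm_square:
  assumes g: "cdiff_at g z" and nz: "g z \<noteq> 0"
  obtains D where "((\<lambda>w. complex_of_real (ln ((cmod (g w))\<^sup>2))) has_derivative D) (at z)"
    "\<And>i. wirtinger i (\<lambda>w. of_real (ln ((cmod (g w))\<^sup>2))) z = cpartial i g z / g z"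
proof -
  obtain E where E: "(g has_derivative E) (at z)" and smult: "\<And>c v. E (c *s v) = c * E v"
    using g by (rule cdiff_atE) blast
  have pos: "(Re (g z))\<^sup>2 + (Im (g z))\<^sup>2 > 0"
    using nz by (simp add: complex_neq_0)
  have "((\<lambda>w. ln ((Re (g w))\<^sup>2 + (Im (g w))\<^sup>2)) has_derivative (\<lambda>v. 2 * Re (E v / g z))) (at z)"
    by (rule derivative_eq_intros has_derivative_Re[OF E] has_derivative_Im[OF E] pos refl)+
      (use pos in \<open>auto simp: fun_eq_iff Re_divide' cmod_power2 field_simps\<close>)
  then have deriv: "((\<lambda>w. complex_of_real (ln ((cmod (g w))\<^sup>2))) has_derivative
      (\<lambda>v. of_real (2 * Re (E v / g z)))) (at z)"
    unfolding cmod_power2 by (rule has_derivative_of_real)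
  have imaginary: "E (axis i \<i>) / g z = \<i> * (E (axis i 1) / g z)" for i
    by (subst axis_eq_smult_axis) (simp only: smult times_divide_eq_right)
  have "wirtinger i (\<lambda>w. of_real (ln ((cmod (g w))\<^sup>2))) z = E (axis i 1) / g z" for i
    unfolding wirtinger_eq[OF deriv] imaginary by (simp add: complex_eq_iff del: times_divide_eq_right)
  with deriv show thesis
    by (intro that) (simp_all add: cpartial_eq[OF E smult])
qed

subsection \<open>Hermitian forms\<close>

definition sesquilinear :: "complex^'n::finite^'n \<Rightarrow> complex^'n \<Rightarrow> complex^'n \<Rightarrow> complex" where
  "sesquilinear C v w = (\<Sum>i\<in>UNIV. \<Sum>j\<in>UNIV. C $ i $ j * (v $ i) * cnj (w $ j))"

lemma sesquilinear_add_left: "sesquilinear C (v + v') w = sesquilinear C v w + sesquilinear C v' w"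
  by (simp add: sesquilinear_def sum.distrib[symmetric] algebra_simps)

lemma sesquilinear_add_right: "sesquilinear C v (w + w') = sesquilinear C v w + sesquilinear C v w'"
  by (simp add: sesquilinear_def sum.distrib[symmetric] algebra_simps)

lemma sesquilinear_smult_left: "sesquilinear C (a *s v) w = a * sesquilinear C v w"
  by (simp add: sesquilinear_def sum_distrib_left mult_ac)

lemma sesquilinear_smult_right: "sesquilinear C v (a *s w) = cnj a * sesquilinear C v w"
  by (simp add: sesquilinear_def sum_distrib_left mult_ac)

lemma sesquilinear_minus: "sesquilinear (- C) v w = - sesquilinear C v w"
  by (simp add: sesquilinear_def sum_negf)

lemma sesquilinear_axis: "sesquilinear C (axis i 1) (axis j 1) = C $ i $ j"
proof -
  have "(\<Sum>l\<in>UNIV. C $ k $ l * axis i 1 $ k * cnj (axis j 1 $ l)) =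
      (\<Sum>l\<in>UNIV. if l = j then C $ k $ l * axis i 1 $ k else 0)" for k
    by (intro sum.cong) (auto simp: axis_def)
  then have "sesquilinear C (axis i 1) (axis j 1) = (\<Sum>k\<in>UNIV. C $ k $ j * axis i 1 $ k)"
    by (simp add: sesquilinear_def)
  also have "\<dots> = (\<Sum>k\<in>UNIV. if k = i then C $ k $ j else 0)"
    by (intro sum.cong) (auto simp: axis_def)
  finally show ?thesis by simp
qed

definition semipositive :: "complex^'n::finite^'n \<Rightarrow> bool" where
  "semipositive C \<longleftrightarrow> (\<forall>v. sesquilinear C v v \<in> \<real> \<and> Re (sesquilinear C v v) \<ge> 0)"

lemma semipositive_null_vector:
  assumes C: "semipositive C" and null: "sesquilinear C v v = 0"
  shows "sesquilinear C v w = 0"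
proof (rule ccontr)
  define a where "a = sesquilinear C v w"
  define b where "b = sesquilinear C w v"
  define d where "d = sesquilinear C w w"
  assume "sesquilinear C v w \<noteq> 0"
  then have a: "a \<noteq> 0" by (simp add: a_def)
  have expand: "sesquilinear C (s *s v + w) (s *s v + w) = s * a + cnj s * b + d" for s
    by (simp add: sesquilinear_add_left sesquilinear_add_right sesquilinear_smult_left
        sesquilinear_smult_right null a_def b_def d_def algebra_simps)
  have real: "Im (s * a + cnj s * b + d) = 0" and pos: "Re (s * a + cnj s * b + d) \<ge> 0" for s
    using C[unfolded semipositive_def, rule_format, of "s *s v + w"]
    unfolding expand by (auto simp: complex_is_Real_iff)
  have b: "b = cnj a"
    using real[of 0] real[of 1] real[of \<i>] by (simp add: complex_eq_iff)
  define \<tau> where "\<tau> = (Re d + 1) / (2 * (cmod a)\<^sup>2)"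
  have "Re (- of_real \<tau> * cnj a * a + cnj (- of_real \<tau> * cnj a) * b + d) = Re d - 2 * \<tau> * (cmod a)\<^sup>2"
    unfolding b by (simp add: cmod_power2) (simp add: power2_eq_square algebra_simps)
  also have "\<dots> = -1"
    using a by (simp add: \<tau>_def field_simps)
  finally show False using pos[of "- of_real \<tau> * cnj a"] by simp
qed

subsection \<open>The Levi form of a real function\<close>

definition levi_matrix :: "(complex^'n::finite \<Rightarrow> real) \<Rightarrow> complex^'n \<Rightarrow> complex^'n^'n" where
  "levi_matrix u z = (\<chi> i j. wirtinger i (wirtinger_bar j (\<lambda>z. of_real (u z))) z)"

context
  fixes S :: "(complex^'n::finite) set" and u :: "complex^'n \<Rightarrow> real"
  assumes S: "open S" and u: "C2_on S u"
begin

lemma has_derivative_of_real_C2: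
  "z \<in> S \<Longrightarrow> ((\<lambda>w. complex_of_real (u w)) has_derivative (\<lambda>v. of_real (frechet_derivative u (at z) v))) (at z)"
  by (rule has_derivative_of_real[OF C2_on_has_derivative[OF u]])

lemma has_derivative_wirtinger_bar:
  assumes z: "z \<in> S"
  shows "(wirtinger_bar j (\<lambda>w. of_real (u w)) has_derivative
    (\<lambda>w. (of_real (hessian u z (axis j 1) w) + \<i> * of_real (hessian u z (axis j \<i>) w)) / 2)) (at z)"
proof -
  have "((\<lambda>z. (of_real (frechet_derivative u (at z) (axis j 1)) +
      \<i> * of_real (frechet_derivative u (at z) (axis j \<i>))) / 2) has_derivative
      (\<lambda>w. (of_real (hessian u z (axis j 1) w) + \<i> * of_real (hessian u z (axis j \<i>) w)) / 2)) (at z)"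
    using C2_on_has_derivative_hessian[OF u z] by (auto intro!: derivative_eq_intros)
  then show ?thesis
    by (rule has_derivative_transform_within_open[OF _ S z])
      (simp add: wirtinger_bar_eq[OF has_derivative_of_real_C2])
qed

lemma wirtinger_eq_cnj_wirtinger_bar: "z \<in> S \<Longrightarrow> wirtinger j (\<lambda>w. of_real (u w)) z = cnj (wirtinger_bar j (\<lambda>w. of_real (u w)) z)"
  by (simp add: wirtinger_eq[OF has_derivative_of_real_C2] wirtinger_bar_eq[OF has_derivative_of_real_C2])

lemma has_derivative_wirtinger:
  assumes z: "z \<in> S"
  obtains D where "(wirtinger j (\<lambda>w. of_real (u w)) has_derivative D) (at z)"
proof -
  have "((\<lambda>w. cnj (wirtinger_bar j (\<lambda>w. of_real (u w)) w)) has_derivative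
      (\<lambda>w. cnj ((of_real (hessian u z (axis j 1) w) + \<i> * of_real (hessian u z (axis j \<i>) w)) / 2))) (at z)"
    by (rule has_derivative_cnj[OF has_derivative_wirtinger_bar[OF z]])
  then show thesis
    by (rule that[OF has_derivative_transform_within_open[OF _ S z]]) (simp add: wirtinger_eq_cnj_wirtinger_bar)
qed

lemma wirtinger_bar_wirtinger:
  assumes z: "z \<in> S"
  shows "wirtinger_bar i (wirtinger j (\<lambda>w. of_real (u w))) z = cnj (levi_matrix u z $ i $ j)"
proof -
  note bar = has_derivative_wirtinger_bar[OF z, of j]
  from has_derivative_transform_within_open[OF has_derivative_cnj[OF bar] S z, of "wirtinger j (\<lambda>w. of_real (u w))"]
  show ?thesis
    by (simp add: wirtinger_eq_cnj_wirtinger_bar wirtinger_bar_eq levi_matrix_def wirtinger_eq[OF bar])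
qed

lemma Re_levi_form:
  assumes z: "z \<in> S"
  shows "Re (sesquilinear (levi_matrix u z) v v) = (hessian u z v v + hessian u z (\<i> *s v) (\<i> *s v)) / 4"
proof -
  define g where "g w = (\<Sum>j\<in>UNIV. cnj (v $ j) * wirtinger_bar j (\<lambda>w. of_real (u w)) w)" for w
  have "((\<lambda>w. (of_real (frechet_derivative u (at w) v) +
      \<i> * of_real (frechet_derivative u (at w) (\<i> *s v))) / 2) has_derivative
      (\<lambda>w. (of_real (hessian u z v w) + \<i> * of_real (hessian u z (\<i> *s v) w)) / 2)) (at z)"
    using C2_on_has_derivative_hessian[OF u z] by (auto intro!: derivative_eq_intros)
  then have g: "(g has_derivative
      (\<lambda>w. (of_real (hessian u z v w) + \<i> * of_real (hessian u z (\<i> *s v) w)) / 2)) (at z)"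
    by (rule has_derivative_transform_within_open[OF _ S z])
      (simp add: g_def sum_cnj_mult_wirtinger_bar[OF has_derivative_of_real_C2])
  have "sesquilinear (levi_matrix u z) v v =
      (\<Sum>i\<in>UNIV. v $ i * (\<Sum>j\<in>UNIV. cnj (v $ j) * wirtinger i (wirtinger_bar j (\<lambda>w. of_real (u w))) z))"
    by (simp add: sesquilinear_def levi_matrix_def sum_distrib_left mult_ac)
  also have "\<dots> = (\<Sum>i\<in>UNIV. v $ i * wirtinger i g z)"
    unfolding g_def[abs_def] wirtinger_sum_mult[OF has_derivative_wirtinger_bar[OF z]] ..
  finally have "Re (sesquilinear (levi_matrix u z) v v) = Re (\<Sum>i\<in>UNIV. v $ i * wirtinger i g z)"
    by (rule arg_cong)
  then show ?thesis
    unfolding sum_mult_wirtinger[OF g] by simp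
qed

end

section \<open>Flat frames over compact submanifolds\<close>

subsection \<open>Slice charts\<close>

definition coord_slice :: "'n set \<Rightarrow> (complex^'n::finite) set" where
  "coord_slice I = {z. \<forall>i\<in>I. z $ i = 0}"

lemma coord_slice_line: "z \<in> coord_slice I \<Longrightarrow> v \<in> coord_slice I \<Longrightarrow> z + c *s v \<in> coord_slice I"
  by (simp add: coord_slice_def)

lemma coord_slice_diff: "z \<in> coord_slice I \<Longrightarrow> w \<in> coord_slice I \<Longrightarrow> z - w \<in> coord_slice I"
  by (simp add: coord_slice_def)

lemma axis_in_coord_slice: "i \<notin> I \<Longrightarrow> axis i c \<in> coord_slice I"
  by (auto simp: coord_slice_def axis_def)

lemma convex_coord_slice: "convex (coord_slice I)"
  by (auto simp: convex_def coord_slice_def)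

locale holomorphic_submanifold = holomorphic_atlas_subset X A Y
  for X :: "'a topology" and A :: "('a, 'n::finite) chart set" and Y :: "'a set" +
  assumes submanifold: "complex_submanifold X A Y"
begin

definition slice_chart :: "'a set \<Rightarrow> ('a \<Rightarrow> complex^'n) \<Rightarrow> 'n set \<Rightarrow> bool" where
  "slice_chart W \<phi> I \<longleftrightarrow> (W, \<phi>) \<in> A \<and> \<phi> ` (W \<inter> Y) = \<phi> ` W \<inter> coord_slice I"

lemma slice_chart_exists:
  assumes "y \<in> Y"
  obtains W \<phi> I where "slice_chart W \<phi> I" "y \<in> W"
proof -
  have "\<exists>(W, \<phi>)\<in>A. \<exists>I. y \<in> W \<and> \<phi> ` (W \<inter> Y) = {z \<in> \<phi> ` W. \<forall>i\<in>I. z $ i = 0}"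
    using submanifold assms unfolding complex_submanifold_def by blast
  moreover have "{z \<in> \<phi> ` W. \<forall>i\<in>I. z $ i = 0} = \<phi> ` W \<inter> coord_slice I" for \<phi> :: "'a \<Rightarrow> complex^'n" and W I
    by (auto simp: coord_slice_def)
  ultimately show thesis using that unfolding slice_chart_def by auto
qed

lemma slice_chart_chart: "slice_chart W \<phi> I \<Longrightarrow> (W, \<phi>) \<in> A"
  by (simp add: slice_chart_def)

lemma slice_chart_mem_iff:
  assumes "slice_chart W \<phi> I" "p \<in> W"
  shows "p \<in> Y \<longleftrightarrow> \<phi> p \<in> coord_slice I"
proof -
  have "p \<in> Y \<longleftrightarrow> \<phi> p \<in> \<phi> ` (W \<inter> Y)"
    using inj_on_image_mem_iff[OF chart_inj_on[OF slice_chart_chart[OF assms(1)]] assms(2), of "W \<inter> Y"] assms(2)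
    by simp
  then show ?thesis using assms by (simp add: slice_chart_def)
qed

lemma slice_chart_inverse_mem:
  assumes "slice_chart W \<phi> I" "z \<in> \<phi> ` W" "z \<in> coord_slice I"
  shows "inv_into W \<phi> z \<in> Y"
  using assms slice_chart_mem_iff[OF assms(1)] chart_inverse[OF slice_chart_chart[OF assms(1)]] by auto

definition slice_ball :: "'a set \<Rightarrow> ('a \<Rightarrow> complex^'n) \<Rightarrow> 'a \<Rightarrow> real \<Rightarrow> 'a set" where
  "slice_ball W \<phi> y \<rho> = {p \<in> W. \<phi> p \<in> ball (\<phi> y) \<rho>} \<inter> Y"

lemma openin_slice_ball: "(W, \<phi>) \<in> A \<Longrightarrow> openin X\<^sub>Y (slice_ball W \<phi> y \<rho>)"
  unfolding slice_ball_def by (intro openin_Int_Y openin_chart_preimage open_ball)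

lemma chart_ball_exists:
  assumes chart: "(W, \<phi>) \<in> A" "y \<in> W" and N: "openin X N" "y \<in> N"
  obtains \<rho> where "\<rho> > 0" "ball (\<phi> y) \<rho> \<subseteq> \<phi> ` (N \<inter> W)"
  using openE[OF open_chart_image[OF chart(1) N(1)], of "\<phi> y"] chart(2) N(2) by blast

lemma slice_ball_subset:
  assumes "(W, \<phi>) \<in> A" "ball (\<phi> y) \<rho> \<subseteq> \<phi> ` (N \<inter> W)"
  shows "slice_ball W \<phi> y \<rho> \<subseteq> N \<inter> Y"
  using assms chart_inj_on[OF assms(1)] by (fastforce simp: slice_ball_def dest: inj_onD)

lemma slice_ball_eq_image:
  assumes slice: "slice_chart W \<phi> I" and ball: "ball (\<phi> y) \<rho> \<subseteq> \<phi> ` W"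
  shows "slice_ball W \<phi> y \<rho> = inv_into W \<phi> ` (ball (\<phi> y) \<rho> \<inter> coord_slice I)"
proof (intro equalityI subsetI)
  fix p assume "p \<in> slice_ball W \<phi> y \<rho>"
  then have "p \<in> W" "\<phi> p \<in> ball (\<phi> y) \<rho> \<inter> coord_slice I"
    using slice_chart_mem_iff[OF slice] by (auto simp: slice_ball_def)
  then show "p \<in> inv_into W \<phi> ` (ball (\<phi> y) \<rho> \<inter> coord_slice I)"
    using chart_inverse[OF slice_chart_chart[OF slice]] by (metis image_eqI)
next
  fix p assume "p \<in> inv_into W \<phi> ` (ball (\<phi> y) \<rho> \<inter> coord_slice I)"
  then obtain z where z: "z \<in> ball (\<phi> y) \<rho>" "z \<in> coord_slice I" "p = inv_into W \<phi> z" by blast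
  then have "z \<in> \<phi> ` W" using ball by blast
  then show "p \<in> slice_ball W \<phi> y \<rho>"
    using z slice_chart_inverse_mem[OF slice] by (auto simp: slice_ball_def inv_into_into f_inv_into_f)
qed

lemma connectedin_slice_ball:
  assumes slice: "slice_chart W \<phi> I" and ball: "ball (\<phi> y) \<rho> \<subseteq> \<phi> ` W"
  shows "connectedin X\<^sub>Y (slice_ball W \<phi> y \<rho>)"
proof -
  have "connected (ball (\<phi> y) \<rho> \<inter> coord_slice I)"
    by (intro convex_connected convex_Int convex_ball convex_coord_slice)
  then have "connectedin (top_of_set (\<phi> ` W)) (ball (\<phi> y) \<rho> \<inter> coord_slice I)"
    using ball by (auto simp: connectedin_subtopology)
  then have "connectedin X (slice_ball W \<phi> y \<rho>)"
    unfolding slice_ball_eq_image[OF assms]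
    by (rule connectedin_continuous_map_image[OF continuous_map_chart_inverse[OF slice_chart_chart[OF slice]]])
  then show ?thesis by (simp add: connectedin_subtopology slice_ball_def)
qed

lemma locally_connected_space_submanifold: "locally_connected_space X\<^sub>Y"
  unfolding locally_connected_space
proof (intro allI impI, elim conjE)
  fix V y assume V: "openin X\<^sub>Y V" and y: "y \<in> V"
  obtain N where N: "openin X N" "V = N \<inter> Y" using V by (auto simp: openin_subtopology)
  obtain W \<phi> I where slice: "slice_chart W \<phi> I" "y \<in> W" using slice_chart_exists N(2) y by blast
  note chart = slice_chart_chart[OF slice(1)]
  obtain \<rho> where \<rho>: "\<rho> > 0" "ball (\<phi> y) \<rho> \<subseteq> \<phi> ` (N \<inter> W)"
    using chart_ball_exists[OF chart slice(2) N(1)] N(2) y by blast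
  then have "connectedin X\<^sub>Y (slice_ball W \<phi> y \<rho>)"
    by (intro connectedin_slice_ball[OF slice(1)]) blast
  moreover have "y \<in> slice_ball W \<phi> y \<rho>" using y N(2) slice(2) \<rho>(1) by (simp add: slice_ball_def)
  ultimately show "\<exists>U. openin X\<^sub>Y U \<and> connectedin X\<^sub>Y U \<and> y \<in> U \<and> U \<subseteq> V"
    using openin_slice_ball[OF chart] slice_ball_subset[OF chart \<rho>(2)] N(2) by blast
qed

end

subsection \<open>Semi-positive metrics\<close>

locale semipositive_bundle = holomorphic_bundle X A L
  for X :: "'a topology" and A :: "('a, 'n::finite) chart set" and L :: "('a, 'e) line_bundle" +
  fixes h :: "'e \<Rightarrow> 'e \<Rightarrow> complex"
  assumes metric: "hermitian_metric L h"
    and weight_C2: "t \<in> bundle_trivs L \<Longrightarrow> (W, \<phi>) \<in> A \<Longrightarrow>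
      C2_on (\<phi> ` (fst t \<inter> W)) (\<lambda>z. weight L h t (inv_into W \<phi> z))"
    and curvature: "semipositive_curvature A L h"
begin

definition log_weight :: "'a set \<times> ('e \<Rightarrow> complex) \<Rightarrow> ('a, 'n) chart \<Rightarrow> complex^'n \<Rightarrow> real" where
  "log_weight t = (\<lambda>(W, \<phi>) z. ln (weight L h t (inv_into W \<phi> z)))"

lemma open_triv_image: "t \<in> bundle_trivs L \<Longrightarrow> (W, \<phi>) \<in> A \<Longrightarrow> open (\<phi> ` (fst t \<inter> W))"
  by (intro open_chart_image bundle_triv_open)

lemma log_weight_C2:
  assumes t: "t \<in> bundle_trivs L" and chart: "(W, \<phi>) \<in> A"
  shows "C2_on (\<phi> ` (fst t \<inter> W)) (log_weight t (W, \<phi>))"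
  unfolding log_weight_def prod.case
  using chart_inverse[OF chart] weight_pos[OF metric t]
  by (intro C2_on_ln open_triv_image weight_C2 assms) auto

lemma semipositive_levi_matrix_log_weight:
  assumes t: "t \<in> bundle_trivs L" "x \<in> fst t" and chart: "(W, \<phi>) \<in> A" "x \<in> W"
  shows "semipositive (- levi_matrix (log_weight t (W, \<phi>)) (\<phi> x))"
proof -
  have "chern_curvature L h t (W, \<phi>) x = - levi_matrix (log_weight t (W, \<phi>)) (\<phi> x)"
    by (simp add: chern_curvature_def levi_matrix_def log_weight_def vec_eq_iff)
  moreover have "x \<in> fst t \<inter> fst (W, \<phi>)" using t(2) chart(2) by simp
  then have "semipositive (chern_curvature L h t (W, \<phi>) x)"
    using curvature t(1) chart(1)
    unfolding semipositive_curvature_def semipositive_def sesquilinear_def Let_def by blast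
  ultimately show ?thesis by simp
qed

definition log_norm ::
    "'a set \<times> ('e \<Rightarrow> complex) \<Rightarrow> ('a \<Rightarrow> complex) \<Rightarrow> ('a, 'n) chart \<Rightarrow> complex^'n \<Rightarrow> real" where
  "log_norm t F c z = log_weight t c z + ln ((cmod (F (inv_into (fst c) (snd c) z)))\<^sup>2)"

context
  fixes t N F W \<phi>
  assumes t: "t \<in> bundle_trivs L" and N: "openin X N" "N \<subseteq> fst t"
    and F: "\<And>p. p \<in> N \<Longrightarrow> holo_at A F p \<and> F p \<noteq> 0" and chart: "(W, \<phi>) \<in> A"
begin

lemma log_weight_C2_on_frame_domain: "C2_on (\<phi> ` (N \<inter> W)) (log_weight t (W, \<phi>))"
  by (rule C2_on_subset[OF log_weight_C2[OF t chart]]) (use N(2) in blast)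

lemma frame_coordinate_in_chart:
  assumes "z \<in> \<phi> ` (N \<inter> W)"
  shows "cdiff_at (\<lambda>z. F (inv_into W \<phi> z)) z" "F (inv_into W \<phi> z) \<noteq> 0"
  using assms F holo_atD[OF _ chart] chart_inverse[OF chart] by auto

lemma isCont_log_norm:
  assumes z: "z \<in> \<phi> ` (N \<inter> W)"
  shows "isCont (log_norm t F (W, \<phi>)) z"
proof -
  have "isCont (log_weight t (W, \<phi>)) z"
    by (rule has_derivative_continuous[OF C2_on_has_derivative[OF log_weight_C2_on_frame_domain z]])
  moreover have "isCont (\<lambda>z. F (inv_into W \<phi> z)) z"
    by (rule cdiff_at_isCont[OF frame_coordinate_in_chart(1)[OF z]])
  ultimately show ?thesis
    unfolding log_norm_def fst_conv snd_conv
    using frame_coordinate_in_chart(2)[OF z] by (intro continuous_intros) auto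
qed

lemma has_laplacian_log_norm:
  assumes \<zeta>: "z + \<zeta> *s v \<in> \<phi> ` (N \<inter> W)"
  shows "has_laplacian (\<lambda>\<xi>. log_norm t F (W, \<phi>) (z + \<xi> *s v))
    (4 * Re (sesquilinear (levi_matrix (log_weight t (W, \<phi>)) (z + \<zeta> *s v)) v v)) \<zeta>"
proof -
  have op: "open (\<phi> ` (N \<inter> W))" by (rule open_chart_image[OF chart N(1)])
  define M where "M = (\<lambda>\<xi>. z + \<xi> *s v) -` (\<phi> ` (N \<inter> W))"
  have M: "open M" "\<zeta> \<in> M"
    unfolding M_def using open_vimage[OF op continuous_on_complex_line] \<zeta> by auto
  have "(\<lambda>\<xi>. F (inv_into W \<phi> (z + \<xi> *s v))) holomorphic_on M"
    unfolding holomorphic_on_def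
    by (rule ballI, rule field_differentiable_at_within, rule cdiff_at_imp_field_differentiable_line,
        rule frame_coordinate_in_chart(1)) (simp add: M_def)
  then have "has_laplacian (\<lambda>\<xi>. ln ((cmod (F (inv_into W \<phi> (z + \<xi> *s v))))\<^sup>2)) 0 \<zeta>"
    by (rule has_laplacian_ln_norm_holomorphic[OF _ M]) (rule frame_coordinate_in_chart(2)[OF \<zeta>])
  from has_laplacian_add[OF has_laplacian_hessian[OF op \<zeta> log_weight_C2_on_frame_domain] this]
  show ?thesis
    using Re_levi_form[OF op log_weight_C2_on_frame_domain \<zeta>, of v]
    by (simp add: log_norm_def mult.commute)
qed

lemma log_norm_superharmonic:
  assumes \<zeta>: "z + \<zeta> *s v \<in> \<phi> ` (N \<inter> W)"
  shows "\<exists>l\<ge>0. has_laplacian (\<lambda>\<xi>. - log_norm t F (W, \<phi>) (z + \<xi> *s v)) l \<zeta>"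
proof -
  obtain x where x: "x \<in> N" "x \<in> W" "z + \<zeta> *s v = \<phi> x" using \<zeta> by blast
  have "semipositive (- levi_matrix (log_weight t (W, \<phi>)) (\<phi> x))"
    using N(2) x by (intro semipositive_levi_matrix_log_weight t chart) auto
  then have "Re (sesquilinear (levi_matrix (log_weight t (W, \<phi>)) (\<phi> x)) v v) \<le> 0"
    by (simp add: semipositive_def sesquilinear_minus)
  with has_laplacian_cmult[OF has_laplacian_log_norm[OF \<zeta>], of "-1"] show ?thesis
    unfolding x(3) by (intro exI conjI) auto
qed

end

end

subsection \<open>Local constancy of the square norm of flat frames\<close>

locale flat_semipositive_bundle =
  holomorphic_submanifold X A Y + holomorphic_bundle_subset X A Y L + semipositive_bundle X A L h
  for X :: "'a topology" and A :: "('a, 'n::finite) chart set" and Y :: "'a set"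
    and L :: "('a, 'e) line_bundle" and h :: "'e \<Rightarrow> 'e \<Rightarrow> complex" +
  fixes G :: "'a \<Rightarrow> real"
  assumes compact: "compactin X Y"
    and flat_frame: "y \<in> Y \<Longrightarrow> t \<in> bundle_trivs L \<Longrightarrow> y \<in> fst t \<Longrightarrow>
      \<exists>N F. frame_with_square_norm h G t N F \<and> y \<in> N"
begin

lemma flat_frame_exists:
  assumes "y \<in> Y"
  obtains t N F where "frame_with_square_norm h G t N F" "y \<in> N"
proof -
  obtain t where "t \<in> bundle_trivs L" "y \<in> fst t"
    using bundle_triv_exists assms Y_subset by blast
  then show thesis using flat_frame[OF assms] that by blast
qed

lemma frame_with_square_norm_subset:
  "frame_with_square_norm h G t N F \<Longrightarrow> openin X M \<Longrightarrow> M \<subseteq> N \<Longrightarrow> frame_with_square_norm h G t M F"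
  unfolding frame_with_square_norm_def by blast

lemma frame_with_square_normD:
  assumes "frame_with_square_norm h G t N F"
  shows "t \<in> bundle_trivs L" "openin X N" "N \<subseteq> fst t" "\<And>p. p \<in> N \<Longrightarrow> holo_at A F p \<and> F p \<noteq> 0"
  using assms by (auto simp: frame_with_square_norm_def)

lemma square_norm_eq_exp_log_norm:
  assumes frame: "frame_with_square_norm h G t N F" and chart: "(W, \<phi>) \<in> A"
    and p: "p \<in> N" "p \<in> W" "p \<in> Y"
  shows "G p = exp (log_norm t F (W, \<phi>) (\<phi> p))"
proof -
  have "weight L h t p > 0" "F p \<noteq> 0" "G p = weight L h t p * (cmod (F p))\<^sup>2"
    using frame p weight_pos[OF metric, of t p] by (auto simp: frame_with_square_norm_def)
  then show ?thesis
    using chart_inverse[OF chart p(2)] by (simp add: log_norm_def log_weight_def exp_add)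
qed

lemma continuous_map_square_norm: "continuous_map X\<^sub>Y euclideanreal G"
proof -
  have "openin X\<^sub>Y {y \<in> Y. G y \<in> S}" if S: "open S" for S
  proof (subst openin_subopen, intro ballI)
    fix y assume "y \<in> {y \<in> Y. G y \<in> S}"
    then have y: "y \<in> Y" "G y \<in> S" by auto
    obtain t N F where frame: "frame_with_square_norm h G t N F" "y \<in> N"
      using y(1) by (rule flat_frame_exists)
    note F = frame_with_square_normD[OF frame(1)]
    obtain W \<phi> where chart: "(W, \<phi>) \<in> A" "y \<in> W" using chart_exists y(1) Y_subset by blast
    define B where "B = \<phi> ` (N \<inter> W) \<inter> (\<lambda>z. exp (log_norm t F (W, \<phi>) z)) -` S"
    have "open B"
      unfolding B_def
      by (intro continuous_open_preimage open_chart_image[OF chart(1) F(2)] S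
          continuous_at_imp_continuous_on ballI continuous_intros isCont_log_norm[OF F chart(1)])
    then have "openin X\<^sub>Y (({x \<in> W. \<phi> x \<in> B} \<inter> N) \<inter> Y)"
      by (intro openin_Int_Y openin_Int openin_chart_preimage[OF chart(1)] F(2))
    moreover have "{x \<in> W. \<phi> x \<in> B} \<inter> N \<inter> Y \<subseteq> {y \<in> Y. G y \<in> S}"
      using square_norm_eq_exp_log_norm[OF frame(1) chart(1)] by (auto simp: B_def)
    moreover have "y \<in> {x \<in> W. \<phi> x \<in> B} \<inter> N \<inter> Y"
      using y frame(2) chart(2) square_norm_eq_exp_log_norm[OF frame(1) chart(1)] by (auto simp: B_def)
    ultimately show "\<exists>M. openin X\<^sub>Y M \<and> y \<in> M \<and> M \<subseteq> {y \<in> Y. G y \<in> S}" by blast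
  qed
  then show ?thesis unfolding continuous_map_def topspace_subset by simp
qed

lemma square_norm_pos:
  assumes "y \<in> Y"
  shows "G y > 0"
proof -
  obtain t N F where "frame_with_square_norm h G t N F" "y \<in> N"
    using assms by (rule flat_frame_exists)
  then show ?thesis
    using assms weight_pos[OF metric, of t y] by (auto simp: frame_with_square_norm_def)
qed

lemma log_norm_slice_line:
  assumes slice: "slice_chart W \<phi> I" and frame: "frame_with_square_norm h G t N F"
    and y: "y \<in> W" and ball: "ball (\<phi> y) \<rho> \<subseteq> \<phi> ` (N \<inter> W)"
    and slice_mem: "\<phi> y \<in> coord_slice I" "v \<in> coord_slice I" and \<xi>: "cmod \<xi> * norm v < \<rho>"
  shows "\<exists>q\<in>slice_ball W \<phi> y \<rho>. \<phi> q = \<phi> y + \<xi> *s v \<and> log_norm t F (W, \<phi>) (\<phi> y + \<xi> *s v) = ln (G q)"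
proof -
  have line: "\<phi> y + \<xi> *s v \<in> ball (\<phi> y) \<rho>"
    using \<xi> by (simp add: dist_norm norm_smult_vec)
  with ball have "\<phi> y + \<xi> *s v \<in> \<phi> ` (N \<inter> W)" by blast
  then obtain q where q: "q \<in> N" "q \<in> W" "\<phi> q = \<phi> y + \<xi> *s v" by fastforce
  then have "q \<in> Y"
    using slice_chart_mem_iff[OF slice q(2)] coord_slice_line[OF slice_mem] by simp
  then show ?thesis
    using q line square_norm_eq_exp_log_norm[OF frame slice_chart_chart[OF slice] q(1,2)]
    by (intro bexI[of _ q]) (auto simp: slice_ball_def)
qed

lemma square_norm_constant_near_local_min:
  assumes slice: "slice_chart W \<phi> I" and frame: "frame_with_square_norm h G t N F"
    and y: "y \<in> Y" "y \<in> W" and ball: "ball (\<phi> y) \<rho> \<subseteq> \<phi> ` (N \<inter> W)"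
    and min: "\<And>x. x \<in> slice_ball W \<phi> y \<rho> \<Longrightarrow> G y \<le> G x" and x: "x \<in> slice_ball W \<phi> y \<rho>"
  shows "G x = G y"
proof (cases "\<phi> x = \<phi> y")
  case True
  then show ?thesis
    using x y chart_inj_on[OF slice_chart_chart[OF slice]] by (auto simp: slice_ball_def dest: inj_onD)
next
  case False
  note chart = slice_chart_chart[OF slice] and F = frame_with_square_normD[OF frame]
  define v where "v = \<phi> x - \<phi> y"
  define R where "R = \<rho> / norm v"
  define u where "u \<xi> = - log_norm t F (W, \<phi>) (\<phi> y + \<xi> *s v)" for \<xi>
  have slice_mem: "\<phi> y \<in> coord_slice I" "v \<in> coord_slice I"
    using slice_chart_mem_iff[OF slice] x y by (auto simp: slice_ball_def v_def intro: coord_slice_diff)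
  have line: "\<exists>q\<in>slice_ball W \<phi> y \<rho>. \<phi> q = \<phi> y + \<xi> *s v \<and> u \<xi> = - ln (G q)" if "\<xi> \<in> ball 0 R" for \<xi>
    using log_norm_slice_line[OF slice frame y(2) ball slice_mem, of \<xi>] that False
    by (simp add: R_def v_def u_def pos_less_divide_eq)
  have line_frame: "\<phi> y + \<xi> *s v \<in> \<phi> ` (N \<inter> W)" if "\<xi> \<in> ball 0 R" for \<xi>
  proof -
    have "\<phi> y + \<xi> *s v \<in> ball (\<phi> y) \<rho>" using line[OF that] by (auto simp: slice_ball_def)
    then show ?thesis using ball by blast
  qed
  have norm_v: "norm v < \<rho>" using x by (simp add: slice_ball_def v_def dist_norm norm_minus_commute)
  have in_ball: "0 \<in> ball 0 R" "1 \<in> ball (0::complex) R"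
    using False norm_v le_less_trans[OF norm_ge_zero norm_v] by (auto simp: R_def v_def pos_less_divide_eq)
  have "u 0 = - ln (G y)" "u 1 = - ln (G x)"
    using line[OF in_ball(1)] line[OF in_ball(2)] x y chart_inj_on[OF chart]
    by (auto simp: v_def slice_ball_def dest: inj_onD)
  moreover have "u 1 = u 0"
  proof (rule strong_maximum_principle[OF _ _ _ in_ball(2)])
    show "continuous_on (ball 0 R) u"
      unfolding u_def
      by (intro continuous_on_minus continuous_on_compose2[OF _ continuous_on_complex_line, of "\<phi> ` (N \<inter> W)"]
          continuous_at_imp_continuous_on ballI isCont_log_norm[OF F chart]) (use line_frame in auto)
    show "\<exists>l\<ge>0. has_laplacian u l \<xi>" if "\<xi> \<in> ball 0 R" for \<xi>
      unfolding u_def by (rule log_norm_superharmonic[OF F chart line_frame[OF that]])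
    show "u \<xi> \<le> u 0" if "\<xi> \<in> ball 0 R" for \<xi>
      using line[OF that] min square_norm_pos y(1) \<open>u 0 = - ln (G y)\<close> by (auto simp: slice_ball_def)
  qed
  ultimately show ?thesis
    using square_norm_pos x y(1) by (simp add: slice_ball_def)
qed

lemma locally_constant_square_norm: "locally_constant_on X\<^sub>Y Y G"
proof -
  have "\<exists>M. openin X\<^sub>Y M \<and> y \<in> M \<and> (\<forall>x\<in>M. G x = G y)"
    if V: "openin X\<^sub>Y V" "y \<in> V" and min: "\<And>x. x \<in> V \<Longrightarrow> G y \<le> G x" for y V
  proof -
    obtain U where U: "openin X U" "V = U \<inter> Y" using V(1) by (auto simp: openin_subtopology)
    then have y: "y \<in> Y" "y \<in> U" using V(2) by auto
    obtain W \<phi> I where slice: "slice_chart W \<phi> I" "y \<in> W" using y(1) by (rule slice_chart_exists)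
    note chart = slice_chart_chart[OF slice(1)]
    obtain t N F where frame: "frame_with_square_norm h G t N F" "y \<in> N"
      using y(1) by (rule flat_frame_exists)
    have "openin X (N \<inter> U)" using frame_with_square_normD(2)[OF frame(1)] U(1) by blast
    then obtain \<rho> where \<rho>: "\<rho> > 0" "ball (\<phi> y) \<rho> \<subseteq> \<phi> ` (N \<inter> U \<inter> W)"
      using chart_ball_exists[OF chart slice(2)] frame(2) y(2) by blast
    have "slice_ball W \<phi> y \<rho> \<subseteq> V"
      using slice_ball_subset[OF chart \<rho>(2)] U(2) by blast
    then have "G x = G y" if "x \<in> slice_ball W \<phi> y \<rho>" for x
      using min \<rho>(2) that by (intro square_norm_constant_near_local_min[OF slice(1) frame(1) y(1) slice(2), of \<rho>]) auto
    moreover have "y \<in> slice_ball W \<phi> y \<rho>" using y slice(2) \<rho>(1) by (simp add: slice_ball_def)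
    ultimately show ?thesis using openin_slice_ball[OF chart] by blast
  qed
  moreover have "compact_space X\<^sub>Y" using compact by (simp add: compact_space_subtopology)
  ultimately show ?thesis
    using locally_constant_on_if_locally_constant_at_minima[OF _ locally_connected_space_submanifold
        continuous_map_square_norm] unfolding topspace_subset by blast
qed

lemma flat_frame_constant_norm:
  assumes y: "y \<in> Y" and t: "t \<in> bundle_trivs L" "y \<in> fst t"
  obtains N F where "frame_with_square_norm h G t N F" "y \<in> N" "\<And>p. p \<in> N \<inter> Y \<Longrightarrow> G p = G y"
proof -
  obtain N F where frame: "frame_with_square_norm h G t N F" "y \<in> N" using flat_frame[OF y t] by blast
  obtain V where "openin X\<^sub>Y V" "y \<in> V" "\<forall>p\<in>V \<inter> Y. G p = G y"
    using locally_constant_square_norm y unfolding locally_constant_on_def by blast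
  then obtain U where U: "openin X U" "y \<in> U" "\<And>p. p \<in> U \<inter> Y \<Longrightarrow> G p = G y"
    by (auto simp: openin_subtopology)
  have "openin X (N \<inter> U)" using frame_with_square_normD(2)[OF frame(1)] U(1) by blast
  then have "frame_with_square_norm h G t (N \<inter> U) F"
    by (rule frame_with_square_norm_subset[OF frame(1)]) blast
  then show thesis using that[of "N \<inter> U" F] frame(2) U by blast
qed

lemma levi_matrix_tangent_eq_0:
  assumes slice: "slice_chart W \<phi> I" and t: "t \<in> bundle_trivs L"
    and p: "p \<in> Y" "p \<in> W" "p \<in> fst t" and v: "v \<in> coord_slice I"
  shows "sesquilinear (levi_matrix (log_weight t (W, \<phi>)) (\<phi> p)) v w = 0"
proof -
  let ?C = "levi_matrix (log_weight t (W, \<phi>)) (\<phi> p)"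
  note chart = slice_chart_chart[OF slice]
  obtain N F where frame: "frame_with_square_norm h G t N F" "p \<in> N" and G: "\<And>q. q \<in> N \<inter> Y \<Longrightarrow> G q = G p"
    using p(1) t p(3) by (rule flat_frame_constant_norm) blast
  note F = frame_with_square_normD[OF frame(1)]
  define M where "M = (\<lambda>\<xi>. \<phi> p + \<xi> *s v) -` (\<phi> ` (N \<inter> W))"
  have "\<phi> p + 0 *s v \<in> \<phi> ` (N \<inter> W)" using p(2) frame(2) by simp
  then have M: "open M" "0 \<in> M" and laplacian: "has_laplacian
      (\<lambda>\<xi>. log_norm t F (W, \<phi>) (\<phi> p + \<xi> *s v)) (4 * Re (sesquilinear ?C v v)) 0"
    using has_laplacian_log_norm[OF F chart, of "\<phi> p" 0 v]
      open_vimage[OF open_chart_image[OF chart F(2)] continuous_on_complex_line] by (auto simp: M_def)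
  have "has_laplacian (\<lambda>\<xi>. log_norm t F (W, \<phi>) (\<phi> p + \<xi> *s v)) 0 0"
  proof (rule has_laplacian_cong[OF has_laplacian_const M])
    fix \<xi> assume "\<xi> \<in> M"
    then obtain q where q: "q \<in> N" "q \<in> W" "\<phi> q = \<phi> p + \<xi> *s v" unfolding M_def by fastforce
    then have "q \<in> Y"
      using slice_chart_mem_iff[OF slice] p coord_slice_line[OF _ v] by metis
    then show "ln (G p) = log_norm t F (W, \<phi>) (\<phi> p + \<xi> *s v)"
      using square_norm_eq_exp_log_norm[OF frame(1) chart q(1,2)] G[of q] q by simp
  qed
  with laplacian have "Re (sesquilinear ?C v v) = 0"
    using has_laplacian_unique by fastforce
  moreover have C: "semipositive (- ?C)"
    by (rule semipositive_levi_matrix_log_weight[OF t p(3) chart p(2)])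
  ultimately have "sesquilinear (- ?C) v v = 0"
    by (auto simp: semipositive_def sesquilinear_minus complex_is_Real_iff complex_eq_iff)
  from semipositive_null_vector[OF C this] show ?thesis by (simp add: sesquilinear_minus)
qed

end

section \<open>The connection form\<close>

subsection \<open>Transformation rules\<close>

context semipositive_bundle
begin

text \<open>The coefficients of the form \<open>\<partial> log |e|\<^sup>2\<close> for the local frame \<open>e\<close> of \<open>t\<close>.\<close>

definition connection :: "'a set \<times> ('e \<Rightarrow> complex) \<Rightarrow> ('a, 'n) chart \<Rightarrow> 'a \<Rightarrow> complex^'n" where
  "connection t c p = (\<chi> j. wirtinger j (\<lambda>z. of_real (log_weight t c z)) (snd c p))"

lemma connection_nth: "connection t c p $ j = wirtinger j (\<lambda>z. of_real (log_weight t c z)) (snd c p)"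
  by (simp add: connection_def)

lemma has_derivative_log_weight:
  assumes "t \<in> bundle_trivs L" "p \<in> fst t" "(W, \<phi>) \<in> A" "p \<in> W"
  obtains D where "((\<lambda>z. complex_of_real (log_weight t (W, \<phi>) z)) has_derivative D) (at (\<phi> p))"
  using has_derivative_of_real[OF C2_on_has_derivative[OF log_weight_C2]] assms by blast

lemma log_weight_transition:
  assumes t: "t \<in> bundle_trivs L" and t': "t' \<in> bundle_trivs L" and chart: "(W, \<phi>) \<in> A"
    and z: "z \<in> \<phi> ` (fst t \<inter> fst t' \<inter> W)"
  shows "log_weight t' (W, \<phi>) z = log_weight t (W, \<phi>) z + ln ((cmod (transition L t t' (inv_into W \<phi> z)))\<^sup>2)"
proof -
  let ?q = "inv_into W \<phi> z"
  have q: "?q \<in> fst t" "?q \<in> fst t'"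
    using z chart_inverse[OF chart] by auto
  have "transition L t t' ?q \<noteq> 0"
    using transition_section[OF bundle_triv_holo[OF t] bundle_triv_holo[OF t']] q
    by (simp add: units_section_iff)
  then show ?thesis
    using weight_transition[OF metric t q(1) t' q(2)] weight_pos[OF metric t q(1)]
    by (simp add: log_weight_def ln_mult)
qed

lemma dlog_transition:
  assumes t: "t \<in> bundle_trivs L" "p \<in> fst t" and t': "t' \<in> bundle_trivs L" "p \<in> fst t'"
    and chart: "(W, \<phi>) \<in> A" "p \<in> W"
  shows "dlog A (transition L t t') p (W, \<phi>) = connection t' (W, \<phi>) p - connection t (W, \<phi>) p"
proof -
  define g where "g z = transition L t t' (inv_into W \<phi> z)" for z
  let ?N = "fst t \<inter> fst t'"
  have transition: "holo_at A (transition L t t') q" "transition L t t' q \<noteq> 0" if "q \<in> ?N" for q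
    using transition_section[OF bundle_triv_holo[OF t(1)] bundle_triv_holo[OF t'(1)]] that
    by (simp_all add: units_section_iff)
  have g: "cdiff_at g (\<phi> p)" "g (\<phi> p) = transition L t t' p" "g (\<phi> p) \<noteq> 0"
    unfolding g_def chart_inverse[OF chart] using transition t(2) t'(2) by (auto intro: holo_atD[OF _ chart])
  have open_N: "open (\<phi> ` (?N \<inter> W))" "\<phi> p \<in> \<phi> ` (?N \<inter> W)"
    using t t' chart bundle_triv_open[of t] bundle_triv_open[of t'] by (auto intro!: open_chart_image)
  obtain D where D: "((\<lambda>z. complex_of_real (log_weight t (W, \<phi>) z)) has_derivative D) (at (\<phi> p))"
    using t chart by (rule has_derivative_log_weight)
  obtain E where E: "((\<lambda>z. complex_of_real (ln ((cmod (g z))\<^sup>2))) has_derivative E) (at (\<phi> p))"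
    and dlog: "\<And>j. wirtinger j (\<lambda>z. of_real (ln ((cmod (g z))\<^sup>2))) (\<phi> p) = cpartial j g (\<phi> p) / g (\<phi> p)"
    using g(1,3) by (rule wirtinger_ln_norm_square) blast
  have "connection t' (W, \<phi>) p $ j = connection t (W, \<phi>) p $ j + cpartial j g (\<phi> p) / g (\<phi> p)" for j
    unfolding connection_nth snd_conv dlog[symmetric] wirtinger_add[OF D E, symmetric]
    by (rule wirtinger_cong[OF has_derivative_add[OF D E] open_N, symmetric])
      (simp add: g_def log_weight_transition[OF t(1) t'(1) chart(1)])
  moreover have "dlog A (transition L t t') p (W, \<phi>) $ j = cpartial j g (\<phi> p) / g (\<phi> p)" for j
    unfolding g(2) using chart by (simp add: dlog_def ext_d_def cgrad_nth g_def[abs_def])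
  ultimately show ?thesis by (simp add: vec_eq_iff)
qed

lemma connection_chart_change:
  assumes t: "t \<in> bundle_trivs L" "p \<in> fst t" and chart: "(W, \<phi>) \<in> A" "p \<in> W"
    and chart': "(V, \<psi>) \<in> A" "p \<in> V"
  shows "connection t (V, \<psi>) p $ k =
    (\<Sum>i\<in>UNIV. cgrad (V, \<psi>) (\<lambda>q. \<phi> q $ i) p $ k * connection t (W, \<phi>) p $ i)"
proof -
  define J where "J = (\<chi> i. cgrad (V, \<psi>) (\<lambda>q. \<phi> q $ i) p)"
  let ?g = "\<lambda>z. \<phi> (inv_into V \<psi> z)"
  obtain D where D: "((\<lambda>z. complex_of_real (log_weight t (W, \<phi>) z)) has_derivative D) (at (?g (\<psi> p)))"
    using has_derivative_log_weight[OF t chart] chart_inverse[OF chart'] by auto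
  have g: "(?g has_derivative (\<lambda>v. \<chi> i. \<Sum>k\<in>UNIV. v $ k * J $ i $ k)) (at (\<psi> p))"
    using has_derivative_chart_change[OF chart chart'] by (simp add: J_def chart_jacobian_def[abs_def])
  have "connection t (V, \<psi>) p $ k = wirtinger k (\<lambda>z. of_real (log_weight t (W, \<phi>) (?g z))) (\<psi> p)"
    unfolding connection_nth snd_conv
  proof (rule wirtinger_cong[OF has_derivative_compose[OF g D], symmetric])
    show "open (\<psi> ` (W \<inter> V))" by (rule open_chart_image[OF chart'(1) chart_open[OF chart(1)]])
    show "\<psi> p \<in> \<psi> ` (W \<inter> V)" using chart(2) chart'(2) by blast
    show "complex_of_real (log_weight t (W, \<phi>) (?g z)) = of_real (log_weight t (V, \<psi>) z)"
      if "z \<in> \<psi> ` (W \<inter> V)" for z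
      using chart_change[OF chart(1) chart'(1) that, of "\<lambda>x. weight L h t x"] by (simp add: log_weight_def)
  qed
  also have "\<dots> = (\<Sum>i\<in>UNIV. J $ i $ k * wirtinger i (\<lambda>z. of_real (log_weight t (W, \<phi>) z)) (?g (\<psi> p)))"
    by (rule wirtinger_compose_holomorphic[OF D g])
  finally show ?thesis
    by (simp add: J_def connection_nth chart_inverse[OF chart'])
qed

end

subsection \<open>Holomorphy along the submanifold\<close>

definition coord_proj :: "'n set \<Rightarrow> complex^'n::finite \<Rightarrow> complex^'n" where
  "coord_proj I z = (\<chi> i. if i \<in> I then 0 else z $ i)"

lemma bounded_linear_coord_proj: "bounded_linear (coord_proj I :: complex^'n::finite \<Rightarrow> complex^'n)"
  unfolding linear_conv_bounded_linear[symmetric]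
  by (rule linearI) (simp_all add: coord_proj_def vec_eq_iff)

lemma coord_proj_in_slice: "coord_proj I z \<in> coord_slice I"
  by (simp add: coord_proj_def coord_slice_def)

lemma coord_proj_slice: "z \<in> coord_slice I \<Longrightarrow> coord_proj I z = z"
  by (simp add: coord_proj_def coord_slice_def vec_eq_iff)

text \<open>The composition with the projection extends a function on the slice that is holomorphic along
  it.\<close>

lemma cdiff_at_compose_coord_proj:
  assumes D: "(f has_derivative D) (at (coord_proj I z))"
    and bar: "\<And>i. i \<notin> I \<Longrightarrow> wirtinger_bar i f (coord_proj I z) = 0"
  shows "cdiff_at (\<lambda>w. f (coord_proj I w)) z"
proof (rule cdiff_atI)
  show "((\<lambda>w. f (coord_proj I w)) has_derivative (\<lambda>v. D (coord_proj I v))) (at z)"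
    by (rule has_derivative_compose[OF bounded_linear_imp_has_derivative[OF bounded_linear_coord_proj] D])
  have imaginary: "D (axis i \<i>) = \<i> * D (axis i 1)" if "i \<notin> I" for i
    using bar[OF that] unfolding wirtinger_bar_eq[OF D] by (simp add: complex_eq_iff)
  have expansion: "D (coord_proj I v) = (\<Sum>i\<in>UNIV. coord_proj I v $ i * D (axis i 1))" for v
    unfolding linear_axis_expansion[OF has_derivative_linear[OF D], of "coord_proj I v"]
  proof (rule sum.cong)
    fix i
    show "Re (coord_proj I v $ i) *\<^sub>R D (axis i 1) + Im (coord_proj I v $ i) *\<^sub>R D (axis i \<i>) =
        coord_proj I v $ i * D (axis i 1)"
      by (cases "i \<in> I") (auto simp: coord_proj_def imaginary complex_eq_iff algebra_simps)
  qed simp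
  have "coord_proj I (a *s v) $ i = a * coord_proj I v $ i" for a v i
    by (simp add: coord_proj_def)
  then show "D (coord_proj I (a *s v)) = a * D (coord_proj I v)" for a v
    by (simp add: expansion sum_distrib_left mult.assoc)
qed

context flat_semipositive_bundle
begin

lemma connection_holomorphic_on_slice:
  assumes slice: "slice_chart W \<phi> I" and t: "t \<in> bundle_trivs L"
    and z: "coord_proj I z \<in> \<phi> ` (fst t \<inter> W)"
  shows "cdiff_at (\<lambda>z. wirtinger j (\<lambda>z. of_real (log_weight t (W, \<phi>) z)) (coord_proj I z)) z"
proof -
  note chart = slice_chart_chart[OF slice]
  note C2 = open_triv_image[OF t chart] log_weight_C2[OF t chart]
  obtain p where p: "p \<in> fst t" "p \<in> W" "coord_proj I z = \<phi> p" using z by blast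
  then have "p \<in> Y" using slice_chart_mem_iff[OF slice p(2)] coord_proj_in_slice by metis
  obtain D where D: "(wirtinger j (\<lambda>z. of_real (log_weight t (W, \<phi>) z)) has_derivative D) (at (coord_proj I z))"
    using has_derivative_wirtinger[OF C2 z] by blast
  have "wirtinger_bar i (wirtinger j (\<lambda>z. of_real (log_weight t (W, \<phi>) z))) (coord_proj I z) = 0"
    if "i \<notin> I" for i
    using levi_matrix_tangent_eq_0[OF slice t \<open>p \<in> Y\<close> p(2,1) axis_in_coord_slice[OF that], of 1 "axis j 1"]
    unfolding wirtinger_bar_wirtinger[OF C2 z] sesquilinear_axis by (simp add: p(3))
  with D show ?thesis by (rule cdiff_at_compose_coord_proj)
qed

lemma connection_section:
  assumes slice: "slice_chart W \<phi> I" and t: "t \<in> bundle_trivs L"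
  shows "(\<lambda>p. connection t (W, \<phi>) p $ j) \<in> sections O\<^sub>Y (fst t \<inter> W \<inter> Y)"
proof (rule O_sub_sectionI)
  note chart = slice_chart_chart[OF slice]
  show "openin X\<^sub>Y (fst t \<inter> W \<inter> Y)"
    using bundle_triv_open[OF t] chart_open[OF chart] by (intro openin_Int_Y) blast
  fix y assume y: "y \<in> fst t \<inter> W \<inter> Y"
  define g where "g z = wirtinger j (\<lambda>z. of_real (log_weight t (W, \<phi>) z)) (coord_proj I z)" for z
  define U where "U = {p \<in> W. \<phi> p \<in> coord_proj I -` (\<phi> ` (fst t \<inter> W))}"
  have proj: "coord_proj I (\<phi> p) = \<phi> p" if "p \<in> W \<inter> Y" for p
    using that slice_chart_mem_iff[OF slice, of p] by (simp add: coord_proj_slice)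
  have "openin X U"
    unfolding U_def
    by (intro openin_chart_preimage[OF chart] open_vimage open_triv_image[OF t chart]
        linear_continuous_on bounded_linear_coord_proj)
  moreover have "y \<in> U" using y proj by (auto simp: U_def)
  moreover have "holo_at A (\<lambda>p. g (\<phi> p)) x" if "x \<in> U" for x
  proof (rule holo_atI[OF chart _ chart_open[OF chart]])
    show "cdiff_at g (\<phi> x)"
      using that unfolding g_def U_def by (intro connection_holomorphic_on_slice[OF slice t]) blast
  qed (use that in \<open>auto simp: U_def\<close>)
  moreover have "connection t (W, \<phi>) x $ j = g (\<phi> x)" if "x \<in> U \<inter> (fst t \<inter> W \<inter> Y)" for x
    using that proj[of x] by (simp add: connection_nth g_def)
  ultimately show "\<exists>U g. openin X U \<and> y \<in> U \<and> (\<forall>x\<in>U. holo_at A g x) \<and>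
      (\<forall>x\<in>U \<inter> (fst t \<inter> W \<inter> Y). connection t (W, \<phi>) x $ j = g x)"
    by (intro exI[of _ U] exI[of _ "\<lambda>p. g (\<phi> p)"]) auto
qed

section \<open>Vanishing of the Ueda class\<close>

definition connection_form where
  "connection_form t c = coordinate_form c (\<lambda>j q. - connection t c q $ j)"

lemma connection_form_section:
  assumes slice: "slice_chart W \<phi> I" and t: "t \<in> bundle_trivs L"
  shows "connection_form t (W, \<phi>) \<in> sections (module_pullback X A Y (Omega1 X A)) (fst t \<inter> W \<inter> Y)"
  unfolding connection_form_def
  by (intro coordinate_form_section slice_chart_chart[OF slice] O_sub_minus connection_section[OF assms]
      OY.open_section[OF connection_section[OF assms]]) blast

lemma connection_form_chart_independent:
  assumes slice: "slice_chart W \<phi> I" and slice': "slice_chart W' \<phi>' I'" and t: "t \<in> bundle_trivs L"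
    and p: "p \<in> Y" "p \<in> fst t" "p \<in> W" "p \<in> W'"
  shows "connection_form t (W', \<phi>') p = connection_form t (W, \<phi>) p"
proof -
  note chart = slice_chart_chart[OF slice] and chart' = slice_chart_chart[OF slice']
  let ?V = "fst t \<inter> W \<inter> W' \<inter> Y"
  have V: "openin X\<^sub>Y ?V" "p \<in> ?V"
    using p bundle_triv_open[OF t] chart_open[OF chart] chart_open[OF chart'] by (auto intro!: openin_Int_Y)
  have "(\<lambda>q. - connection t (W', \<phi>') q $ k) \<in> sections O\<^sub>Y ?V" for k
    by (rule OY.section_restrict[OF O_sub_minus[OF connection_section[OF slice' t]] V(1)]) blast
  then have "connection_form t (W', \<phi>') p = coordinate_form (W, \<phi>)
      (\<lambda>j q. \<Sum>k\<in>UNIV. cgrad (W, \<phi>) (\<lambda>y. \<phi>' y $ k) q $ j * - connection t (W', \<phi>') q $ k) p"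
    unfolding connection_form_def by (intro coordinate_form_change[OF chart chart' p(1) V(2,1)]) auto
  also have "\<dots> = connection_form t (W, \<phi>) p"
    unfolding connection_form_def
    by (rule coordinate_form_cong[OF V])
      (simp add: connection_chart_change[OF t _ chart' _ chart] sum_negf)
  finally show ?thesis .
qed

lemma connection_form_transition:
  assumes slice: "slice_chart W \<phi> I" and t: "t \<in> bundle_trivs L" and t': "t' \<in> bundle_trivs L"
    and p: "p \<in> Y" "p \<in> fst t" "p \<in> fst t'" "p \<in> W"
  shows "connection_form t (W, \<phi>) p =
    \<Omega>.tens p (germ X p (dlog A (transition L t t'))) (germ X\<^sub>Y p (\<lambda>x. 1)) \<otimes>\<^bsub>\<Omega>.P p\<^esub>
      connection_form t' (W, \<phi>) p"
proof -
  note chart = slice_chart_chart[OF slice]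
  let ?N = "fst t \<inter> fst t'" and ?V = "fst t \<inter> fst t' \<inter> W \<inter> Y"
  let ?\<omega> = "dlog A (transition L t t')"
  have \<omega>: "?\<omega> \<in> sections (Omega1 X A) ?N"
    using dlog_section[OF transition_section[OF bundle_triv_holo[OF t] bundle_triv_holo[OF t']]]
      dO_subset_Omega1 by blast
  have open_NW: "openin X (?N \<inter> W)"
    using bundle_triv_open[OF t] bundle_triv_open[OF t'] chart_open[OF chart] by blast
  have V: "openin X\<^sub>Y ?V" "p \<in> ?V"
    using openin_Int_Y[OF open_NW] p by auto
  have coeff: "(\<lambda>q. ?\<omega> q (W, \<phi>) $ j * 1) \<in> sections O\<^sub>Y ?V" for j
    using \<omega> chart by (intro O_sub_mult_holo[OF O_sub_const[OF V(1)] open_NW]) (auto simp: Omega1_section_iff)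
  have "(\<lambda>q. - connection t' (W, \<phi>) q $ j) \<in> sections O\<^sub>Y ?V" for j
    by (rule OY.section_restrict[OF O_sub_minus[OF connection_section[OF slice t']] V(1)]) blast
  from coordinate_form_add[OF chart p(4,1) V(2) coeff this]
  have "coordinate_form (W, \<phi>) (\<lambda>j q. ?\<omega> q (W, \<phi>) $ j * 1) p \<otimes>\<^bsub>\<Omega>.P p\<^esub> connection_form t' (W, \<phi>) p =
      coordinate_form (W, \<phi>) (\<lambda>j q. ?\<omega> q (W, \<phi>) $ j * 1 + - connection t' (W, \<phi>) q $ j) p"
    by (simp add: connection_form_def)
  also have "\<dots> = connection_form t (W, \<phi>) p"
    unfolding connection_form_def
    by (rule coordinate_form_cong[OF V]) (simp add: dlog_transition[OF t _ t' _ chart])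
  finally show ?thesis
    using p by (simp add: tens_eq_coordinate_form[OF p(1) chart p(4) \<omega> _ O_sub_one p(1)])
qed

lemma ueda_class_trivial: "ueda_class X A Y L = \<one>\<^bsub>H1 X\<^sub>Y (module_pullback X A Y (Omega1 X A))\<^esub>"
proof -
  have "\<forall>x\<in>topspace X. \<exists>t. t \<in> bundle_trivs L \<and> x \<in> fst t"
    by (rule ballI, rule bundle_triv_exists) blast+
  then obtain t where t: "\<And>x. x \<in> topspace X \<Longrightarrow> t x \<in> bundle_trivs L \<and> x \<in> fst (t x)"
    by metis
  then have family: "triv_family t" by (simp add: triv_family_def bundle_triv_holo)
  have "\<forall>y\<in>Y. \<exists>W \<phi> I. slice_chart W \<phi> I \<and> y \<in> W"
    by (rule ballI, rule slice_chart_exists) blast+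
  then obtain W \<phi> I where slice: "\<And>y. y \<in> Y \<Longrightarrow> slice_chart (W y) (\<phi> y) (I y) \<and> y \<in> W y"
    by metis
  have tY: "t y \<in> bundle_trivs L" "y \<in> fst (t y)" if "y \<in> Y" for y
    using t that Y_subset by auto
  have "coh_class X\<^sub>Y (module_pullback X A Y (Omega1 X A)) (fst (ueda_cochain t), snd (ueda_cochain t)) =
      \<one>\<^bsub>H1 X\<^sub>Y (module_pullback X A Y (Omega1 X A))\<^esub>"
  proof (rule \<Omega>.pullback.coh_class_coboundary, unfold topspace_subset)
    show "(fst (ueda_cochain t), snd (ueda_cochain t)) \<in> cocycles X\<^sub>Y (module_pullback X A Y (Omega1 X A))"
      using ueda_cochain_cocycle[OF family] by simp
    fix x assume x: "x \<in> Y"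
    show "x \<in> fst (t x) \<inter> W x \<inter> Y \<and> fst (t x) \<inter> W x \<inter> Y \<subseteq> fst (ueda_cochain t) x"
      using slice[OF x] tY[OF x] x by (auto simp: fst_ueda_cochain)
    show "connection_form (t x) (W x, \<phi> x) \<in> sections (module_pullback X A Y (Omega1 X A)) (fst (t x) \<inter> W x \<inter> Y)"
      using slice[OF x] tY[OF x] by (intro connection_form_section) auto
    fix y p assume y: "y \<in> Y" and p: "p \<in> fst (t x) \<inter> W x \<inter> Y \<inter> (fst (t y) \<inter> W y \<inter> Y)"
    then have "p \<in> Y" by blast
    then show "connection_form (t x) (W x, \<phi> x) p =
        snd (ueda_cochain t) x y p \<otimes>\<^bsub>vals (module_pullback X A Y (Omega1 X A)) p\<^esub>
          connection_form (t y) (W y, \<phi> y) p"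
      using connection_form_transition[of "W x" "\<phi> x" "I x" "t x" "t y" p]
        connection_form_chart_independent[of "W x" "\<phi> x" "I x" "W y" "\<phi> y" "I y" "t y" p]
        slice[OF x] slice[OF y] tY[OF x] tY[OF y] p
      by (simp add: snd_ueda_cochain \<Omega>.vals_module_pullback)
  qed
  then show ?thesis
    unfolding ueda_class_eq[OF family] by simp
qed

end

theorem mainTheorem3:
  fixes X :: "'a topology" and A :: "('a, 'n::finite) chart set"
    and Y :: "'a set" and L :: "('a, 'e) line_bundle" and r :: nat
  assumes "complex_manifold X A"
    and "complex_submanifold X A Y"
    and "compactin X Y"
    and "holomorphic_line_bundle X (O_sheaf X A) L"
    and "unitary_flat (subtopology X Y) (O_sub X A Y) (restrict_bundle L Y)"
    and "r \<ge> 2"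
    and "ueda_class X A Y L \<noteq> \<one>\<^bsub>H1 (subtopology X Y) (module_pullback X A Y (Omega1 X A))\<^esub>"
  shows "\<not> (\<exists>h. hermitian_metric L h \<and> metric_of_class A L r h \<and> semipositive_curvature A L h)"
proof
  assume "\<exists>h. hermitian_metric L h \<and> metric_of_class A L r h \<and> semipositive_curvature A L h"
  then obtain h where h: "hermitian_metric L h" "metric_of_class A L r h" "semipositive_curvature A L h"
    by blast
  interpret holomorphic_bundle_subset X A Y L
    using assms(1,2,4) by unfold_locales (auto simp: complex_submanifold_def)
  obtain \<T> where "unitary_trivializations X A Y L \<T>"
    using assms(5) by (rule unitary_flat_trivializations)
  then interpret unitary_trivializations X A Y L \<T> .
  have "C2_on (\<phi> ` (fst t \<inter> W)) (\<lambda>z. weight L h t (inv_into W \<phi> z))"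
    if "t \<in> bundle_trivs L" "(W, \<phi>) \<in> A" for t W \<phi>
    using h(2) that assms(6) unfolding metric_of_class_def by (blast intro: Cr_on_imp_C2_on)
  then interpret flat_semipositive_bundle X A Y L h "flat_square_norm h"
    using assms(2,3) h flat_square_norm_frame by unfold_locales auto
  show False using ueda_class_trivial assms(7) by contradiction
qed

end
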